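(* There exist constants $c_1,c_2$ such that the $d$-quasi-forest deletion problem (given a graph $G$ on $n$ vertices and integers $k,d$, decide whether there is $X \subseteq V(G)$ with $|X| \le k$ such that $G - X$ is a $d$-quasi-forest) can be solved in time $O^*\!\left({c_1^{(k+d)}}^{\,c_2(k+d)}\right)$.
   Context: A $d$-quasi-forest is a graph in which each connected component admits a feedback vertex set (a vertex set whose deletion leaves an acyclic graph) of size at most $d$. The $O^*$ notation suppresses factors polynomial in $n$. *)

theory Defs
  imports
    "Graph_Theory.Digraph_Component"
    "HOL-Computational_Algebra.Polynomial"
begin

section \<open>Quasi-forests\<close>

text \<open>
  Undirected simple graphs are finite loop-free symmetric digraphs (the locales \<open>graph\<close> and
  \<open>pair_graph\<close>), in which every edge is a pair of opposite arcs. For them the strongly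
  connected components \<open>pre_digraph.sccs\<close> are the connected components. The library's
  \<open>forest\<close> is not usable here: traversing an edge back and forth is a \<open>pre_digraph.cycle\<close>
  of length two. The cycles of the undirected graph are those of length at least three.
\<close>

definition acyclic_graph :: "('a, 'b) pre_digraph \<Rightarrow> bool" where
  "acyclic_graph G \<longleftrightarrow> \<not> (\<exists>p. pre_digraph.cycle G p \<and> 3 \<le> length p)"

definition delete_verts :: "('a, 'b) pre_digraph \<Rightarrow> 'a set \<Rightarrow> ('a, 'b) pre_digraph" where
  "delete_verts G X = G \<restriction> (verts G - X)"

definition feedback_vertex_set :: "('a, 'b) pre_digraph \<Rightarrow> 'a set \<Rightarrow> bool" where
  "feedback_vertex_set G F \<longleftrightarrow> F \<subseteq> verts G \<and> acyclic_graph (delete_verts G F)"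

definition quasi_forest :: "nat \<Rightarrow> ('a, 'b) pre_digraph \<Rightarrow> bool" where
  "quasi_forest d G \<longleftrightarrow>
     (\<forall>C \<in> pre_digraph.sccs G. \<exists>F. feedback_vertex_set C F \<and> finite F \<and> card F \<le> d)"

definition quasi_forest_deletion :: "('a, 'b) pre_digraph \<Rightarrow> nat \<Rightarrow> nat \<Rightarrow> bool" where
  "quasi_forest_deletion G k d \<longleftrightarrow>
     (\<exists>X \<subseteq> verts G. finite X \<and> card X \<le> k \<and> quasi_forest d (delete_verts G X))"


section \<open>Random access machines\<close>

text \<open>
  The machine model is the random access machine with addition and truncated subtraction under
  the uniform cost measure, programmed in structured form. A program uses finitely many
  memories, each an infinite sequence of cells holding natural numbers; \<open>s a i\<close> is the content
  of cell \<open>i\<close> of memory \<open>a\<close>, and addresses may be computed (indirect addressing). There is no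
  multiplication, so in \<open>t\<close> steps the bit length of the largest number grows by at most
  \<open>t\<close> plus a constant depending on the program; hence uniform and logarithmic cost, and Turing
  machine time, are polynomially related.
\<close>

type_synonym state = "nat \<Rightarrow> nat \<Rightarrow> nat"

datatype expr =
    Const nat
  | Read nat expr
  | Add expr expr
  | Sub expr expr

primrec eval_expr :: "expr \<Rightarrow> state \<Rightarrow> nat" where
  "eval_expr (Const c) s = c"
| "eval_expr (Read a e) s = s a (eval_expr e s)"
| "eval_expr (Add e f) s = eval_expr e s + eval_expr f s"
| "eval_expr (Sub e f) s = eval_expr e s - eval_expr f s"

primrec cost :: "expr \<Rightarrow> nat" where
  "cost (Const c) = 1"
| "cost (Read a e) = Suc (cost e)"
| "cost (Add e f) = Suc (cost e + cost f)"
| "cost (Sub e f) = Suc (cost e + cost f)"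

datatype program =
    SKIP
  | WRITE nat expr expr
  | SEQ program program
  | IF expr program program
  | WHILE expr program

text \<open>
  \<open>exec P s t s'\<close>: started in \<open>s\<close>, \<open>P\<close> halts after exactly \<open>t\<close> steps in \<open>s'\<close>. A test succeeds
  if its value is nonzero.
\<close>

inductive exec :: "program \<Rightarrow> state \<Rightarrow> nat \<Rightarrow> state \<Rightarrow> bool" where
  exec_SKIP: "exec SKIP s 1 s"
| exec_WRITE: "exec (WRITE a e f) s (1 + cost e + cost f)
    (s(a := (s a)(eval_expr e s := eval_expr f s)))"
| exec_SEQ: "exec P s t s' \<Longrightarrow> exec Q s' u s'' \<Longrightarrow> exec (SEQ P Q) s (t + u) s''"
| exec_IF_True: "eval_expr e s \<noteq> 0 \<Longrightarrow> exec P s t s' \<Longrightarrow> exec (IF e P Q) s (1 + cost e + t) s'"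
| exec_IF_False: "eval_expr e s = 0 \<Longrightarrow> exec Q s t s' \<Longrightarrow> exec (IF e P Q) s (1 + cost e + t) s'"
| exec_WHILE_False: "eval_expr e s = 0 \<Longrightarrow> exec (WHILE e P) s (1 + cost e) s"
| exec_WHILE_True: "eval_expr e s \<noteq> 0 \<Longrightarrow> exec P s t s' \<Longrightarrow> exec (WHILE e P) s' u s'' \<Longrightarrow>
    exec (WHILE e P) s (1 + cost e + t + u) s''"

inductive_cases SKIP_E: "exec SKIP s t s'"
inductive_cases WRITE_E: "exec (WRITE a e f) s t s'"
inductive_cases SEQ_E: "exec (SEQ P Q) s t s'"
inductive_cases IF_E: "exec (IF e P Q) s t s'"
inductive_cases WHILE_E: "exec (WHILE e P) s t s'"

lemma exec_deterministic:
  "exec P s t s' \<Longrightarrow> exec P s u s'' \<Longrightarrow> t = u \<and> s' = s''"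
proof (induction arbitrary: u s'' rule: exec.induct)
  case (exec_SKIP s)
  then show ?case by (rule SKIP_E) simp
next
  case (exec_WRITE a e f s)
  then show ?case by (rule WRITE_E) simp
next
  case (exec_SEQ P s t s' Q u' s1)
  from exec_SEQ.prems show ?case
  proof (rule SEQ_E)
    fix t2 s2 u2
    assume *: "u = t2 + u2" "exec P s t2 s2" "exec Q s2 u2 s''"
    have "t = t2 \<and> s' = s2" by (rule exec_SEQ.IH(1)) fact
    moreover from this *(3) have "u' = u2 \<and> s1 = s''" by (intro exec_SEQ.IH(2)) simp
    ultimately show ?thesis using *(1) by simp
  qed
next
  case (exec_IF_True e s P t s' Q)
  from exec_IF_True.prems show ?case
  proof (rule IF_E)
    fix t2
    assume "u = Suc (cost e + t2)" "exec P s t2 s''"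
    with exec_IF_True.IH [of t2 s''] show ?thesis by simp
  qed (use exec_IF_True.hyps in simp)
next
  case (exec_IF_False e s Q t s' P)
  from exec_IF_False.prems show ?case
  proof (rule IF_E)
    fix t2
    assume "u = Suc (cost e + t2)" "exec Q s t2 s''"
    with exec_IF_False.IH [of t2 s''] show ?thesis by simp
  qed (use exec_IF_False.hyps in simp)
next
  case (exec_WHILE_False e s P)
  from exec_WHILE_False.prems show ?case
    by (rule WHILE_E) (use exec_WHILE_False.hyps in simp_all)
next
  case (exec_WHILE_True e s P t s' u' s1)
  from exec_WHILE_True.prems show ?case
  proof (rule WHILE_E)
    fix t2 s2 u2
    assume *: "u = Suc (cost e + t2 + u2)" "exec P s t2 s2" "exec (WHILE e P) s2 u2 s''"
    have "t = t2 \<and> s' = s2" by (rule exec_WHILE_True.IH(1)) fact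
    moreover from this *(3) have "u' = u2 \<and> s1 = s''" by (intro exec_WHILE_True.IH(2)) simp
    ultimately show ?thesis using *(1) by simp
  qed (use exec_WHILE_True.hyps in simp)
qed

text \<open>The answer is left in cell 0 of memory 0.\<close>

definition decides_within :: "program \<Rightarrow> state \<Rightarrow> bool \<Rightarrow> nat \<Rightarrow> bool" where
  "decides_within P s answer T \<longleftrightarrow>
     (\<exists>t s'. exec P s t s' \<and> t \<le> T \<and> s' 0 0 = (if answer then 1 else 0))"

text \<open>
  Memory 0 holds the number of vertices and the two parameters, memory 1 the adjacency matrix in
  row-major order; every other cell is 0.
\<close>

definition encode_instance :: "nat \<Rightarrow> nat pair_pre_digraph \<Rightarrow> nat \<Rightarrow> nat \<Rightarrow> state" where
  "encode_instance n G k d = (\<lambda>a i.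
     if a = 0 then (if i = 0 then n else if i = 1 then k else if i = 2 then d else 0)
     else if a = 1 then (if \<exists>u<n. \<exists>v<n. i = u * n + v \<and> (u, v) \<in> parcs G then 1 else 0)
     else 0)"


section \<open>Running times up to polynomial factors\<close>

text \<open>
  \<open>T n k d\<close> is the running time bound for \<open>n\<close> vertices and parameters \<open>k\<close> and \<open>d\<close>; one
  polynomial in \<open>n\<close> serves all values of the parameters.
\<close>

definition O_star :: "(nat \<Rightarrow> nat \<Rightarrow> nat) \<Rightarrow> (nat \<Rightarrow> nat \<Rightarrow> nat \<Rightarrow> nat) set" where
  "O_star g = {T. \<exists>p :: nat poly. \<forall>n k d. T n k d \<le> g k d * poly p n}"

text \<open>
  A bound of the form \<open>(c\<^sub>1 ^ m) ^ (c\<^sub>2 * m)\<close> is also one of the form \<open>a ^ (m ^ (b * m))\<close>.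
\<close>

lemma iterated_power_le_power_tower:
  fixes c1 c2 :: nat
  obtains a b :: nat where "\<And>m :: nat. (c1 ^ m) ^ (c2 * m) \<le> a ^ (m ^ (b * m))"
proof
  fix m :: nat
  consider "m = 0" | "m = 1" | "2 \<le> m"
    by linarith
  then have m: "m * m \<le> m ^ m"
  proof cases
    case 3
    then show ?thesis
      using power_increasing [of 2 m m] by (simp add: power2_eq_square)
  qed simp_all
  have "(c1 ^ m) ^ (c2 * m) = (c1 ^ c2) ^ (m * m)"
    unfolding power_mult [symmetric] by (rule arg_cong [where f = "power c1"]) simp
  also have "\<dots> \<le> Suc (c1 ^ c2) ^ (m * m)"
    by (rule power_mono) auto
  also have "\<dots> \<le> Suc (c1 ^ c2) ^ (m ^ (1 * m))"
    unfolding mult_1 by (rule power_increasing [OF m]) simp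
  finally show "(c1 ^ m) ^ (c2 * m) \<le> Suc (c1 ^ c2) ^ (m ^ (1 * m))" .
qed

end

(*
Iterative compression with exhaustive guessing. Vertices are inserted one by one, and a
solution (X, F) is kept that minimises |X| first and |F| second, where X is the deleted set and
F collects the feedback vertices of the components. When x is inserted, guess the roles of the
vertices in X and of x; components not attached to a kept one of them keep their old roles.
Minimality bounds the number of attached vertices of F by (2k+1)d, so their roles can be guessed
too, and the remaining vertices induce a forest. Absorb leaves of that forest as long as the
hanging subtree is light: at most one edge to forest vertices, and all decided neighbours in one
piece. A non-light subtree with root v leaves three choices: delete v, put v into F, or keep the
whole subtree in the forest; a potential of order (k+1)(d+1) decreases each time. Hence 3-ary
strings of length 10(k+1)(d+1) suffice as guesses, and they are enumerated by a machine program.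
*)
theory Submission
  imports Defs
begin


section \<open>Connectivity and acyclicity\<close>

text \<open>Soundness is free: every candidate read off a guess string is checked before it is
  stored, so only completeness has to be proved, that is, some string leads to a cheapest solution.
  The obstacle is that a string cannot name what the optimum does inside a hanging subtree. Hence
  the target (X, F) is modified on the way: whatever it deletes or takes as feedback in the subtree
  is exchanged for the root, and neither set grows. The potential counts the components of kept
  vertices that still touch an open vertex twice, those of kept forest vertices once, and the
  vertices of the target without a role; the factor two pays for a forest component that keeping a
  subtree may create. The number (2k+1)d is (k+1)d, for the components that contain one of the k+1
  first guessed vertices, plus kd, for the old components hit by the new deletions. A string then
  needs 5k+4+(10k+5)d symbols, at most 10(k+1)(d+1). With m = k+d this is at most 10+30m^2, so 3 to
  this power, raised to the fixed loop depth of the program, fits the required form with c_2 =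
  1.\<close>

locale ugraph =
  fixes E :: "'a \<Rightarrow> 'a \<Rightarrow> bool"
  assumes E_sym: "E x y \<Longrightarrow> E y x"
    and E_irrefl: "\<not> E x x"
begin

text \<open>The reflexive closure relates every vertex to itself, even outside \<open>S\<close>; the
  conjunct \<open>x \<in> S\<close> removes those pairs.\<close>

definition conn :: "'a set \<Rightarrow> 'a \<Rightarrow> 'a \<Rightarrow> bool" where
  "conn S x y \<longleftrightarrow> x \<in> S \<and> (\<lambda>x y. x \<in> S \<and> y \<in> S \<and> E x y)\<^sup>*\<^sup>* x y"

definition comp :: "'a set \<Rightarrow> 'a \<Rightarrow> 'a set" where
  "comp S x = {y. conn S x y}"

lemma conn_refl: "x \<in> S \<Longrightarrow> conn S x x"
  by (simp add: conn_def)

lemma conn_step: "conn S x y \<Longrightarrow> E y z \<Longrightarrow> z \<in> S \<Longrightarrow> conn S x z"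
proof -
  assume a: "conn S x y" "E y z" "z \<in> S"
  have "y \<in> S"
    using a(1) unfolding conn_def by (metis (no_types, lifting) rtranclp.cases)
  with a show ?thesis
    unfolding conn_def by (auto intro: rtranclp.rtrancl_into_rtrancl)
qed

lemma conn_induct [consumes 1, case_names base step]:
  assumes "conn S x y"
    and "x \<in> S \<Longrightarrow> P x"
    and "\<And>y z. conn S x y \<Longrightarrow> P y \<Longrightarrow> y \<in> S \<Longrightarrow> E y z \<Longrightarrow> z \<in> S \<Longrightarrow> P z"
  shows "P y"
proof -
  have x: "x \<in> S" and r: "(\<lambda>x y. x \<in> S \<and> y \<in> S \<and> E x y)\<^sup>*\<^sup>* x y"
    using assms(1) by (auto simp: conn_def)
  from r show ?thesis
  proof (induction rule: rtranclp_induct)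
    case base
    then show ?case using assms(2) x by blast
  next
    case (step y z)
    then have "conn S x y" using x by (simp add: conn_def)
    then show ?case using step assms(3) by blast
  qed
qed

lemma conn_in: "conn S x y \<Longrightarrow> x \<in> S \<and> y \<in> S"
  by (induction rule: conn_induct) (auto simp: conn_def)

lemma conn_trans:
  assumes "conn S x y" "conn S y z" shows "conn S x z"
  using assms(2) by (induction rule: conn_induct) (use assms(1) conn_step in \<open>simp, blast\<close>)

lemma conn_edge: "E x y \<Longrightarrow> x \<in> S \<Longrightarrow> y \<in> S \<Longrightarrow> conn S x y"
  by (rule conn_step [OF conn_refl])

lemma conn_sym: "conn S x y \<Longrightarrow> conn S y x"
proof (induction rule: conn_induct)
  case (step y z)
  then have "conn S z y" using E_sym conn_edge by blast
  then show ?case using step.IH conn_trans by blast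
qed (simp add: conn_refl)

lemma conn_mono: "conn S x y \<Longrightarrow> S \<subseteq> S' \<Longrightarrow> conn S' x y"
proof (induction rule: conn_induct)
  case (step y z)
  then show ?case by (meson conn_step subsetD)
qed (auto simp: conn_refl)

lemma conn_closed:
  assumes "conn S x y" "x \<in> Q" "\<And>u w. u \<in> Q \<Longrightarrow> u \<in> S \<Longrightarrow> w \<in> S \<Longrightarrow> E u w \<Longrightarrow> w \<in> Q"
  shows "conn (S \<inter> Q) x y \<and> y \<in> Q"
  using assms(1)
proof (induction rule: conn_induct)
  case base
  then show ?case using assms(2) by (auto intro: conn_refl)
next
  case (step y z)
  then have "z \<in> S \<inter> Q" using assms(3)[of y z] by blast
  then show ?case using step by (metis conn_step IntD2)
qed

lemma in_comp [simp]: "y \<in> comp S x \<longleftrightarrow> conn S x y"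
  by (simp add: comp_def)

lemma comp_subset: "comp S x \<subseteq> S"
  using conn_in by auto

lemma comp_eq: "conn S x y \<Longrightarrow> comp S x = comp S y"
  unfolding comp_def by (intro Collect_cong) (blast intro: conn_trans conn_sym)

lemma comp_eq_iff: "x \<in> S \<Longrightarrow> comp S x = comp S y \<longleftrightarrow> conn S x y"
  using comp_eq [of S x y] in_comp [of x S x] in_comp [of x S y] conn_refl conn_sym by blast

lemma comp_connected: "conn S x y \<Longrightarrow> conn (comp S x) x y"
proof (induction rule: conn_induct)
  case (step y z)
  then have "z \<in> comp S x" using conn_step[of S x y z] by simp
  then show ?case using step by (metis conn_step)
qed (simp add: conn_refl)

section \<open>Forests through vertices of degree at most one\<close>

definition low :: "'a set \<Rightarrow> 'a \<Rightarrow> bool" where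
  "low S v \<longleftrightarrow> (\<forall>u\<in>S. \<forall>w\<in>S. E v u \<longrightarrow> E v w \<longrightarrow> u = w)"

text \<open>This is 1-degeneracy: on a cycle every vertex has two neighbours, and a finite set
  without low vertices contains a cycle. The form avoids walks and suits both induction and the
  stripping of leaves by a program; \<open>acyclic_graph_H\<close> links it to cycles.\<close>

definition acyc :: "'a set \<Rightarrow> bool" where
  "acyc S \<longleftrightarrow> (\<forall>S'. S' \<subseteq> S \<longrightarrow> S' \<noteq> {} \<longrightarrow> (\<exists>v\<in>S'. low S' v))"

lemma acyc_mono: "acyc S \<Longrightarrow> S' \<subseteq> S \<Longrightarrow> acyc S'"
  unfolding acyc_def by (meson order_trans)

lemma low_mono: "low S v \<Longrightarrow> S' \<subseteq> S \<Longrightarrow> low S' v"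
  unfolding low_def by blast

text \<open>Removing a low vertex \<open>v\<close> leaves two low vertices by induction. As
  \<open>v\<close> has at most one neighbour, one of them is not adjacent to \<open>v\<close> and
  stays low; \<open>v\<close> itself is the other. With only two vertices left, both are
  low.\<close>

lemma acyc_two_low:
  assumes "acyc S" "finite S" "a \<in> S" "b \<in> S" "a \<noteq> b"
  shows "\<exists>u\<in>S. \<exists>v\<in>S. u \<noteq> v \<and> low S u \<and> low S v"
  using assms
proof (induction "card S" arbitrary: S a b rule: less_induct)
  case less
  obtain v where v: "v \<in> S" "low S v"
    using less.prems unfolding acyc_def by blast
  show ?case
  proof (cases "\<exists>x y. x \<in> S - {v} \<and> y \<in> S - {v} \<and> x \<noteq> y")
    case True
    then obtain x y where xy: "x \<in> S - {v}" "y \<in> S - {v}" "x \<noteq> y" by blast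
    have "card (S - {v}) < card S"
      using v less.prems by (intro psubset_card_mono) auto
    then obtain p q where pq: "p \<in> S - {v}" "q \<in> S - {v}" "p \<noteq> q" "low (S - {v}) p" "low (S - {v}) q"
      using less.hyps[of "S - {v}" x y] less.prems xy acyc_mono[of S "S - {v}"] by auto
    have "\<not> (E v p \<and> E v q)" using v pq unfolding low_def by blast
    then consider "\<not> E p v" | "\<not> E q v" using E_sym by blast
    then show ?thesis
    proof cases
      case 1
      then have "low S p" using pq unfolding low_def by (metis Diff_iff insertE empty_iff)
      then show ?thesis using pq v by blast
    next
      case 2
      then have "low S q" using pq unfolding low_def by (metis Diff_iff insertE empty_iff)
      then show ?thesis using pq v by blast
    qed
  next
    case False
    obtain w where w: "w \<in> S" "w \<noteq> v" using less.prems by metis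
    then have "S = {v, w}" using False v by blast
    then have "low S w" unfolding low_def using E_irrefl by auto
    then show ?thesis using v w by blast
  qed
qed

text \<open>Each component of \<open>B\<close> hangs on \<open>A\<close> by at most one edge. A
  subset meeting \<open>B\<close> has a low vertex there: a component of \<open>S \<inter> B\<close>
  is a single vertex or has two low vertices, and only one of these can carry the edge to
  \<open>A\<close>.\<close>

lemma acyc_union:
  assumes A: "acyc A" and B: "acyc B" "finite B" and disj: "A \<inter> B = {}"
    and one: "\<And>t t' a a'. conn B t t' \<Longrightarrow> a \<in> A \<Longrightarrow> a' \<in> A \<Longrightarrow> E t a \<Longrightarrow> E t' a' \<Longrightarrow> t = t' \<and> a = a'"
  shows "acyc (A \<union> B)"
  unfolding acyc_def
proof (intro allI impI)
  fix S assume S: "S \<subseteq> A \<union> B" "S \<noteq> {}"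
  show "\<exists>v\<in>S. low S v"
  proof (cases "S \<inter> B = {}")
    case True
    then show ?thesis using S A unfolding acyc_def by blast
  next
    case False
    then obtain b where b: "b \<in> S \<inter> B" by blast
    define K where "K = comp (S \<inter> B) b"
    have bK: "b \<in> K" using b by (simp add: K_def conn_refl)
    have KS: "K \<subseteq> S \<inter> B" unfolding K_def by (rule comp_subset)
    have connK: "conn B x y" if "x \<in> K" "y \<in> K" for x y
    proof -
      have "conn (S \<inter> B) x y" using that conn_sym conn_trans unfolding K_def by (metis in_comp)
      then show ?thesis by (rule conn_mono) blast
    qed
    have nbr: "y \<in> K \<or> y \<in> A" if "x \<in> K" "y \<in> S" "E x y" for x y
      using that S conn_step[of "S \<inter> B" b x y] unfolding K_def by auto
    show ?thesis
    proof (cases "K = {b}")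
      case True
      have "u \<in> A" if "u \<in> S" "E b u" for u using nbr[of b u] that bK True E_irrefl by auto
      then have "low S b" unfolding low_def using one[of b b] connK bK by blast
      then show ?thesis using b by blast
    next
      case False
      then obtain c where "c \<in> K" "c \<noteq> b" using bK by blast
      moreover have "acyc K" "finite K" using B KS by (auto intro: acyc_mono finite_subset)
      ultimately obtain p q where pq: "p \<in> K" "q \<in> K" "p \<noteq> q" "low K p" "low K q"
        using acyc_two_low[of K c b] bK by blast
      have "\<not> ((\<exists>u\<in>A. E p u) \<and> (\<exists>u\<in>A. E q u))"
        using one[of p q] connK pq by blast
      then consider "\<forall>u\<in>A. \<not> E p u" | "\<forall>u\<in>A. \<not> E q u" by blast
      then show ?thesis
      proof cases
        case 1
        then have "low S p" using pq nbr[of p] unfolding low_def by blast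
        then show ?thesis using pq KS by blast
      next
        case 2
        then have "low S q" using pq nbr[of q] unfolding low_def by blast
        then show ?thesis using pq KS by blast
      qed
    qed
  qed
qed

text \<open>A walk enters and leaves a low vertex through the same neighbour, so the visit can be
  cut out.\<close>

lemma conn_remove_low:
  assumes "conn S x y" "low S v" "x \<noteq> v" "y \<noteq> v"
  shows "conn (S - {v}) x y"
proof -
  \<comment> \<open>The second conjunct carries the induction across a visit to \<open>v\<close>: at
    that moment the only neighbour of \<open>v\<close> has been reached without
    \<open>v\<close>.\<close>
  have "(y \<noteq> v \<longrightarrow> conn (S - {v}) x y) \<and> (y = v \<longrightarrow> (\<forall>u\<in>S. E v u \<longrightarrow> conn (S - {v}) x u))"
    using assms(1)
  proof (induction rule: conn_induct)
    case base
    then show ?case using assms(3) by (auto intro: conn_refl)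
  next
    case (step y z)
    show ?case
    proof (cases "z = v")
      case True
      then have "y \<noteq> v" using step E_irrefl by auto
      moreover have "E v y" using step.hyps(3) True by (simp add: E_sym)
      then have "u = y" if "u \<in> S" "E v u" for u
        using assms(2) step.hyps(2) that unfolding low_def by blast
      ultimately show ?thesis using True step by blast
    next
      case False
      then have "z \<in> S - {v}" using step by blast
      then show ?thesis using step False by (metis conn_step)
    qed
  qed
  then show ?thesis using assms by blast
qed

text \<open>Two edges between connected sets would close a cycle. The induction deletes a low vertex
  \<open>v\<close> of the union: if its side has another vertex, connectivity uses up the only
  neighbour of \<open>v\<close> on that side, so neither edge ends in \<open>v\<close>.\<close>

lemma acyc_one_edge:
  assumes "acyc (A \<union> B)" "finite A" "finite B" "A \<inter> B = {}"
    and "\<And>x y. x \<in> A \<Longrightarrow> y \<in> A \<Longrightarrow> conn A x y" "\<And>x y. x \<in> B \<Longrightarrow> y \<in> B \<Longrightarrow> conn B x y"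
    and "a \<in> A" "b \<in> B" "E a b" "a' \<in> A" "b' \<in> B" "E a' b'"
  shows "a = a' \<and> b = b'"
  using assms
proof (induction "card A + card B" arbitrary: A B a a' b b' rule: less_induct)
  case less
  show ?case
  proof (rule ccontr)
    assume neg: "\<not> ?thesis"
    \<comment> \<open>\<open>red\<close> takes its own sets and induction hypothesis, so that it
      also serves with the two sides exchanged when \<open>v\<close> lies in
      \<open>B\<close>.\<close>
    have red: False if l: "low (A \<union> B) v" "v \<in> A"
      and wlog: "acyc (A \<union> B)" "finite A" "finite B" "A \<inter> B = {}"
        "\<And>x y. x \<in> A \<Longrightarrow> y \<in> A \<Longrightarrow> conn A x y" "\<And>x y. x \<in> B \<Longrightarrow> y \<in> B \<Longrightarrow> conn B x y"
        "a \<in> A" "b \<in> B" "E a b" "a' \<in> A" "b' \<in> B" "E a' b'" "\<not> (a = a' \<and> b = b')"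
      and IH: "\<And>A' B' a b a' b'. card A' + card B' < card A + card B \<Longrightarrow> acyc (A' \<union> B') \<Longrightarrow> finite A' \<Longrightarrow> finite B' \<Longrightarrow> A' \<inter> B' = {}
        \<Longrightarrow> (\<And>x y. x \<in> A' \<Longrightarrow> y \<in> A' \<Longrightarrow> conn A' x y) \<Longrightarrow> (\<And>x y. x \<in> B' \<Longrightarrow> y \<in> B' \<Longrightarrow> conn B' x y)
        \<Longrightarrow> a \<in> A' \<Longrightarrow> b \<in> B' \<Longrightarrow> E a b \<Longrightarrow> a' \<in> A' \<Longrightarrow> b' \<in> B' \<Longrightarrow> E a' b' \<Longrightarrow> a = a' \<and> b = b'"
      for A B a b a' b' v
    proof (cases "A = {v}")
      case True
      then show False using l wlog unfolding low_def by blast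
    next
      case False
      then obtain w where w: "w \<in> A" "w \<noteq> v" using l by blast
      have "\<exists>u\<in>A. E v u"
      proof (rule ccontr)
        assume "\<not> ?thesis"
        then have "w \<in> {v}" using conn_closed[of A v w "{v}"] wlog(5)[of v w] l w by auto
        then show False using w by simp
      qed
      then obtain u where u: "u \<in> A" "E v u" by blast
      have nv: "a \<noteq> v" "a' \<noteq> v" using l u wlog unfolding low_def by blast+
      have lA: "low A v" using l low_mono by blast
      have c1: "card (A - {v}) < card A" using l wlog by (intro psubset_card_mono) auto
      have "a = a' \<and> b = b'"
      proof (rule IH[of "A - {v}" B])
        show "card (A - {v}) + card B < card A + card B" using c1 by simp
        show "acyc (A - {v} \<union> B)" using wlog(1) by (rule acyc_mono) auto
        show "conn (A - {v}) x y" if "x \<in> A - {v}" "y \<in> A - {v}" for x y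
          using conn_remove_low[of A x y v] wlog(5) lA that by auto
      qed (use wlog nv in auto)
      then show False using wlog by blast
    qed
    obtain v where v: "v \<in> A \<union> B" "low (A \<union> B) v"
      using less.prems(1,7) unfolding acyc_def by blast
    show False
    proof (cases "v \<in> A")
      case True
      show False
        by (rule red[of A B v a b a' b'])
           (use v(2) True less.prems neg less.hyps in \<open>blast+\<close>)
    next
      case False
      then have vB: "v \<in> B" using v by blast
      show False
      proof (rule red[of B A v b a b' a'])
        show "a2 = a3 \<and> b2 = b3"
          if "card A' + card B' < card B + card A" "acyc (A' \<union> B')" "finite A'" "finite B'" "A' \<inter> B' = {}"
            "\<And>x y. x \<in> A' \<Longrightarrow> y \<in> A' \<Longrightarrow> conn A' x y" "\<And>x y. x \<in> B' \<Longrightarrow> y \<in> B' \<Longrightarrow> conn B' x y"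
            "a2 \<in> A'" "b2 \<in> B'" "E a2 b2" "a3 \<in> A'" "b3 \<in> B'" "E a3 b3" for A' B' a2 b2 a3 b3
          by (rule less.hyps[of A' B']) (use that in \<open>simp_all add: add.commute\<close>)
      qed (use v(2) vB less.prems neg E_sym in \<open>auto simp: Un_commute Int_commute\<close>)
    qed
  qed
qed

text \<open>A detour through a component of \<open>B\<close> leaves and re-enters \<open>S\<close>
  at vertices that are already connected in \<open>S\<close>, so \<open>B\<close> creates no new
  connection.\<close>

lemma conn_bypass:
  assumes "conn (S \<union> B) x y" "x \<in> S" "y \<in> S" "S \<inter> B = {}"
    and nb: "\<And>t t' p p'. conn B t t' \<Longrightarrow> p \<in> S \<Longrightarrow> p' \<in> S \<Longrightarrow> E t p \<Longrightarrow> E t' p' \<Longrightarrow> conn S p p'"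
  shows "conn S x y"
proof -
  \<comment> \<open>While the walk is inside \<open>B\<close>, every exit of the current component
    of \<open>B\<close> counts as reached, not just the exit that is taken later.\<close>
  have "(y \<in> S \<longrightarrow> conn S x y) \<and> (y \<in> B \<longrightarrow> (\<forall>t p. conn B y t \<longrightarrow> p \<in> S \<longrightarrow> E t p \<longrightarrow> conn S x p))"
    using assms(1)
  proof (induction rule: conn_induct)
    case base
    then show ?case using assms by (auto intro: conn_refl)
  next
    case (step y z)
    show ?case
    proof (cases "z \<in> S")
      case True
      then have "z \<notin> B" using assms(4) by blast
      moreover have "conn S x z"
      proof (cases "y \<in> S")
        case True
        then show ?thesis using step \<open>z \<in> S\<close> by (metis conn_step)
      next
        case False
        then have "y \<in> B" using step.hyps(2) by blast
        then show ?thesis using step.IH step.hyps(3) \<open>z \<in> S\<close> conn_refl by blast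
      qed
      ultimately show ?thesis by blast
    next
      case False
      then have z: "z \<in> B" using step by blast
      have "conn S x p" if "conn B z t" "p \<in> S" "E t p" for t p
      proof (cases "y \<in> S")
        case True
        then have "conn S y p" using nb[of z t y p] that step E_sym by blast
        moreover have "conn S x y" using step.IH True by blast
        ultimately show ?thesis using conn_trans by blast
      next
        case False
        then have "y \<in> B" using step by blast
        then show ?thesis using step that z by (meson conn_edge conn_trans)
      qed
      then show ?thesis using False by blast
    qed
  qed
  then show ?thesis using assms by blast
qed

end

section \<open>Solutions and branching\<close>

context ugraph
begin

text \<open>One global \<open>F\<close>, counted per component, stands for the separate feedback
  sets of the components; \<open>sol_iff_comps\<close> proves the equivalence.\<close>

definition sol :: "nat \<Rightarrow> 'a set \<Rightarrow> 'a set \<Rightarrow> 'a set \<Rightarrow> bool" where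
  "sol d V X F \<longleftrightarrow> X \<subseteq> V \<and> F \<subseteq> V \<and> X \<inter> F = {} \<and> acyc (V - X - F) \<and>
     (\<forall>v\<in>V - X. card (F \<inter> comp (V - X) v) \<le> d)"

text \<open>\<open>S\<close> is a part of what an old solution keeps, and the forest
  \<open>B\<close> is attached to it. The assumption \<open>one\<close> gives acyclicity through
  \<open>acyc_union\<close>; the assumption \<open>nb\<close> prevents components of
  \<open>S\<close> from being joined, through \<open>conn_bypass\<close>, so no component gets more
  vertices of \<open>F\<close> than before.\<close>

lemma sol_absorb:
  assumes sol: "sol d V X F" and V: "finite V" and S: "S \<subseteq> V - X" and B: "B \<subseteq> V" "S \<inter> B = {}" "acyc B"
    and one: "\<And>t t' p p'. conn B t t' \<Longrightarrow> p \<in> S - F \<Longrightarrow> p' \<in> S - F \<Longrightarrow> E t p \<Longrightarrow> E t' p' \<Longrightarrow> t = t' \<and> p = p'"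
    and nb: "\<And>t t' p p'. conn B t t' \<Longrightarrow> p \<in> S \<Longrightarrow> p' \<in> S \<Longrightarrow> E t p \<Longrightarrow> E t' p' \<Longrightarrow> conn S p p'"
  shows "sol d V (V - S - B) (F \<inter> S)"
  unfolding sol_def
proof (intro conjI ballI)
  have eq: "V - (V - S - B) = S \<union> B" using S B by blast
  have "acyc ((S - F) \<union> B)"
  proof (rule acyc_union)
    show "acyc (S - F)" using sol S unfolding sol_def by (blast intro: acyc_mono)
    show "finite B" using V B finite_subset by blast
  qed (use B one in \<open>blast+\<close>)
  then show "acyc (V - (V - S - B) - (F \<inter> S))"
    unfolding eq by (rule acyc_mono) blast
  fix v assume "v \<in> V - (V - S - B)"
  show "card (F \<inter> S \<inter> comp (V - (V - S - B)) v) \<le> d"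
  proof (cases "F \<inter> S \<inter> comp (S \<union> B) v = {}")
    case True
    then show ?thesis by (simp add: eq)
  next
    case False
    then obtain f where f: "f \<in> F" "f \<in> S" "conn (S \<union> B) v f" by auto
    have "F \<inter> S \<inter> comp (S \<union> B) v \<subseteq> F \<inter> comp (V - X) f"
    proof
      fix x assume x: "x \<in> F \<inter> S \<inter> comp (S \<union> B) v"
      then have "conn (S \<union> B) f x" using f conn_sym conn_trans in_comp by blast
      then have "conn S f x" by (rule conn_bypass) (use x f B nb in blast)+
      then show "x \<in> F \<inter> comp (V - X) f" using x S conn_mono by auto
    qed
    then have "card (F \<inter> S \<inter> comp (S \<union> B) v) \<le> card (F \<inter> comp (V - X) f)"
      using V sol unfolding sol_def by (intro card_mono) (auto intro: finite_subset)
    also have "\<dots> \<le> d" using sol f S unfolding sol_def by blast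
    finally show ?thesis by (simp add: eq)
  qed
qed (use S sol in \<open>auto simp: sol_def\<close>)

text \<open>\<open>W\<close> will be the kept forest vertices and \<open>K\<close> all kept
  vertices. The first clause is what adding \<open>T\<close> needs in order to stay acyclic, the
  second what it needs in order not to join components.\<close>

definition light :: "'a set \<Rightarrow> 'a set \<Rightarrow> 'a set \<Rightarrow> bool" where
  "light W K T \<longleftrightarrow>
     (\<forall>t\<in>T. \<forall>t'\<in>T. \<forall>w\<in>W. \<forall>w'\<in>W. E t w \<longrightarrow> E t' w' \<longrightarrow> t = t' \<and> w = w') \<and>
     (\<forall>t\<in>T. \<forall>t'\<in>T. \<forall>p\<in>K. \<forall>p'\<in>K. E t p \<longrightarrow> E t' p' \<longrightarrow> conn K p p')"

text \<open>Roles: 0 undecided, 1 absorbed, 2 deleted, 3 feedback, 4 kept in the forest, 5 absent.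
  The fate of an absorbed vertex is postponed, because a light component can be added at the end to
  whatever is kept. The last clause says that an absorbed component hangs on at most one undecided
  vertex.\<close>

definition inv :: "('a \<Rightarrow> nat) \<Rightarrow> bool" where
  "inv r \<longleftrightarrow> finite {x. r x \<le> 4} \<and> acyc {x. r x \<le> 1} \<and>
     (\<forall>a. r a = 1 \<longrightarrow> light {x. r x = 4} {x. r x = 3 \<or> r x = 4} (comp {x. r x = 1} a)) \<and>
     (\<forall>t t' u u'. conn {x. r x = 1} t t' \<longrightarrow> r u = 0 \<longrightarrow> r u' = 0 \<longrightarrow> E t u \<longrightarrow> E t' u' \<longrightarrow> u = u')"

text \<open>Roles 0 and 1 put no constraint on the target solution, so absorbing a vertex preserves
  compatibility with the same target.\<close>

definition compat :: "nat \<Rightarrow> ('a \<Rightarrow> nat) \<Rightarrow> 'a set \<Rightarrow> 'a set \<Rightarrow> bool" where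
  "compat d r X F \<longleftrightarrow> sol d {x. r x \<le> 4} X F \<and> {x. r x = 2} \<subseteq> X \<and> {x. r x = 3} \<subseteq> F \<and>
     {x. r x = 4} \<inter> (X \<union> F) = {}"

text \<open>The root \<open>v\<close> is adjoined to the absorbed vertices because it is itself
  still undecided; the component is then \<open>v\<close> with all trees hanging on it.\<close>

definition stree :: "('a \<Rightarrow> nat) \<Rightarrow> 'a \<Rightarrow> 'a set" where
  "stree r v = comp ({x. r x = 1} \<union> {v}) v"

text \<open>The three choices at a root. Deleting \<open>v\<close> leaves the trees below it
  absorbed, now without any undecided neighbour; the other two choices fix them as forest
  vertices.\<close>

definition move :: "('a \<Rightarrow> nat) \<Rightarrow> 'a \<Rightarrow> nat \<Rightarrow> 'a \<Rightarrow> nat" where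
  "move r v c = (if c = 0 then r(v := 2)
     else (\<lambda>x. if x = v \<and> c = 1 then 3 else if x \<in> stree r v then 4 else r x))"

lemma stree_self: "v \<in> stree r v"
  by (simp add: stree_def conn_refl)

lemma stree_role: "t \<in> stree r v \<Longrightarrow> t \<noteq> v \<Longrightarrow> r t = 1"
  using conn_in unfolding stree_def by fastforce

lemma stree_le1: "t \<in> stree r v \<Longrightarrow> r v = 0 \<Longrightarrow> r t \<le> 1"
  using stree_role by (cases "t = v") auto

lemma stree_closed: "t \<in> stree r v \<Longrightarrow> E t t' \<Longrightarrow> r t' = 1 \<Longrightarrow> t' \<in> stree r v"
  unfolding stree_def using conn_step by auto

lemma stree_closed_conn:
  assumes "t \<in> stree r v" "conn {x. r x = 1} t t'" shows "t' \<in> stree r v"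
  using conn_closed[OF assms(2), of "stree r v"] assms(1) stree_closed by blast

lemma stree_connected: "t \<in> stree r v \<Longrightarrow> t' \<in> stree r v \<Longrightarrow> conn (stree r v) t t'"
  unfolding stree_def using comp_connected conn_sym conn_trans in_comp by metis

lemma stree_reaches_root:
  assumes "t \<in> stree r v" "t \<noteq> v"
  shows "\<exists>t'. conn {x. r x = 1} t t' \<and> E t' v"
proof -
  have "conn ({x. r x = 1} \<union> {v}) v t" using assms by (simp add: stree_def)
  then have "t \<noteq> v \<longrightarrow> (\<exists>t'. conn {x. r x = 1} t t' \<and> E t' v)"
  proof (induction rule: conn_induct)
    case (step y z)
    show ?case
    proof
      assume zv: "z \<noteq> v"
      then have z: "r z = 1" using step by auto
      show "\<exists>t'. conn {x. r x = 1} z t' \<and> E t' v"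
      proof (cases "y = v")
        case True
        then show ?thesis using step z E_sym conn_refl by (metis mem_Collect_eq)
      next
        case False
        then have "conn {x. r x = 1} z y" using step z E_sym by (intro conn_edge) auto
        then show ?thesis using step False conn_trans by blast
      qed
    qed
  qed simp
  then show ?thesis using assms by blast
qed

text \<open>Every absorbed component below \<open>v\<close> touches \<open>v\<close>, which by
  \<open>inv\<close> is then its only undecided neighbour. So only the root can have open neighbours
  outside the subtree.\<close>

lemma stree_nbr:
  assumes "inv r" "r v = 0" "t \<in> stree r v" "E t h" "r h \<le> 1" "h \<notin> stree r v"
  shows "t = v"
proof (rule ccontr)
  assume tv: "t \<noteq> v"
  have "r h \<noteq> 1" using assms stree_closed by blast
  then have "r h = 0" using assms(5) by simp
  moreover obtain t' where "conn {x. r x = 1} t t'" "E t' v" using stree_reaches_root assms tv by blast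
  ultimately have "h = v" using assms conn_refl conn_sym unfolding inv_def
    by (metis conn_in)
  then show False using assms stree_self by blast
qed

lemma stree_comp:
  assumes "conn (stree r v - {v}) t t'"
  shows "conn {x. r x = 1} t t'"
  using assms by (rule conn_mono) (use stree_role in blast)

lemma role_upd_le: "r v = 0 \<Longrightarrow> {x. (r(v := 1)) x \<le> 4} = {x. r x \<le> 4}" for r :: "'a \<Rightarrow> nat"
  by auto

lemma compat_absorb:
  assumes "compat d r X F" "r v = 0"
  shows "compat d (r(v := 1)) X F"
proof -
  have "{x. (r(v := 1)) x = c} = {x. r x = c}" if "c \<ge> 2" for c using that assms(2) by auto
  then show ?thesis using assms role_upd_le[of r v] unfolding compat_def by simp
qed

text \<open>The only new absorbed component is \<open>stree r v\<close>. Its edges to other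
  undecided vertices all leave from \<open>v\<close>, and \<open>v\<close> is low, so there is at
  most one; lightness is assumed.\<close>

lemma inv_absorb:
  assumes inv: "inv r" and v: "r v = 0" "low {x. r x = 0} v"
    and light: "light {x. r x = 4} {x. r x = 3 \<or> r x = 4} (stree r v)"
  shows "inv (r(v := 1))"
proof -
  let ?r = "r(v := 1)"
  have A: "{x. ?r x = 1} = {x. r x = 1} \<union> {v}" by auto
  have W: "{x. ?r x = 4} = {x. r x = 4}" "{x. ?r x = 3 \<or> ?r x = 4} = {x. r x = 3 \<or> r x = 4}"
    using v by auto
  have H: "{x. ?r x \<le> 1} = {x. r x \<le> 1}" "{x. ?r x \<le> 4} = {x. r x \<le> 4}" using v by auto
  have eq: "comp {x. ?r x = 1} a = stree r v" if "a \<in> stree r v" for a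
    using that comp_eq unfolding stree_def A by simp
  have sub: "conn {x. r x = 1} a b" if "conn {x. ?r x = 1} a b" "a \<notin> stree r v" for a b
  proof -
    have "conn ({x. ?r x = 1} \<inter> - stree r v) a b \<and> b \<in> - stree r v"
    proof (rule conn_closed[OF that(1)])
      fix u w assume "u \<in> - stree r v" "u \<in> {x. ?r x = 1}" "w \<in> {x. ?r x = 1}" "E u w"
      then show "w \<in> - stree r v"
        using E_sym[of u w] unfolding A stree_def in_comp
        by (metis Compl_iff conn_step in_comp)
    qed (use that in simp)
    moreover have "{x. ?r x = 1} \<inter> - stree r v \<subseteq> {x. r x = 1}" using stree_self by auto
    ultimately show ?thesis using conn_mono by blast
  qed
  show ?thesis unfolding inv_def W H
  proof (intro conjI allI impI)
    fix a assume a: "?r a = 1"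
    show "light {x. r x = 4} {x. r x = 3 \<or> r x = 4} (comp {x. ?r x = 1} a)"
    proof (cases "a \<in> stree r v")
      case True
      then show ?thesis using light eq by simp
    next
      case False
      then have "comp {x. ?r x = 1} a \<subseteq> comp {x. r x = 1} a" using sub by auto
      moreover have "r a = 1" using a False stree_self by (auto split: if_splits)
      ultimately show ?thesis using inv unfolding inv_def light_def by (meson subsetD)
    qed
  next
    fix t t' u u'
    assume t: "conn {x. ?r x = 1} t t'" and u: "?r u = 0" "?r u' = 0" and e: "E t u" "E t' u'"
    have u': "r u = 0" "r u' = 0" "u \<noteq> v" "u' \<noteq> v" using u by (auto split: if_splits)
    show "u = u'"
    proof (cases "t \<in> stree r v")
      case True
      then have "t' \<in> stree r v" using eq t by (metis in_comp)
      then have "t = v" "t' = v" using True stree_nbr[OF inv v(1)] e u' stree_role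
        by (metis less_eq_nat.simps(1) zero_neq_one)+
      then show ?thesis using e u' v unfolding low_def by blast
    next
      case False
      then show ?thesis using sub[OF t] u' e inv unfolding inv_def by blast
    qed
  qed (use inv in \<open>auto simp: inv_def\<close>)
qed

lemma move_le4: "r v = 0 \<Longrightarrow> {x. move r v c x \<le> 4} = {x. r x \<le> 4}"
  unfolding move_def by (auto dest: stree_le1[of _ r v] split: if_splits)

lemma move_le1:
  assumes "r v = 0"
  shows "{x. move r v c x \<le> 1} = (if c = 0 then {x. r x \<le> 1} - {v} else {x. r x \<le> 1} - stree r v)"
  using assms stree_self[of v r] unfolding move_def by auto

lemma move_eq0:
  assumes "r v = 0"
  shows "{x. move r v c x = 0} = {x. r x = 0} - {v}"
  using assms stree_self[of v r] unfolding move_def by (auto dest: stree_le1[of _ r v] stree_role)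

lemma move_eq1:
  assumes "r v = 0"
  shows "{x. move r v c x = 1} = (if c = 0 then {x. r x = 1} else {x. r x = 1} - stree r v)"
  using assms unfolding move_def by auto

lemma move_eq2:
  assumes "r v = 0"
  shows "{x. move r v c x = 2} = (if c = 0 then {x. r x = 2} \<union> {v} else {x. r x = 2})"
  using assms stree_self[of v r] unfolding move_def by (auto dest: stree_le1[of _ r v] stree_role)

lemma move_eq3:
  assumes "r v = 0"
  shows "{x. move r v c x = 3} = (if c = 1 then {x. r x = 3} \<union> {v} else {x. r x = 3})"
  using assms stree_self[of v r] unfolding move_def by (auto dest: stree_le1[of _ r v] stree_role)

lemma move_eq4:
  assumes "r v = 0"
  shows "{x. move r v c x = 4} = (if c = 0 then {x. r x = 4} else if c = 1 then {x. r x = 4} \<union> (stree r v - {v})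
    else {x. r x = 4} \<union> stree r v)"
  using assms stree_self[of v r] unfolding move_def by (auto dest: stree_le1[of _ r v] stree_role)

lemma move_kept:
  assumes "r v = 0"
  shows "{x. move r v c x = 3 \<or> move r v c x = 4} =
    (if c = 0 then {x. r x = 3 \<or> r x = 4} else {x. r x = 3 \<or> r x = 4} \<union> stree r v)"
  using assms stree_self[of v r] unfolding move_def by (auto dest: stree_le1[of _ r v] stree_role)

lemmas move_sets = move_le4 move_le1 move_eq0 move_eq1 move_eq2 move_eq3 move_eq4 move_kept

lemma comp_no_stree_nbr:
  assumes "r a = 1" "a \<notin> stree r v" "conn {x. r x = 1} a t" "E t s"
  shows "s \<notin> stree r v"
proof
  assume s: "s \<in> stree r v"
  have t: "r t = 1" using assms conn_in by blast
  then have "t \<in> stree r v" using stree_closed[OF s] assms(4) E_sym by blast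
  then have "a \<in> stree r v" using stree_closed_conn conn_sym assms(3) by blast
  then show False using assms by blast
qed

text \<open>An absorbed component that remains is not adjacent to the subtree that becomes kept. So
  it sees the same kept vertices as before, and connectivity among these can only grow.\<close>

lemma inv_move:
  assumes inv: "inv r" and v: "r v = 0"
  shows "inv (move r v c)"
  unfolding inv_def
proof (intro conjI allI impI)
  show "finite {x. move r v c x \<le> 4}" using inv v by (simp add: move_le4 inv_def)
  show "acyc {x. move r v c x \<le> 1}"
    using inv v acyc_mono[of "{x. r x \<le> 1}" "{x. move r v c x \<le> 1}"] unfolding inv_def move_le1[of r v c, OF v] by auto
next
  fix a assume a: "move r v c a = 1"
  have ra: "r a = 1" using a v move_eq1[of r v c] by (auto split: if_splits)
  have l: "light {x. r x = 4} {x. r x = 3 \<or> r x = 4} (comp {x. r x = 1} a)"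
    using inv ra unfolding inv_def by blast
  show "light {x. move r v c x = 4} {x. move r v c x = 3 \<or> move r v c x = 4} (comp {x. move r v c x = 1} a)"
  proof (cases "c = 0")
    case True
    then show ?thesis using l unfolding move_eq1[of r v, OF v] move_eq4[of r v, OF v] move_kept[of r v, OF v] by simp
  next
    case False
    have aT: "a \<notin> stree r v" using a v False move_eq1[of r v c] by auto
    have sub: "comp {x. move r v c x = 1} a \<subseteq> comp {x. r x = 1} a"
      using conn_mono[of "{x. move r v c x = 1}" a _ "{x. r x = 1}"] move_eq1[of r v c] v by auto
    let ?K = "{x. r x = 3 \<or> r x = 4}" and ?W = "{x. r x = 4}"
    have K: "{x. move r v c x = 3 \<or> move r v c x = 4} = ?K \<union> stree r v"
      using v False by (simp add: move_kept)
    have W: "{x. move r v c x = 4} \<subseteq> ?W \<union> stree r v" using v False by (auto simp: move_eq4)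
    have nT: "s \<notin> stree r v" if "t \<in> comp {x. move r v c x = 1} a" "E t s" for t s
      using that sub comp_no_stree_nbr[OF ra aT] by auto
    show ?thesis unfolding light_def K
    proof (intro conjI ballI impI)
      fix t t' w w'
      assume "t \<in> comp {x. move r v c x = 1} a" "t' \<in> comp {x. move r v c x = 1} a"
        "w \<in> {x. move r v c x = 4}" "w' \<in> {x. move r v c x = 4}" "E t w" "E t' w'"
      moreover from this have "w \<in> ?W" "w' \<in> ?W" using W nT by blast+
      ultimately show "t = t'" "w = w'" using l sub unfolding light_def by blast+
    next
      fix t t' p p'
      assume "t \<in> comp {x. move r v c x = 1} a" "t' \<in> comp {x. move r v c x = 1} a"
        "p \<in> ?K \<union> stree r v" "p' \<in> ?K \<union> stree r v" "E t p" "E t' p'"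
      moreover from this have "p \<in> ?K" "p' \<in> ?K" using nT by blast+
      ultimately have "conn ?K p p'" using l sub unfolding light_def by blast
      then show "conn (?K \<union> stree r v) p p'" by (rule conn_mono) blast
    qed
  qed
next
  fix t t' u u'
  assume "conn {x. move r v c x = 1} t t'" "move r v c u = 0" "move r v c u' = 0" "E t u" "E t' u'"
  moreover have "{x. move r v c x = 1} \<subseteq> {x. r x = 1}" unfolding move_eq1[of r v, OF v] by auto
  then have "conn {x. r x = 1} t t'" using calculation(1) conn_mono by blast
  moreover have "r u = 0" "r u' = 0" using calculation move_eq0[of r v c] v by blast+
  ultimately show "u = u'" using inv unfolding inv_def by blast
qed

text \<open>Applied to a component of a smaller set, this yields the component of \<open>S\<close>
  that contains it; images under \<open>merge\<close> therefore count how pieces coalesce.\<close>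

definition merge :: "'a set \<Rightarrow> 'a set \<Rightarrow> 'a set" where
  "merge S C = (\<Union>x\<in>C. comp S x)"

lemma merge_comp:
  assumes "p \<in> S" "S \<subseteq> S'" shows "merge S' (comp S p) = comp S' p"
proof
  show "merge S' (comp S p) \<subseteq> comp S' p"
    unfolding merge_def using conn_mono[OF _ assms(2)] conn_trans by fastforce
  show "comp S' p \<subseteq> merge S' (comp S p)"
    unfolding merge_def using conn_refl[OF assms(1)] by auto
qed

lemma card_image_less:
  assumes "finite A" "x \<in> A" "y \<in> A" "x \<noteq> y" "f x = f y"
  shows "card (f ` A) < card A"
proof -
  have "f ` A = f ` (A - {x})" using assms by auto
  then have "card (f ` A) \<le> card (A - {x})" using assms card_image_le by (metis finite_Diff)
  also have "\<dots> < card A" using assms by (intro psubset_card_mono) auto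
  finally show ?thesis .
qed

text \<open>A component without an open neighbour is never changed again, and there may be many of
  those. The ones counted here number at most as many as the guessed vertices at the start.\<close>

definition pieces :: "('a \<Rightarrow> nat) \<Rightarrow> 'a set \<Rightarrow> 'a set set" where
  "pieces r S = comp S ` {p \<in> S. \<exists>h. r h \<le> 1 \<and> E h p}"

text \<open>Pieces of kept vertices weigh two because keeping a subtree that joins two of them may
  at the same time create one new piece of forest vertices. The last two terms count the vertices of
  the target that no role names yet.\<close>

definition pot :: "('a \<Rightarrow> nat) \<Rightarrow> 'a set \<Rightarrow> 'a set \<Rightarrow> nat" where
  "pot r X F = 2 * card (pieces r {x. r x = 3 \<or> r x = 4}) + card (pieces r {x. r x = 4}) +
     card (X - {x. r x = 2}) + card (F - {x. r x = 3})"

end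

section \<open>Exchanging the target inside a hanging subtree\<close>

context ugraph
begin

lemma inv_finite: "inv r \<Longrightarrow> S \<subseteq> {x. r x \<le> 4} \<Longrightarrow> finite S"
  unfolding inv_def using finite_subset by blast

lemma inv_light:
  assumes "inv r" "conn {x. r x = 1} t t'"
  shows "light {x. r x = 4} {x. r x = 3 \<or> r x = 4} (comp {x. r x = 1} t)"
    "t \<in> comp {x. r x = 1} t" "t' \<in> comp {x. r x = 1} t"
proof -
  have "r t = 1" using conn_in[OF assms(2)] by simp
  then show "light {x. r x = 4} {x. r x = 3 \<or> r x = 4} (comp {x. r x = 1} t)"
    using assms(1) unfolding inv_def by simp
  show "t \<in> comp {x. r x = 1} t" "t' \<in> comp {x. r x = 1} t"
    using assms(2) \<open>r t = 1\<close> by (auto simp: conn_refl)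
qed

text \<open>Without its root, \<open>T\<close> splits into parts of absorbed components. These are
  light and their neighbours outside \<open>T\<close> are decided, so \<open>acyc_union\<close>
  applies whatever the target does inside \<open>T\<close>.\<close>

lemma acyc_stree_exchange:
  assumes inv: "inv r" and v: "r v = 0" and com: "compat d r X F" and T: "T = stree r v"
  shows "acyc (({x. r x \<le> 4} - X - F - T) \<union> (T - {v}))"
proof (rule acyc_union)
  show "acyc ({x. r x \<le> 4} - X - F - T)"
    using com unfolding compat_def sol_def by (blast intro: acyc_mono)
  have "T \<subseteq> {x. r x \<le> 1}" using stree_le1[of _ r v, OF _ v] T by blast
  then show "acyc (T - {v})" using inv unfolding inv_def by (blast intro: acyc_mono)
  show "finite (T - {v})" using stree_le1[of _ r v, OF _ v] T by (intro inv_finite[OF inv]) force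
  fix t t' a a'
  assume t: "conn (T - {v}) t t'" and a: "a \<in> {x. r x \<le> 4} - X - F - T" "a' \<in> {x. r x \<le> 4} - X - F - T"
    and e: "E t a" "E t' a'"
  have tt: "t \<in> T" "t' \<in> T" "t \<noteq> v" "t' \<noteq> v" using t conn_in by blast+
  have c: "conn {x. r x = 1} t t'" using stree_comp t T by blast
  have W: "r x = 4" if "x \<in> {x. r x \<le> 4} - X - F - T" "E s x" "s \<in> T" "s \<noteq> v" for s x
  proof -
    have "\<not> r x \<le> 1" using stree_nbr[OF inv v, of s x] that T by blast
    moreover have "r x \<noteq> 2" "r x \<noteq> 3" using com that unfolding compat_def by blast+
    moreover have "r x \<le> 4" using that by blast
    ultimately show ?thesis by linarith
  qed
  have "light {x. r x = 4} {x. r x = 3 \<or> r x = 4} (comp {x. r x = 1} t)"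
    by (rule inv_light(1)[OF inv c])
  moreover have "t \<in> comp {x. r x = 1} t" "t' \<in> comp {x. r x = 1} t"
    by (rule inv_light(2,3)[OF inv c])+
  ultimately show "t = t' \<and> a = a'"
    using W[OF a(1) e(1) tt(1,3)] W[OF a(2) e(2) tt(2,4)] e unfolding light_def by blast
qed blast

lemma compat_V: "compat d r X F \<Longrightarrow> X \<subseteq> {x. r x \<le> 4} \<and> F \<subseteq> {x. r x \<le> 4} \<and> X \<inter> F = {}"
  unfolding compat_def sol_def by blast

text \<open>Deleting the root does at least as well as any deletion inside \<open>T\<close>: what
  remains of \<open>T\<close> consists of light trees, which \<open>sol_absorb\<close> adds to the
  vertices kept outside \<open>T\<close>.\<close>

lemma compat_exchange_X:
  assumes inv: "inv r" and v: "r v = 0" and com: "compat d r X F" and T: "T = stree r v"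
  shows "compat d (move r v 0) ((X - T) \<union> {v}) (F - T)"
proof -
  let ?V = "{x. r x \<le> 4}" and ?K = "{x. r x = 3 \<or> r x = 4}"
  note cV = compat_V[OF com]
  have TV: "T \<subseteq> {x. r x \<le> 1}" using stree_le1[of _ r v, OF _ v] T by blast
  then have TV4: "T \<subseteq> ?V" by auto
  have vT: "v \<in> T" using stree_self T by blast
  have fin: "finite ?V" using inv unfolding inv_def by blast
  have sol: "sol d ?V X F" using com unfolding compat_def by blast
  have KS: "?K \<subseteq> ?V - X - T"
  proof
    fix x assume x: "x \<in> ?K"
    then have "x \<notin> T" using TV by auto
    moreover have "x \<notin> X" using x com unfolding compat_def sol_def by blast
    ultimately show "x \<in> ?V - X - T" using x by auto
  qed
  have nb: "conn (?V - X - T) p p'"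
    if h: "conn (T - {v}) t t'" "p \<in> ?V - X - T" "p' \<in> ?V - X - T" "E t p" "E t' p'" for t t' p p'
  proof -
    have tt: "t \<in> T" "t' \<in> T" "t \<noteq> v" "t' \<noteq> v" using h conn_in by blast+
    have c: "conn {x. r x = 1} t t'" using stree_comp h T by blast
    have K: "x \<in> ?K" if "x \<in> ?V - X - T" "E s x" "s \<in> T" "s \<noteq> v" for s x
    proof -
      have "\<not> r x \<le> 1" using stree_nbr[OF inv v, of s x] that T by blast
      moreover have "r x \<noteq> 2" using com that unfolding compat_def by blast
      moreover have "r x \<le> 4" using that by blast
      ultimately have "r x = 3 \<or> r x = 4" by linarith
      then show ?thesis by blast
    qed
    have "light {x. r x = 4} ?K (comp {x. r x = 1} t)"
      by (rule inv_light(1)[OF inv c])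
    moreover have "t \<in> comp {x. r x = 1} t" "t' \<in> comp {x. r x = 1} t"
      by (rule inv_light(2,3)[OF inv c])+
    ultimately have "conn ?K p p'"
      using K[OF h(2,4) tt(1,3)] K[OF h(3,5) tt(2,4)] h(4,5) unfolding light_def by blast
    then show ?thesis using KS by (rule conn_mono)
  qed
  have W: "?V - (X - T \<union> {v}) - (F - T) = (?V - X - F - T) \<union> (T - {v})" using vT TV4 by blast
  have "sol d ?V (?V - (?V - X - T) - (T - {v})) (F \<inter> (?V - X - T))"
  proof (rule sol_absorb[OF sol fin])
    show "acyc (T - {v})" using inv TV unfolding inv_def by (blast intro: acyc_mono)
    fix t t' p p'
    assume h: "conn (T - {v}) t t'" "p \<in> ?V - X - T - F" "p' \<in> ?V - X - T - F" "E t p" "E t' p'"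
    show "t = t' \<and> p = p'"
    proof -
      have ac: "acyc (({x. r x \<le> 4} - X - F - T) \<union> (T - {v}))"
        by (rule acyc_stree_exchange[OF inv v com T])
      let ?A = "comp (T - {v}) t"
      have tt: "t \<in> T" "t' \<in> T" "t \<noteq> v" "t' \<noteq> v" using h conn_in by blast+
      have c: "conn {x. r x = 1} t t'" using stree_comp h T by blast
      have W: "r x = 4" if "x \<in> ?V - X - T - F" "E s x" "s \<in> T" "s \<noteq> v" for s x
      proof -
        have "\<not> r x \<le> 1" using stree_nbr[OF inv v, of s x] that T by blast
        moreover have "r x \<noteq> 2" "r x \<noteq> 3" using com that unfolding compat_def by blast+
        moreover have "r x \<le> 4" using that by blast
        ultimately show ?thesis by linarith
      qed
      have "light {x. r x = 4} ?K (comp {x. r x = 1} t)"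
        by (rule inv_light(1)[OF inv c])
      moreover have "t \<in> comp {x. r x = 1} t" "t' \<in> comp {x. r x = 1} t"
        by (rule inv_light(2,3)[OF inv c])+
      ultimately show ?thesis
        using W[OF h(2,4) tt(1,3)] W[OF h(3,5) tt(2,4)] h(4,5) unfolding light_def by blast
    qed
  next
    fix t t' p p'
    assume "conn (T - {v}) t t'" "p \<in> ?V - X - T" "p' \<in> ?V - X - T" "E t p" "E t' p'"
    then show "conn (?V - X - T) p p'" by (rule nb)
  qed (use TV4 in blast)+
  moreover have "?V - (?V - X - T) - (T - {v}) = X - T \<union> {v}" using vT TV4 cV by blast
  moreover have "F \<inter> (?V - X - T) = F - T" using cV by blast
  ultimately have s: "sol d ?V (X - T \<union> {v}) (F - T)" by simp
  have "{x. r x = 2} \<inter> T = {}" "{x. r x = 3} \<inter> T = {}" "{x. r x = 4} \<inter> T = {}" using TV by auto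
  then show ?thesis using s com v unfolding compat_def by (auto simp: move_sets)
qed

text \<open>\<open>T\<close> is connected and disjoint from \<open>X\<close>, so it lies within one
  component of the kept graph. Replacing the nonempty \<open>F \<inter> T\<close> by
  \<open>v\<close> alone raises no count, and acyclicity is
  \<open>acyc_stree_exchange\<close>.\<close>

lemma compat_exchange_F:
  assumes inv: "inv r" and v: "r v = 0" and com: "compat d r X F" and T: "T = stree r v"
    and XT: "X \<inter> T = {}" and FT: "F \<inter> T \<noteq> {}"
  shows "compat d (move r v 1) X ((F - T) \<union> {v})" "card ((F - T) \<union> {v}) \<le> card F"
proof -
  let ?V = "{x. r x \<le> 4}"
  note cV = compat_V[OF com]
  have TV: "T \<subseteq> {x. r x \<le> 1}" using stree_le1[of _ r v, OF _ v] T by blast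
  then have TV4: "T \<subseteq> ?V" by auto
  have vT: "v \<in> T" using stree_self T by blast
  have fin: "finite ?V" using inv unfolding inv_def by blast
  have sol: "sol d ?V X F" using com unfolding compat_def by blast
  have finF: "finite F" using cV fin finite_subset by blast
  \<comment> \<open>Used with the components of the kept graph for feasibility, and with
    \<open>UNIV\<close> for the size of the whole set.\<close>
  have cardle: "card (((F - T) \<union> {v}) \<inter> C) \<le> card (F \<inter> C)" if C: "T \<subseteq> C \<or> T \<inter> C = {}" for C
  proof (cases "T \<subseteq> C")
    case True
    obtain f where f: "f \<in> F" "f \<in> T" using FT by blast
    have "((F - T) \<union> {v}) \<inter> C \<subseteq> insert v ((F \<inter> C) - {f})" using f by blast
    then have "card (((F - T) \<union> {v}) \<inter> C) \<le> card (insert v ((F \<inter> C) - {f}))"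
      using finF by (intro card_mono) auto
    also have "\<dots> \<le> Suc (card ((F \<inter> C) - {f}))" by (rule card_insert_le_m1) simp_all
    also have "\<dots> = card (F \<inter> C)" using f True finF by (intro card_Suc_Diff1) auto
    finally show ?thesis .
  next
    case False
    then have "v \<notin> C" using C vT by blast
    then have "((F - T) \<union> {v}) \<inter> C \<subseteq> F \<inter> C" by blast
    then show ?thesis using finF by (intro card_mono) auto
  qed
  from cardle[of UNIV] show "card ((F - T) \<union> {v}) \<le> card F" by simp
  have "sol d ?V X ((F - T) \<union> {v})" unfolding sol_def
  proof (intro conjI ballI)
    have "?V - X - (F - T \<union> {v}) = (?V - X - F - T) \<union> (T - {v})" using vT TV4 XT by blast
    then show "acyc (?V - X - (F - T \<union> {v}))" using acyc_stree_exchange[OF inv v com T] by simp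
    fix y assume y: "y \<in> ?V - X"
    have "T \<subseteq> comp (?V - X) y \<or> T \<inter> comp (?V - X) y = {}"
    proof (rule disjCI)
      assume "T \<inter> comp (?V - X) y \<noteq> {}"
      then obtain t where t: "t \<in> T" "conn (?V - X) y t" by auto
      have c: "conn (?V - X) t t'" if "t' \<in> T" for t'
      proof (rule conn_mono)
        show "conn T t t'" using stree_connected[of t r v t'] t that T by simp
      qed (use TV4 XT in blast)
      show "T \<subseteq> comp (?V - X) y" using conn_trans[OF t(2) c] by auto
    qed
    from cardle[OF this] show "card ((F - T \<union> {v}) \<inter> comp (?V - X) y) \<le> d"
      using sol y unfolding sol_def by (meson order_trans)
  qed (use cV vT TV4 XT in blast)+
  moreover have "{x. r x = 2} \<inter> T = {}" "{x. r x = 3} \<inter> T = {}" "{x. r x = 4} \<inter> T = {}" using TV by auto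
  ultimately show "compat d (move r v 1) X ((F - T) \<union> {v})"
    using com v XT T unfolding compat_def by (auto simp: move_sets)
qed

lemma compat_exchange_W:
  assumes v: "r v = 0" and com: "compat d r X F" and T: "stree r v \<inter> (X \<union> F) = {}"
  shows "compat d (move r v 2) X F"
  using com v T unfolding compat_def by (auto simp: move_sets)

end

section \<open>The potential drops at every branching\<close>

context ugraph
begin

lemma finite_pieces: "finite S \<Longrightarrow> finite (pieces r S)"
  unfolding pieces_def by (rule finite_imageI) simp

lemma pieces_mono: "{h. r' h \<le> 1} \<subseteq> {h. r h \<le> 1} \<Longrightarrow> pieces r' S \<subseteq> pieces r S"
  unfolding pieces_def by blast

text \<open>Inside the moved subtree only the root can still have an open neighbour, so at most one
  piece is new; all others are enlargements of old ones.\<close>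

lemma pieces_move:
  assumes inv: "inv r" and v: "r v = 0" and c: "c \<noteq> 0" and S: "S \<subseteq> S'" "S' \<subseteq> S \<union> stree r v"
  shows "pieces (move r v c) S' \<subseteq> (if v \<in> S' then insert (comp S' v) (merge S' ` pieces r S) else merge S' ` pieces r S)"
proof
  fix C assume "C \<in> pieces (move r v c) S'"
  then obtain p h where p: "p \<in> S'" "move r v c h \<le> 1" "E h p" and C: "C = comp S' p"
    unfolding pieces_def by blast
  have h: "r h \<le> 1" "h \<notin> stree r v" using p(2) move_le1[of r v c, OF v] c by auto
  show "C \<in> (if v \<in> S' then insert (comp S' v) (merge S' ` pieces r S) else merge S' ` pieces r S)"
  proof (cases "p \<in> S")
    case True
    then have "comp S p \<in> pieces r S" unfolding pieces_def using p h by blast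
    then show ?thesis using merge_comp[OF True S(1)] C by (auto simp: image_iff)
  next
    case False
    then have "p \<in> stree r v" using p S by blast
    then have "p = v" using stree_nbr[OF inv v _ E_sym[OF p(3)] h] by blast
    then show ?thesis using p C by simp
  qed
qed

text \<open>The choice reads off what the target does inside \<open>T\<close>. If it deletes
  something there, or else has a feedback vertex there, one of its unnamed vertices is exchanged for
  \<open>v\<close>, which the move names. If it keeps all of \<open>T\<close> in the forest, the
  failure of \<open>light\<close> yields two pieces that \<open>T\<close> merges.\<close>

lemma branch_step:
  assumes inv: "inv r" and v: "r v = 0" and com: "compat d r X F"
    and nl: "\<not> light {x. r x = 4} {x. r x = 3 \<or> r x = 4} (stree r v)"
  shows "\<exists>c<3. \<exists>X' F'. compat d (move r v c) X' F' \<and> card X' \<le> card X \<and> card F' \<le> card F \<and>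
    pot (move r v c) X' F' < pot r X F"
proof -
  define T where "T = stree r v"
  let ?K = "{x. r x = 3 \<or> r x = 4}" and ?W = "{x. r x = 4}" and ?V = "{x. r x \<le> 4}"
  have finV: "finite ?V" using inv unfolding inv_def by blast
  have fin: "finite ?K" "finite ?W" "finite X" "finite F"
    using compat_V[OF com] by (auto intro: inv_finite[OF inv])
  have finT: "finite T" using stree_le1[of _ r v, OF _ v] unfolding T_def by (intro inv_finite[OF inv]) force
  have TV: "T \<subseteq> {x. r x \<le> 1}" using stree_le1[of _ r v, OF _ v] T_def by blast
  have vT: "v \<in> T" using stree_self T_def by blast
  have disj: "{x. r x = 2} \<inter> T = {}" "{x. r x = 3} \<inter> T = {}" "?W \<inter> T = {}" using TV by auto
  have KT: "?K \<inter> T = {}" using TV by auto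
  \<comment> \<open>A subtree without kept neighbours would be light. As \<open>T\<close> touches
    some kept \<open>p0\<close>, the piece of \<open>v\<close> is an enlargement of an old
    piece.\<close>
  obtain t0 p0 where tp: "t0 \<in> T" "p0 \<in> ?K" "E t0 p0" using nl unfolding light_def T_def by blast
  have touch: "comp S p \<in> pieces r S" if "p \<in> S" "t \<in> T" "E t p" for S p t
    unfolding pieces_def using that TV by blast
  have img: "comp S' p = comp S' v" if "p \<in> S'" "t \<in> T" "E t p" "T \<subseteq> S'" for S' p t
  proof -
    have "conn T v t" using stree_connected[of v r v t] vT that T_def by blast
    then have "conn S' v t" using that(4) by (rule conn_mono)
    then have "conn S' v p" using that(3,1) by (rule conn_step)
    then show ?thesis using comp_eq by blast
  qed
  consider (X) "X \<inter> T \<noteq> {}" | (F) "X \<inter> T = {}" "F \<inter> T \<noteq> {}" | (W) "T \<inter> (X \<union> F) = {}" by blast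
  then show ?thesis
  proof cases
    case X
    let ?X = "X - T \<union> {v}" and ?F = "F - T"
    obtain x where x: "x \<in> X" "x \<in> T" using X by blast
    have "?X \<subseteq> insert v (X - {x})" using x by blast
    then have "card ?X \<le> card (insert v (X - {x}))" using fin by (intro card_mono) auto
    also have "\<dots> \<le> Suc (card (X - {x}))" by (rule card_insert_le_m1) simp_all
    also have "\<dots> = card X" using x fin by (intro card_Suc_Diff1) auto
    finally have cX: "card ?X \<le> card X" .
    have cF: "card ?F \<le> card F" using fin by (intro card_mono) auto
    have eq: "{x. move r v 0 x = 3 \<or> move r v 0 x = 4} = ?K" "{x. move r v 0 x = 4} = ?W"
      "{x. move r v 0 x = 3} = {x. r x = 3}" "{x. move r v 0 x = 2} = {x. r x = 2} \<union> {v}"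
      using move_sets[of r v 0, OF v] by auto
    have pm: "pieces (move r v 0) S \<subseteq> pieces r S" for S
      by (rule pieces_mono) (simp add: move_le1[of r v 0, OF v, simplified])
    have p: "card (pieces (move r v 0) ?K) \<le> card (pieces r ?K)"
      by (rule card_mono[OF finite_pieces[OF fin(1)] pm])
    have p': "card (pieces (move r v 0) ?W) \<le> card (pieces r ?W)"
      by (rule card_mono[OF finite_pieces[OF fin(2)] pm])
    have "?X - ({x. r x = 2} \<union> {v}) \<subseteq> X - {x. r x = 2} - {x}" using x by blast
    then have "card (?X - ({x. r x = 2} \<union> {v})) \<le> card (X - {x. r x = 2} - {x})"
      using fin by (intro card_mono) auto
    also have "\<dots> < card (X - {x. r x = 2})" using x disj fin by (intro psubset_card_mono) auto
    finally have q: "card (?X - ({x. r x = 2} \<union> {v})) < card (X - {x. r x = 2})" .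
    have q': "card (?F - {x. r x = 3}) \<le> card (F - {x. r x = 3})" using fin by (intro card_mono) auto
    have "pot (move r v 0) ?X ?F < pot r X F"
      unfolding pot_def eq using p p' q q' by linarith
    then show ?thesis using compat_exchange_X[OF inv v com T_def] cX cF
      by (intro exI[of _ 0] conjI exI[of _ ?X] exI[of _ ?F]) auto
  next
    case F
    let ?F = "F - T \<union> {v}"
    note cF = compat_exchange_F[OF inv v com T_def F]
    let ?K' = "?K \<union> T" and ?W' = "?W \<union> (T - {v})"
    have eq: "{x. move r v 1 x = 3 \<or> move r v 1 x = 4} = ?K'" "{x. move r v 1 x = 4} = ?W'"
      "{x. move r v 1 x = 3} = {x. r x = 3} \<union> {v}" "{x. move r v 1 x = 2} = {x. r x = 2}"
      using move_sets[of r v 1, OF v] T_def by auto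
    have "pieces (move r v 1) ?K' \<subseteq> insert (comp ?K' v) (merge ?K' ` pieces r ?K)"
      using pieces_move[OF inv v, of 1 ?K ?K'] T_def by (auto split: if_splits)
    also have "comp ?K' v = merge ?K' (comp ?K p0)"
      using merge_comp[of p0 ?K ?K'] img[of p0 ?K' t0] tp by blast
    then have "insert (comp ?K' v) (merge ?K' ` pieces r ?K) = merge ?K' ` pieces r ?K"
      using touch[OF tp(2,1,3)] by blast
    finally have "card (pieces (move r v 1) ?K') \<le> card (merge ?K' ` pieces r ?K)"
      using finite_pieces[OF fin(1)] by (intro card_mono) auto
    then have p: "card (pieces (move r v 1) ?K') \<le> card (pieces r ?K)"
      using card_image_le[OF finite_pieces[OF fin(1)]] order_trans by blast
    \<comment> \<open>The root goes to \<open>F\<close>, and the rest of the subtree has no open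
      neighbour, so no forest piece is created.\<close>
    have "v \<notin> ?W'" using v by auto
    then have "pieces (move r v 1) ?W' \<subseteq> merge ?W' ` pieces r ?W"
      using pieces_move[OF inv v, of 1 ?W ?W'] T_def by (auto split: if_splits)
    then have "card (pieces (move r v 1) ?W') \<le> card (merge ?W' ` pieces r ?W)"
      using finite_pieces[OF fin(2)] by (intro card_mono) auto
    then have p': "card (pieces (move r v 1) ?W') \<le> card (pieces r ?W)"
      using card_image_le[OF finite_pieces[OF fin(2)]] order_trans by blast
    obtain f where f: "f \<in> F" "f \<in> T" using F by blast
    have "?F - ({x. r x = 3} \<union> {v}) \<subseteq> F - {x. r x = 3} - {f}" using f by blast
    then have "card (?F - ({x. r x = 3} \<union> {v})) \<le> card (F - {x. r x = 3} - {f})"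
      using fin by (intro card_mono) auto
    also have "\<dots> < card (F - {x. r x = 3})" using f disj fin by (intro psubset_card_mono) auto
    finally have "pot (move r v 1) X ?F < pot r X F"
      unfolding pot_def eq using p p' by linarith
    then show ?thesis using cF by (intro exI[of _ 1] conjI exI[of _ X] exI[of _ ?F]) auto
  next
    case W
    let ?K' = "?K \<union> T" and ?W' = "?W \<union> T"
    have com': "compat d (move r v 2) X F" by (rule compat_exchange_W[OF v com]) (use W T_def in blast)
    have eq: "{x. move r v 2 x = 3 \<or> move r v 2 x = 4} = ?K'" "{x. move r v 2 x = 4} = ?W'"
      "{x. move r v 2 x = 3} = {x. r x = 3}" "{x. move r v 2 x = 2} = {x. r x = 2}"
      using move_sets[of r v 2, OF v] T_def by auto
    have "pieces (move r v 2) ?K' \<subseteq> insert (comp ?K' v) (merge ?K' ` pieces r ?K)"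
      using pieces_move[OF inv v, of 2 ?K ?K'] T_def by (auto split: if_splits)
    also have "comp ?K' v = merge ?K' (comp ?K p0)"
      using merge_comp[of p0 ?K ?K'] img[of p0 ?K' t0] tp by blast
    then have "insert (comp ?K' v) (merge ?K' ` pieces r ?K) = merge ?K' ` pieces r ?K"
      using touch[OF tp(2,1,3)] by blast
    finally have p1: "card (pieces (move r v 2) ?K') \<le> card (merge ?K' ` pieces r ?K)"
      using finite_pieces[OF fin(1)] by (intro card_mono) auto
    have p2: "card (merge ?K' ` pieces r ?K) \<le> card (pieces r ?K)"
      by (rule card_image_le[OF finite_pieces[OF fin(1)]])
    have w0: "pieces (move r v 2) ?W' \<subseteq> insert (comp ?W' v) (merge ?W' ` pieces r ?W)"
      using pieces_move[OF inv v, of 2 ?W ?W'] T_def by (auto split: if_splits)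
    have finm: "finite (merge ?W' ` pieces r ?W)" using finite_pieces[OF fin(2)] by simp
    have w1: "card (merge ?W' ` pieces r ?W) \<le> card (pieces r ?W)"
      by (rule card_image_le[OF finite_pieces[OF fin(2)]])
    \<comment> \<open>If \<open>T\<close> joins two kept pieces, the doubled term drops by at least
      two while at most one forest piece is new. Otherwise \<open>T\<close> has two edges to forest
      vertices, and then the number of forest pieces itself drops.\<close>
    have lt: "2 * card (pieces (move r v 2) ?K') + card (pieces (move r v 2) ?W') < 2 * card (pieces r ?K) + card (pieces r ?W)"
    proof (cases "\<forall>t\<in>T. \<forall>t'\<in>T. \<forall>p\<in>?K. \<forall>p'\<in>?K. E t p \<longrightarrow> E t' p' \<longrightarrow> conn ?K p p'")
      case False
      then obtain t t' p p' where h: "t \<in> T" "t' \<in> T" "p \<in> ?K" "p' \<in> ?K" "E t p" "E t' p'" "\<not> conn ?K p p'"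
        by blast
      have "card (merge ?K' ` pieces r ?K) < card (pieces r ?K)"
      proof (rule card_image_less)
        show "merge ?K' (comp ?K p) = merge ?K' (comp ?K p')"
          using img[of p ?K' t] img[of p' ?K' t'] merge_comp[of p ?K ?K'] merge_comp[of p' ?K ?K'] h by blast
        show "comp ?K p \<noteq> comp ?K p'" using comp_eq_iff[of p ?K p'] h by simp
        show "finite (pieces r ?K)" by (rule finite_pieces[OF fin(1)])
        show "comp ?K p \<in> pieces r ?K" by (rule touch[OF h(3,1,5)])
        show "comp ?K p' \<in> pieces r ?K" by (rule touch[OF h(4,2,6)])
      qed
      moreover have "card (pieces (move r v 2) ?W') \<le> card (insert (comp ?W' v) (merge ?W' ` pieces r ?W))"
        using w0 finm by (intro card_mono) auto
      moreover have "\<dots> \<le> Suc (card (merge ?W' ` pieces r ?W))" by (rule card_insert_le_m1) simp_all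
      ultimately show ?thesis using p1 w1 by linarith
    next
      case True
      then obtain t t' w w' where h: "t \<in> T" "t' \<in> T" "w \<in> ?W" "w' \<in> ?W" "E t w" "E t' w'" "\<not> (t = t' \<and> w = w')"
        using nl unfolding light_def T_def by blast
      \<comment> \<open>Two edges from \<open>T\<close> into one component of forest vertices would
        close a cycle in the forest of the target.\<close>
      have nc: "\<not> conn ?W w w'"
      proof
        assume cw: "conn ?W w w'"
        have "t = t' \<and> w = w'"
        proof (rule acyc_one_edge[of T "comp ?W w"])
          have "T \<union> comp ?W w \<subseteq> ?V - X - F"
            using W TV com conn_in[of ?W w] unfolding compat_def by force
          then show "acyc (T \<union> comp ?W w)" using com unfolding compat_def sol_def by (blast intro: acyc_mono)
          show "finite (comp ?W w)" by (rule finite_subset[OF comp_subset fin(2)])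
          show "T \<inter> comp ?W w = {}" using disj(3) comp_subset[of ?W w] by blast
          show "conn T x y" if "x \<in> T" "y \<in> T" for x y using stree_connected[of x r v y] that T_def by simp
          show "conn (comp ?W w) x y" if "x \<in> comp ?W w" "y \<in> comp ?W w" for x y
            using conn_trans[OF conn_sym[OF comp_connected[of ?W w x]] comp_connected[of ?W w y]] that by simp
          show "w \<in> comp ?W w" "w' \<in> comp ?W w" using cw conn_refl[OF h(3)] by simp_all
        qed (use h finT in auto)
        then show False using h by blast
      qed
      have "card (merge ?W' ` pieces r ?W) < card (pieces r ?W)"
      proof (rule card_image_less)
        show "merge ?W' (comp ?W w) = merge ?W' (comp ?W w')"
          using img[of w ?W' t] img[of w' ?W' t'] merge_comp[of w ?W ?W'] merge_comp[of w' ?W ?W'] h by blast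
        show "comp ?W w \<noteq> comp ?W w'" using comp_eq_iff[of w ?W w'] nc h by simp
        show "finite (pieces r ?W)" by (rule finite_pieces[OF fin(2)])
        show "comp ?W w \<in> pieces r ?W" by (rule touch[OF h(3,1,5)])
        show "comp ?W w' \<in> pieces r ?W" by (rule touch[OF h(4,2,6)])
      qed
      moreover have "comp ?W' v = merge ?W' (comp ?W w)"
        using merge_comp[of w ?W ?W'] img[of w ?W' t] h by blast
      then have "insert (comp ?W' v) (merge ?W' ` pieces r ?W) = merge ?W' ` pieces r ?W"
        using touch[OF h(3,1,5)] by blast
      then have "card (pieces (move r v 2) ?W') \<le> card (merge ?W' ` pieces r ?W)"
        using w0 finm by (intro card_mono) auto
      ultimately show ?thesis using p1 p2 by linarith
    qed
    have "pot (move r v 2) X F < pot r X F"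
      unfolding pot_def eq using lt by linarith
    then show ?thesis using com' by (intro exI[of _ 2] conjI exI[of _ X] exI[of _ F]) auto
  qed
qed

text \<open>Once nothing is undecided, the absorbed components are light trees and
  \<open>sol_absorb\<close> adds them to the kept vertices. The deleted set becomes exactly role 2,
  even where the target deletes absorbed vertices.\<close>

lemma sol_finish:
  assumes inv: "inv r" and com: "compat d r X F" and U: "\<And>x. r x \<noteq> 0"
  shows "sol d {x. r x \<le> 4} {x. r x = 2} {x. r x = 3}"
proof -
  let ?K = "{x. r x = 3 \<or> r x = 4}" and ?V = "{x. r x \<le> 4}" and ?A = "{x. r x = 1}"
  have "sol d ?V (?V - ?K - ?A) (F \<inter> ?K)"
  proof (rule sol_absorb)
    show "sol d ?V X F" using com unfolding compat_def by blast
    show "?K \<subseteq> ?V - X" using com unfolding compat_def sol_def by auto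
    have "?A \<subseteq> {x. r x \<le> 1}" by auto
    then show "acyc ?A" using inv unfolding inv_def by (blast intro: acyc_mono)
    fix t t' p p'
    assume c: "conn ?A t t'" and e: "E t p" "E t' p'"
    note l = inv_light[OF inv c]
    show "t = t' \<and> p = p'" if "p \<in> ?K - F" "p' \<in> ?K - F"
    proof -
      have "r p = 4" "r p' = 4" using that com unfolding compat_def by blast+
      then show ?thesis using l e unfolding light_def by blast
    qed
    show "conn ?K p p'" if "p \<in> ?K" "p' \<in> ?K" using l e that unfolding light_def by blast
  qed (use inv in \<open>auto simp: inv_def\<close>)
  moreover have "r x = 2" if "r x \<le> 4" "r x \<noteq> 3" "r x \<noteq> 4" "r x \<noteq> 1" for x
    using U[of x] that by linarith
  then have "?V - ?K - ?A = {x. r x = 2}" by auto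
  moreover have "F \<inter> ?K = {x. r x = 3}" using com unfolding compat_def by blast
  ultimately show ?thesis by simp
qed

lemma ex_low_undecided:
  assumes "inv r" "r x = 0"
  shows "\<exists>v. r v = 0 \<and> low {x. r x = 0} v"
proof -
  have "{x. r x = 0} \<subseteq> {x. r x \<le> 1}" "{x. r x = 0} \<noteq> {}" using assms by auto
  then show ?thesis using assms(1) unfolding inv_def acyc_def by blast
qed

end

section \<open>Iterative compression\<close>

context ugraph
begin

text \<open>For \<open>N\<close> above the number of vertices, the weighted sum orders pairs
  lexicographically by the size of \<open>X\<close> and then of \<open>F\<close>;
  \<open>card_le_of_cost\<close> extracts the first comparison.\<close>

definition minsol :: "nat \<Rightarrow> nat \<Rightarrow> 'a set \<Rightarrow> 'a set \<Rightarrow> 'a set \<Rightarrow> bool" where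
  "minsol N d V X F \<longleftrightarrow> sol d V X F \<and>
     (\<forall>X' F'. sol d V X' F' \<longrightarrow> N * card X + card F \<le> N * card X' + card F')"

lemma conn_closed_no_exit:
  assumes "conn S x y" "x \<in> Q" "\<And>u w. u \<in> Q \<Longrightarrow> w \<in> S \<Longrightarrow> E u w \<Longrightarrow> w \<in> Q"
  shows "y \<in> Q" "conn (S \<inter> Q) x y"
  using conn_closed[OF assms(1,2)] assms(3) by blast+

lemma conn_closed_no_entry:
  assumes "conn S x y" "x \<notin> Q" "\<And>u w. u \<in> Q \<Longrightarrow> w \<in> S \<Longrightarrow> E u w \<Longrightarrow> w \<in> Q"
  shows "y \<notin> Q" "conn (S - Q) x y"
proof -
  have "conn (S \<inter> - Q) x y \<and> y \<in> - Q"
    by (rule conn_closed[OF assms(1)]) (use assms(2,3) E_sym in blast)+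
  then show "y \<notin> Q" "conn (S - Q) x y" by (simp_all add: Diff_eq)
qed

text \<open>\<open>Q\<close> is a union of components of \<open>V - X\<close>, so feedback vertices
  can be changed there independently of the rest. The other solution keeps all of \<open>Q\<close>,
  and its components contain those inside \<open>Q\<close>, so its count carries over.\<close>

lemma sol_patch:
  assumes sol: "sol d V X F" and fin: "finite V" and Q: "Q \<subseteq> V - X"
    and cl: "\<And>u w. u \<in> Q \<Longrightarrow> w \<in> V - X \<Longrightarrow> E u w \<Longrightarrow> w \<in> Q"
    and sol': "sol d V' X' F'" and fin': "finite V'" and Q': "Q \<subseteq> V' - X'"
  shows "sol d V X ((F - Q) \<union> (F' \<inter> Q))"
  unfolding sol_def
proof (intro conjI ballI)
  have "acyc ((V - X - F - Q) \<union> (Q - F'))"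
  proof (rule acyc_union)
    show "acyc (V - X - F - Q)" using sol unfolding sol_def by (blast intro: acyc_mono)
    have "Q - F' \<subseteq> V' - X' - F'" using Q' by blast
    then show "acyc (Q - F')" using sol' unfolding sol_def by (blast intro: acyc_mono)
    show "finite (Q - F')" using Q fin finite_subset by blast
    show "t = t' \<and> a = a'" if "conn (Q - F') t t'" "a \<in> V - X - F - Q" "E t a" for t t' a a'
      using that cl[of t a] conn_in[OF that(1)] by blast
  qed blast
  then show "acyc (V - X - ((F - Q) \<union> (F' \<inter> Q)))"
    by (rule acyc_mono) blast
  fix v assume v: "v \<in> V - X"
  show "card (((F - Q) \<union> (F' \<inter> Q)) \<inter> comp (V - X) v) \<le> d"
  proof (cases "v \<in> Q")
    case True
    have "((F - Q) \<union> (F' \<inter> Q)) \<inter> comp (V - X) v \<subseteq> F' \<inter> comp (V' - X') v"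
    proof
      fix x assume x: "x \<in> ((F - Q) \<union> (F' \<inter> Q)) \<inter> comp (V - X) v"
      then have "conn (V - X) v x" by simp
      have "x \<in> Q" "conn ((V - X) \<inter> Q) v x"
        by (rule conn_closed_no_exit[OF \<open>conn (V - X) v x\<close> True]; use cl in blast)+
      then show "x \<in> F' \<inter> comp (V' - X') v" using x conn_mono[of _ v x "V' - X'"] Q' by auto
    qed
    then have "card (((F - Q) \<union> (F' \<inter> Q)) \<inter> comp (V - X) v) \<le> card (F' \<inter> comp (V' - X') v)"
      using sol' fin' unfolding sol_def by (intro card_mono) (auto intro: finite_subset)
    also have "\<dots> \<le> d" using sol' Q' True unfolding sol_def by blast
    finally show ?thesis .
  next
    case False
    have "((F - Q) \<union> (F' \<inter> Q)) \<inter> comp (V - X) v \<subseteq> F \<inter> comp (V - X) v"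
    proof
      fix x assume x: "x \<in> ((F - Q) \<union> (F' \<inter> Q)) \<inter> comp (V - X) v"
      then have c: "conn (V - X) v x" by simp
      have "x \<notin> Q" by (rule conn_closed_no_entry(1)[OF c False]) (use cl in blast)
      then show "x \<in> F \<inter> comp (V - X) v" using x by blast
    qed
    then have "card (((F - Q) \<union> (F' \<inter> Q)) \<inter> comp (V - X) v) \<le> card (F \<inter> comp (V - X) v)"
      using sol fin unfolding sol_def by (intro card_mono) (auto intro: finite_subset)
    also have "\<dots> \<le> d" using sol v unfolding sol_def by blast
    finally show ?thesis .
  qed
qed (use sol Q in \<open>auto simp: sol_def\<close>)

text \<open>Otherwise patching \<open>Q\<close> with \<open>F'\<close> would be cheaper for the same
  \<open>X\<close>. The lemma is used in both directions: to compare the old minimal solution with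
  the new one, and conversely.\<close>

lemma minsol_exchange:
  assumes min: "minsol N d V X F" and fin: "finite V" and Q: "Q \<subseteq> V - X"
    and cl: "\<And>u w. u \<in> Q \<Longrightarrow> w \<in> V - X \<Longrightarrow> E u w \<Longrightarrow> w \<in> Q"
    and sol': "sol d V' X' F'" and fin': "finite V'" and Q': "Q \<subseteq> V' - X'"
  shows "card (F \<inter> Q) \<le> card (F' \<inter> Q)"
proof -
  have sol: "sol d V X F" using min unfolding minsol_def by blast
  have finF: "finite F" using sol fin finite_subset unfolding sol_def by blast
  have "sol d V X ((F - Q) \<union> (F' \<inter> Q))"
    using sol fin Q cl sol' fin' Q' by (rule sol_patch)
  then have "card F \<le> card ((F - Q) \<union> (F' \<inter> Q))" using min unfolding minsol_def by fastforce
  also have "\<dots> \<le> card (F - Q) + card (F' \<inter> Q)" by (rule card_Un_le)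
  finally have "card F \<le> card (F - Q) + card (F' \<inter> Q)" .
  moreover have "card F = card (F - Q) + card (F \<inter> Q)"
    using finF by (subst card_Un_disjoint[symmetric]) (auto intro: arg_cong[where f = card])
  ultimately show ?thesis by linarith
qed

lemma sol_hereditary:
  assumes sol: "sol d V X F" and fin: "finite V" and V': "V' \<subseteq> V"
  shows "sol d V' (X \<inter> V') (F \<inter> V')"
  unfolding sol_def
proof (intro conjI ballI)
  have "V' - X \<inter> V' - F \<inter> V' \<subseteq> V - X - F" using V' by blast
  then show "acyc (V' - X \<inter> V' - F \<inter> V')" using sol unfolding sol_def by (blast intro: acyc_mono)
  fix v assume v: "v \<in> V' - X \<inter> V'"
  have "F \<inter> V' \<inter> comp (V' - X \<inter> V') v \<subseteq> F \<inter> comp (V - X) v"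
  proof -
    have "V' - X \<inter> V' \<subseteq> V - X" using V' by blast
    then show ?thesis using conn_mono[of "V' - X \<inter> V'" v _ "V - X"] by auto
  qed
  then have "card (F \<inter> V' \<inter> comp (V' - X \<inter> V') v) \<le> card (F \<inter> comp (V - X) v)"
    using sol fin unfolding sol_def by (intro card_mono) (auto intro: finite_subset)
  also have "\<dots> \<le> d" using sol v V' unfolding sol_def by blast
  finally show "card (F \<inter> V' \<inter> comp (V' - X \<inter> V') v) \<le> d" .
qed (use sol in \<open>auto simp: sol_def\<close>)

lemma minsol_exists:
  assumes "sol d V X F"
  obtains X' F' where "minsol N d V X' F'" 
proof -
  obtain p where p: "sol d V (fst p) (snd p)"
    "\<And>q. sol d V (fst q) (snd q) \<Longrightarrow> N * card (fst p) + card (snd p) \<le> N * card (fst q) + card (snd q)"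
    using ex_has_least_nat[of "\<lambda>p. sol d V (fst p) (snd p)" "(X, F)" "\<lambda>p. N * card (fst p) + card (snd p)"] assms
    by auto
  have "minsol N d V (fst p) (snd p)"
    unfolding minsol_def using p(1) p(2)[of "(_, _)"] by auto
  then show ?thesis using that by blast
qed

lemma card_le_of_cost:
  assumes "N * card X + card F \<le> N * card X' + card F'" "card F' < N"
  shows "card X \<le> card X'"
proof (rule ccontr)
  assume "\<not> ?thesis"
  then have "N * Suc (card X') \<le> N * card X" by (intro mult_le_mono2) simp
  then show False using assms by simp
qed

text \<open>The first stage of guessing: roles for \<open>x\<close> and the old deleted vertices are
  enough to determine which vertices are attached to a kept one of them.\<close>

definition prep :: "('a \<Rightarrow> nat) \<Rightarrow> 'a \<Rightarrow> ('a \<Rightarrow> nat) \<Rightarrow> 'a \<Rightarrow> nat" where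
  "prep prev x \<chi> v = (if v = x \<or> prev v = 2 then \<chi> v else if prev v = 5 then 5 else 0)"

definition reached :: "('a \<Rightarrow> nat) \<Rightarrow> 'a set" where
  "reached r = {v. \<exists>y. (r y = 3 \<or> r y = 4) \<and> conn {x. r x \<noteq> 2 \<and> r x \<noteq> 5} y v}"

text \<open>Outside the reached part the old roles remain. Inside it the old feedback vertices are
  guessed and the old forest vertices become undecided, so the undecided vertices induce a forest
  from the beginning.\<close>

definition start :: "('a \<Rightarrow> nat) \<Rightarrow> 'a \<Rightarrow> ('a \<Rightarrow> nat) \<Rightarrow> 'a \<Rightarrow> nat" where
  "start prev x \<chi> v = (if v = x \<or> prev v = 2 \<or> prev v = 5 then prep prev x \<chi> v
     else if v \<in> reached (prep prev x \<chi>) then (if prev v = 3 then \<chi> v else 0) else prev v)"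

text \<open>A bound on the number of guessed vertices: \<open>k + 1\<close> for \<open>x\<close>
  with the old deleted set, and \<open>(2 * k + 1) * d\<close> for the reached old feedback
  vertices.\<close>

definition bound :: "nat \<Rightarrow> nat \<Rightarrow> nat" where
  "bound k d = (k + 1) + (2 * k + 1) * d"

lemma card_UN_le_mult:
  assumes "finite I" "\<And>i. i \<in> I \<Longrightarrow> card (A i) \<le> d"
  shows "card (\<Union>i\<in>I. A i) \<le> card I * d"
proof -
  have "card (\<Union>i\<in>I. A i) \<le> (\<Sum>i\<in>I. card (A i))" using assms(1) by (rule card_UN_le)
  also have "\<dots> \<le> (\<Sum>i\<in>I. d)" using assms(2) by (rule sum_mono)
  finally show ?thesis by simp
qed

text \<open>An old and a new minimal solution are compared. Components of the new kept graph with a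
  vertex of \<open>Y\<close> contain at most \<open>(k + 1) * d\<close> feedback vertices. The rest
  of the reached part lies in old components that contain a newly deleted vertex, and there are at
  most \<open>k\<close> of these. Minimality transfers each bound to the other solution.\<close>

lemma compression_start:
  assumes prev: "\<And>v. prev v \<in> {2, 3, 4, 5}" and finp: "finite {v. prev v \<le> 4}" and x: "prev x = 5"
    and V: "V = insert x {v. prev v \<le> 4}"
    and minp: "minsol N d {v. prev v \<le> 4} {v. prev v = 2} {v. prev v = 3}" and cp: "card {v. prev v = 2} \<le> k"
    and N: "card V < N" and sol0: "sol d V X0 F0" and k: "card X0 \<le> k"
  shows "\<exists>\<chi> X F. range \<chi> \<subseteq> {2, 3, 4} \<and> minsol N d V X F \<and> card X \<le> k \<and>
    inv (start prev x \<chi>) \<and> {v. start prev x \<chi> v \<le> 4} = V \<and> compat d (start prev x \<chi>) X F \<and>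
    card {v. v = x \<or> prev v = 2} \<le> k + 1 \<and>
    card {v. prev v = 3 \<and> v \<in> reached (prep prev x \<chi>)} \<le> (2 * k + 1) * d \<and>
    pot (start prev x \<chi>) X F \<le> 3 * bound k d + k + (2 * k + 1) * d"
proof -
  let ?Vp = "{v. prev v \<le> 4}" and ?Xp = "{v. prev v = 2}" and ?Fp = "{v. prev v = 3}"
  obtain X Fs where min0: "minsol N d V X Fs" using minsol_exists[OF sol0] by metis
  have finV: "finite V" using finp V by simp
  have s0: "sol d V X Fs" using min0 unfolding minsol_def by blast
  have sp: "sol d ?Vp ?Xp ?Fp" using minp unfolding minsol_def by blast
  have finFs: "finite Fs" using s0 finV finite_subset unfolding sol_def by blast
  have cardV: "card F < N" if "F \<subseteq> V" for F using card_mono[OF finV that] N by linarith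
  have cX: "card X \<le> k"
  proof -
    have "card F0 < N" using sol0 cardV unfolding sol_def by blast
    then have "card X \<le> card X0" using min0 sol0 card_le_of_cost unfolding minsol_def by meson
    then show ?thesis using k by simp
  qed
  define Y where "Y = insert x ?Xp"
  have cp': "card Y \<le> k + 1" using cp card_insert_le_m1[of "k + 1" ?Xp x] unfolding Y_def by simp
  have finXp: "finite ?Xp" and finFp: "finite ?Fp" by (rule finite_subset[OF _ finp]; auto)+
  have finY: "finite Y" unfolding Y_def using finXp by simp
  have YV: "Y \<subseteq> V" unfolding Y_def V by auto
  have VY: "V - Y = ?Vp - ?Xp" unfolding Y_def V using x by auto
  have VY34: "v \<in> V - Y \<longleftrightarrow> prev v = 3 \<or> prev v = 4" for v
    unfolding VY using prev[of v] by auto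
  \<comment> \<open>\<open>S\<close> is what remains after the guessed deletions, \<open>M\<close>
    the part of it attached to a kept vertex of \<open>Y\<close>, and \<open>D\<close> the rest, a
    union of old components.\<close>
  define S where "S = V - X \<inter> Y"
  define M where "M = {v. \<exists>y\<in>Y - X. conn S y v}"
  define D where "D = S - M"
  have VYS: "V - Y \<subseteq> S" "V - X \<subseteq> S" unfolding S_def by blast+
  have YM: "Y - X \<subseteq> M" unfolding M_def S_def using YV by (auto intro: conn_refl)
  have DY: "D \<subseteq> V - Y" using YM unfolding D_def S_def by blast
  have DVp: "D \<subseteq> ?Vp - ?Xp" using DY unfolding VY .
  have MS: "M \<subseteq> S" unfolding M_def using conn_in by blast
  have MY: "M - Y \<subseteq> V - Y" using MS unfolding S_def by blast
  have clM: "w \<in> M" if "u \<in> M" "w \<in> S" "E u w" for u w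
    using that conn_step unfolding M_def by blast
  have clD: "w \<in> D" if "u \<in> D" "w \<in> S" "E u w" for u w
    using that clM[of w u] E_sym unfolding D_def by blast
  \<comment> \<open>Deleting vertices in \<open>D\<close> is a waste, as there the old solution can be kept.\<close>
  have XD: "X \<inter> D = {}"
  proof (rule ccontr)
    assume ne: "X \<inter> D \<noteq> {}"
    have solD: "sol d V (X - D) ((Fs - D) \<union> (?Fp \<inter> D))"
      unfolding sol_def
    proof (intro conjI ballI)
      have Vx: "V - (X - D) \<subseteq> S" unfolding S_def using DY by blast
      have "acyc ((V - X - Fs - D) \<union> (D - ?Fp))"
      proof (rule acyc_union)
        show "acyc (V - X - Fs - D)" using s0 unfolding sol_def by (blast intro: acyc_mono)
        have "D - ?Fp \<subseteq> ?Vp - ?Xp - ?Fp" using DY VY by blast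
        then show "acyc (D - ?Fp)" using sp unfolding sol_def by (blast intro: acyc_mono)
        show "finite (D - ?Fp)" using DY finV finite_subset by blast
        show "t = t' \<and> a = a'" if "conn (D - ?Fp) t t'" "a \<in> V - X - Fs - D" "E t a" for t t' a a'
          using that clD[of t a] conn_in[OF that(1)] VYS by blast
      qed blast
      then show "acyc (V - (X - D) - ((Fs - D) \<union> (?Fp \<inter> D)))" by (rule acyc_mono) blast
      fix v assume v: "v \<in> V - (X - D)"
      have cl': "w \<in> D" if "u \<in> D" "w \<in> V - (X - D)" "E u w" for u w using clD that Vx by blast
      show "card (((Fs - D) \<union> (?Fp \<inter> D)) \<inter> comp (V - (X - D)) v) \<le> d"
      proof (cases "v \<in> D")
        case True
        have "((Fs - D) \<union> (?Fp \<inter> D)) \<inter> comp (V - (X - D)) v \<subseteq> ?Fp \<inter> comp (?Vp - ?Xp) v"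
        proof
          fix z assume z: "z \<in> ((Fs - D) \<union> (?Fp \<inter> D)) \<inter> comp (V - (X - D)) v"
          then have c: "conn (V - (X - D)) v z" by simp
          have zD: "z \<in> D" and c': "conn ((V - (X - D)) \<inter> D) v z" 
            by (rule conn_closed_no_exit[OF c True]; use cl' in blast)+
          have "conn (?Vp - ?Xp) v z" using c' by (rule conn_mono) (use DVp in blast)
          then show "z \<in> ?Fp \<inter> comp (?Vp - ?Xp) v" using z zD by simp
        qed
        then have "card (((Fs - D) \<union> (?Fp \<inter> D)) \<inter> comp (V - (X - D)) v) \<le> card (?Fp \<inter> comp (?Vp - ?Xp) v)"
          using finFp by (intro card_mono) simp_all
        also have "\<dots> \<le> d" using sp True DVp unfolding sol_def by blast
        finally show ?thesis .
      next
        case False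
        have "((Fs - D) \<union> (?Fp \<inter> D)) \<inter> comp (V - (X - D)) v \<subseteq> Fs \<inter> comp (V - X) v"
        proof
          fix z assume z: "z \<in> ((Fs - D) \<union> (?Fp \<inter> D)) \<inter> comp (V - (X - D)) v"
          then have c: "conn (V - (X - D)) v z" by simp
          have zD: "z \<notin> D" and c': "conn (V - (X - D) - D) v z" 
            by (rule conn_closed_no_entry[OF c False]; use cl' in blast)+
          have "conn (V - X) v z" using c' by (rule conn_mono) blast
          then show "z \<in> Fs \<inter> comp (V - X) v" using z zD by simp
        qed
        then have "card (((Fs - D) \<union> (?Fp \<inter> D)) \<inter> comp (V - (X - D)) v) \<le> card (Fs \<inter> comp (V - X) v)"
          using finFs by (intro card_mono) simp_all
        also have "\<dots> \<le> d" using s0 v False unfolding sol_def by blast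
        finally show ?thesis .
      qed
    qed (use s0 DY VY V in \<open>auto simp: sol_def\<close>)
    then have "(Fs - D) \<union> (?Fp \<inter> D) \<subseteq> V" unfolding sol_def by blast
    then have "card X \<le> card (X - D)"
      using card_le_of_cost[OF _ cardV] min0 solD unfolding minsol_def by meson
    moreover have "card (X - D) < card X"
      using ne s0 finV finite_subset unfolding sol_def by (intro psubset_card_mono) blast+
    ultimately show False by simp
  qed
  have DX: "D \<subseteq> V - X" using XD DY by blast
  \<comment> \<open>On \<open>D\<close> the old feedback set is copied, because \<open>start\<close>
    leaves the old roles there and the target has to be compatible with them.\<close>
  define F where "F = (Fs - D) \<union> (?Fp \<inter> D)"
  have cl1: "w \<in> D" if "u \<in> D" "w \<in> V - X" "E u w" for u w using clD that VYS by blast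
  have clp: "w \<in> D" if "u \<in> D" "w \<in> ?Vp - ?Xp" "E u w" for u w using clD that VYS VY by blast
  have sF: "sol d V X F" unfolding F_def
    using s0 finV DX cl1 sp finp DVp by (rule sol_patch)
  have "card (?Fp \<inter> D) \<le> card (Fs \<inter> D)"
    using minp finp DVp clp s0 finV DX by (rule minsol_exchange)
  then have "card F \<le> card (Fs - D) + card (Fs \<inter> D)"
    unfolding F_def using card_Un_le[of "Fs - D" "?Fp \<inter> D"] by linarith
  also have "\<dots> = card Fs"
    using finite_subset[of Fs V] s0 finV unfolding sol_def
    by (subst card_Un_disjoint[symmetric]) (auto intro: arg_cong[where f = card])
  finally have "card F \<le> card Fs" .
  then have minF: "minsol N d V X F"
    using min0 sF unfolding minsol_def by (meson add_left_mono order_trans)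
  have FV: "F \<subseteq> V" "X \<subseteq> V" "X \<inter> F = {}" using sF unfolding sol_def by blast+
  have finX: "finite X" and finF: "finite F" using FV finV finite_subset by blast+
  have ciY: "card (Y - X) \<le> k + 1" using card_mono[OF finY, of "Y - X"] cp' by auto
  have compd: "card (F \<inter> comp (V - X) y) \<le> d" if "y \<in> V - X" for y using sF that unfolding sol_def by blast
  \<comment> \<open>\<open>U\<close> and \<open>\<tau>\<close> split \<open>M - Y\<close> by whether
    the old component avoids \<open>X\<close>; \<open>P\<close> and \<open>Q\<close> split what the
    new solution keeps of \<open>M\<close> by whether the new component meets
    \<open>Y\<close>.\<close>
  define U where "U = {v \<in> M - Y. comp (V - Y) v \<inter> X = {}}"
  define \<tau> where "\<tau> = {v \<in> M - Y. comp (V - Y) v \<inter> X \<noteq> {}}"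
  define P where "P = {v. \<exists>y\<in>Y - X. conn (V - X) y v}"
  define Q where "Q = {v \<in> M - X. v \<notin> P}"
  \<comment> \<open>After its last vertex of \<open>Y\<close>, a walk to a vertex of
    \<open>U\<close> stays in one old component, which avoids \<open>X\<close>. So the attachment to
    \<open>Y\<close> survives in the new kept graph.\<close>
  have UP: "U \<subseteq> P"
  proof
    fix v assume v: "v \<in> U"
    then obtain y where y: "y \<in> Y - X" "conn S y v" unfolding U_def M_def by blast
    from y(2) have "v \<notin> Y \<longrightarrow> comp (V - Y) v \<inter> X = {} \<longrightarrow> v \<in> P"
    proof (induction rule: conn_induct)
      case base
      then show ?case using y by blast
    next
      case (step u z)
      show ?case
      proof (intro impI)
        assume z: "z \<notin> Y" "comp (V - Y) z \<inter> X = {}"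
        have zV: "z \<in> V - Y" using z step S_def by blast
        then have "z \<in> comp (V - Y) z" by (simp add: conn_refl)
        then have zX: "z \<in> V - X" using z zV by blast
        show "z \<in> P"
        proof (cases "u \<in> Y")
          case True
          then have "u \<in> Y - X" "u \<in> V - X" using step S_def YV by blast+
          then show ?thesis unfolding P_def using conn_edge[of u z "V - X"] step zX by blast
        next
          case False
          then have uV: "u \<in> V - Y" using step S_def by blast
          then have "comp (V - Y) u = comp (V - Y) z" using conn_edge[of u z "V - Y"] step zV comp_eq by blast
          then have "u \<in> P" using step.IH False z by simp
          then show ?thesis unfolding P_def using step.hyps zX conn_step by blast
        qed
      qed
    qed
    then show "v \<in> P" using v unfolding U_def by blast
  qed
  have cP: "card (F \<inter> P) \<le> (k + 1) * d"
  proof -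
    have "F \<inter> P = (\<Union>y\<in>Y - X. F \<inter> comp (V - X) y)" unfolding P_def by auto
    also have "card \<dots> \<le> card (Y - X) * d"
      by (rule card_UN_le_mult) (use finY YV compd in auto)
    also have "\<dots> \<le> (k + 1) * d" using ciY by (rule mult_le_mono1)
    finally show ?thesis .
  qed
  \<comment> \<open>\<open>U\<close> is a union of old components kept by the new solution too, so
    minimality of the old one bounds its feedback vertices there by those of \<open>F\<close>, and
    \<open>U \<subseteq> P\<close>.\<close>
  have cU: "card (?Fp \<inter> U) \<le> (k + 1) * d"
  proof -
    have "card (?Fp \<inter> U) \<le> card (F \<inter> U)"
    proof (rule minsol_exchange[OF minp finp])
      show "U \<subseteq> ?Vp - ?Xp" using MY VY unfolding U_def by blast
      show "w \<in> U" if "u \<in> U" "w \<in> ?Vp - ?Xp" "E u w" for u w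
      proof -
        have w: "w \<in> V - Y" using that VY by blast
        then have "w \<in> M" using clM[of u w] that VYS unfolding U_def by blast
        moreover have "comp (V - Y) u = comp (V - Y) w"
          using comp_eq conn_edge[of u w "V - Y"] that w MY unfolding U_def by blast
        ultimately show ?thesis using that w unfolding U_def by auto
      qed
      show "sol d V X F" "finite V" by fact+
      show "U \<subseteq> V - X"
      proof
        fix v assume v: "v \<in> U"
        then have "v \<in> V - Y" using MY unfolding U_def by blast
        moreover from this have "v \<in> comp (V - Y) v" by (simp add: conn_refl)
        ultimately show "v \<in> V - X" using v unfolding U_def by blast
      qed
    qed
    also have "\<dots> \<le> card (F \<inter> P)" using UP finF by (intro card_mono) auto
    finally show ?thesis using cP by simp
  qed
  \<comment> \<open>Every old component inside \<open>\<tau>\<close> contains a vertex of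
    \<open>X - Y\<close>, so at most \<open>k\<close> old components contribute.\<close>
  have ct: "card (?Fp \<inter> \<tau>) \<le> k * d"
  proof -
    have "?Fp \<inter> \<tau> \<subseteq> (\<Union>y\<in>X - Y. ?Fp \<inter> comp (V - Y) y)"
    proof
      fix v assume v: "v \<in> ?Fp \<inter> \<tau>"
      then obtain y where y: "conn (V - Y) v y" "y \<in> X" unfolding \<tau>_def by auto
      then have "y \<in> X - Y" using conn_in by blast
      then show "v \<in> (\<Union>y\<in>X - Y. ?Fp \<inter> comp (V - Y) y)" using y v conn_sym by auto
    qed
    moreover have "finite (\<Union>y\<in>X - Y. ?Fp \<inter> comp (V - Y) y)"
      using finX finFp by auto
    ultimately have "card (?Fp \<inter> \<tau>) \<le> card (\<Union>y\<in>X - Y. ?Fp \<inter> comp (V - Y) y)" by (rule card_mono[rotated])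
    also have "\<dots> \<le> card (X - Y) * d"
    proof (rule card_UN_le_mult)
      fix y assume "y \<in> X - Y"
      then have "y \<in> ?Vp - ?Xp" using FV VY by blast
      then show "card (?Fp \<inter> comp (V - Y) y) \<le> d" unfolding VY using sp unfolding sol_def by blast
    qed (use finX in simp)
    also have "\<dots> \<le> k * d" using cX card_mono[OF finX, of "X - Y"] by (intro mult_le_mono1) simp
    finally show ?thesis .
  qed
  have FpM: "card (?Fp \<inter> M) \<le> (2 * k + 1) * d"
  proof -
    have "?Fp \<inter> M \<subseteq> (?Fp \<inter> U) \<union> (?Fp \<inter> \<tau>)"
      unfolding U_def \<tau>_def Y_def using x by auto
    then have "card (?Fp \<inter> M) \<le> card ((?Fp \<inter> U) \<union> (?Fp \<inter> \<tau>))"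
      using finFp by (intro card_mono) auto
    also have "\<dots> \<le> card (?Fp \<inter> U) + card (?Fp \<inter> \<tau>)" by (rule card_Un_le)
    also have "\<dots> \<le> (k + 1) * d + k * d" using cU ct by (rule add_mono)
    also have "\<dots> = (2 * k + 1) * d" by (simp add: algebra_simps)
    finally show ?thesis .
  qed
  have Qt: "Q \<subseteq> \<tau>"
  proof
    fix v assume v: "v \<in> Q"
    have "v \<notin> Y"
    proof
      assume "v \<in> Y"
      then have "v \<in> P" using v YV conn_refl[of v "V - X"] unfolding P_def Q_def by blast
      then show False using v unfolding Q_def by blast
    qed
    then show "v \<in> \<tau>" using v UP unfolding Q_def \<tau>_def U_def by blast
  qed
  \<comment> \<open>On \<open>Q\<close> the comparison runs the other way: \<open>F\<close> is
    minimal, \<open>Q\<close> is a union of new components free of \<open>Y\<close>, and there the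
    old feedback set bounds \<open>F\<close>.\<close>
  have FM: "card (F \<inter> M) \<le> (2 * k + 1) * d"
  proof -
    have "card (F \<inter> Q) \<le> card (?Fp \<inter> Q)"
    proof (rule minsol_exchange[OF minF finV])
      show "Q \<subseteq> V - X" using MS unfolding Q_def S_def by blast
      show "w \<in> Q" if "u \<in> Q" "w \<in> V - X" "E u w" for u w
      proof -
        have "w \<in> M" using clM[of u w] that VYS unfolding Q_def by blast
        moreover have "w \<notin> P"
        proof
          assume "w \<in> P"
          moreover have "u \<in> V - X" using that MS unfolding Q_def S_def by blast
          ultimately have "u \<in> P" using conn_step E_sym that(3) unfolding P_def by blast
          then show False using that unfolding Q_def by blast
        qed
        ultimately show ?thesis using that unfolding Q_def by blast
      qed
      show "sol d ?Vp ?Xp ?Fp" "finite ?Vp" by fact+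
      show "Q \<subseteq> ?Vp - ?Xp" using Qt MY VY unfolding \<tau>_def by blast
    qed
    also have "\<dots> \<le> card (?Fp \<inter> \<tau>)"
      using Qt finFp by (intro card_mono) auto
    also have "\<dots> \<le> k * d" by (rule ct)
    finally have "card (F \<inter> Q) \<le> k * d" .
    moreover have "F \<inter> M \<subseteq> (F \<inter> P) \<union> (F \<inter> Q)" using FV unfolding Q_def by blast
    then have "card (F \<inter> M) \<le> card ((F \<inter> P) \<union> (F \<inter> Q))" using finF by (intro card_mono) auto
    moreover have "\<dots> \<le> card (F \<inter> P) + card (F \<inter> Q)" by (rule card_Un_le)
    ultimately have "card (F \<inter> M) \<le> (k + 1) * d + k * d" using cP by linarith
    then show ?thesis by (simp add: algebra_simps)
  qed
  define \<chi> where "\<chi> v = (if v \<in> X then 2 else if v \<in> F then 3 else 4 :: nat)" for v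
  let ?r1 = "prep prev x \<chi>" and ?r = "start prev x \<chi>"
  have Yi: "v = x \<or> prev v = 2 \<longleftrightarrow> v \<in> Y" for v unfolding Y_def by simp
  have p5: "prev v = 5 \<longleftrightarrow> v \<notin> ?Vp" for v using prev[of v] by auto
  have r1: "?r1 v = (if v \<in> Y then \<chi> v else if v \<in> V then 0 else 5)" for v
    unfolding prep_def Yi p5 V Y_def by auto
  have "{v. ?r1 v \<noteq> 2 \<and> ?r1 v \<noteq> 5} = S"
    unfolding r1 S_def \<chi>_def using YV by auto
  moreover have "?r1 y = 3 \<or> ?r1 y = 4 \<longleftrightarrow> y \<in> Y - X" for y
    unfolding r1 \<chi>_def by auto
  ultimately have reach: "reached ?r1 = M" unfolding reached_def M_def by auto
  have rY: "?r v = \<chi> v" if "v \<in> Y" for v 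
  proof -
    have "v = x \<or> prev v = 2 \<or> prev v = 5" using that Yi by blast
    then show ?thesis using r1[of v] that unfolding start_def by simp
  qed
  have rO: "?r v = 5" if "v \<notin> V" for v
  proof -
    have "v \<notin> Y" "v \<noteq> x" "prev v = 5" using that YV V p5 by auto
    then show ?thesis using r1[of v] that unfolding start_def by simp
  qed
  have rV: "?r v = (if v \<in> M then if prev v = 3 then \<chi> v else 0 else prev v)" if "v \<in> V - Y" for v
  proof -
    have "\<not> (v = x \<or> prev v = 2 \<or> prev v = 5)" using that VY34[of v] x by auto
    then show ?thesis unfolding start_def reach by simp
  qed
  have MVYX: "v \<in> M \<or> v \<in> D" if "v \<in> V - Y" for v using that VYS unfolding D_def by blast
  have le4: "{v. ?r v \<le> 4} = V"
  proof (intro set_eqI iffI CollectI)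
    fix v assume "v \<in> {v. ?r v \<le> 4}"
    then show "v \<in> V" using rO[of v] by (cases "v \<in> V") auto
  next
    fix v assume v: "v \<in> V"
    show "?r v \<le> 4"
    proof (cases "v \<in> Y")
      case True
      then show ?thesis using rY \<chi>_def by simp
    next
      case False
      then show ?thesis using rV[of v] v VY34[of v] \<chi>_def by auto
    qed
  qed
  have r01: "?r v \<le> 1 \<longleftrightarrow> v \<in> M - Y \<and> prev v \<noteq> 3" "?r v \<noteq> 1" for v
  proof -
    consider "v \<in> Y" | "v \<notin> V" | "v \<in> V - Y" by blast
    then have "(?r v \<le> 1 \<longleftrightarrow> v \<in> M - Y \<and> prev v \<noteq> 3) \<and> ?r v \<noteq> 1"
    proof cases
      case 1
      then show ?thesis using rY[of v] \<chi>_def by auto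
    next
      case 2
      then show ?thesis using rO[of v] MY by auto
    next
      case 3
      then show ?thesis using rV[of v] VY34[of v] \<chi>_def by auto
    qed
    then show "?r v \<le> 1 \<longleftrightarrow> v \<in> M - Y \<and> prev v \<noteq> 3" "?r v \<noteq> 1" by blast+
  qed
  have "{v. ?r v \<le> 1} \<subseteq> ?Vp - ?Xp - ?Fp" using r01 MY VY by auto
  then have "acyc {v. ?r v \<le> 1}" using sp unfolding sol_def by (blast intro: acyc_mono)
  moreover have "{v. ?r v = 1} = {}" using r01 by blast
  then have "\<not> conn {v. ?r v = 1} t t'" for t t' using conn_in[of "{v. ?r v = 1}" t t'] by blast
  ultimately have inv: "inv ?r" unfolding inv_def le4 using finV r01 by blast
  have r234: "(?r v = 2 \<longrightarrow> v \<in> X) \<and> (?r v = 3 \<longrightarrow> v \<in> F) \<and> (?r v = 4 \<longrightarrow> v \<notin> X \<and> v \<notin> F)" for v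
  proof -
    consider "v \<in> Y" | "v \<notin> V" | "v \<in> V - Y" "v \<in> M" | "v \<in> V - Y" "v \<in> D" using MVYX by blast
    then show ?thesis
    proof cases
      case 1
      then show ?thesis using rY[of v] \<chi>_def by auto
    next
      case 2
      then show ?thesis using rO[of v] by auto
    next
      case 3
      then show ?thesis using rV[of v] \<chi>_def by auto
    next
      case 4
      then have "?r v = prev v" "v \<notin> X" using rV[of v] XD unfolding D_def by auto
      moreover have "v \<in> F \<longleftrightarrow> prev v = 3" using 4 unfolding F_def by blast
      ultimately show ?thesis using VY34[of v] 4 by auto
    qed
  qed
  have com: "compat d ?r X F" unfolding compat_def le4 using sF r234 by auto
  have Zc: "card (Y \<union> (?Fp \<inter> M)) \<le> bound k d"
    unfolding bound_def using card_Un_le[of Y "?Fp \<inter> M"] cp' FpM by linarith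
  have finZ: "finite (Y \<union> (?Fp \<inter> M))" using finY finFp by auto
  \<comment> \<open>Open vertices lie in \<open>M\<close>, which is closed under edges within
    \<open>S\<close>. So a decided vertex next to an open one is in \<open>Y\<close> or is a reached
    old feedback vertex, and every piece contains such a guessed vertex.\<close>
  have pc: "card (pieces ?r W) \<le> bound k d" if W: "W \<subseteq> {v. ?r v = 3 \<or> ?r v = 4}" for W
  proof -
    have "{p \<in> W. \<exists>h. ?r h \<le> 1 \<and> E h p} \<subseteq> Y \<union> (?Fp \<inter> M)"
    proof
      fix p assume "p \<in> {p \<in> W. \<exists>h. ?r h \<le> 1 \<and> E h p}"
      then obtain h where p: "?r p = 3 \<or> ?r p = 4" "?r h \<le> 1" "E h p" using W by auto
      show "p \<in> Y \<union> (?Fp \<inter> M)"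
      proof (cases "p \<in> Y")
        case False
        have "p \<in> V" using p le4 by auto
        then have pV: "p \<in> V - Y" using False by blast
        then have "p \<in> M" using clM[of h p] p r01 VYS by blast
        then show ?thesis using rV[OF pV] p by (auto split: if_splits)
      qed blast
    qed
    then have "card (pieces ?r W) \<le> card (comp W ` (Y \<union> (?Fp \<inter> M)))"
      unfolding pieces_def using finZ by (intro card_mono) auto
    also have "\<dots> \<le> card (Y \<union> (?Fp \<inter> M))" using finZ by (rule card_image_le)
    finally show ?thesis using Zc by simp
  qed
  have c1: "card (X - {v. ?r v = 2}) \<le> k" using cX card_mono[OF finX, of "X - {v. ?r v = 2}"] by auto
  have "F - {v. ?r v = 3} \<subseteq> F \<inter> M"
  proof
    fix v assume v: "v \<in> F - {v. ?r v = 3}"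
    show "v \<in> F \<inter> M"
    proof (rule ccontr)
      assume "v \<notin> F \<inter> M"
      then have "v \<in> D" using v FV VYS unfolding D_def by blast
      moreover from this have "prev v = 3" using v unfolding F_def by blast
      ultimately show False using rV[of v] DY v unfolding D_def by auto
    qed
  qed
  then have c2: "card (F - {v. ?r v = 3}) \<le> (2 * k + 1) * d"
    using FM finF card_mono[of "F \<inter> M" "F - {v. ?r v = 3}"] by auto
  have "card (pieces ?r {v. ?r v = 3 \<or> ?r v = 4}) \<le> bound k d" by (rule pc) blast
  moreover have "card (pieces ?r {v. ?r v = 4}) \<le> bound k d" by (rule pc) blast
  ultimately have "pot ?r X F \<le> 3 * bound k d + k + (2 * k + 1) * d"
    unfolding pot_def using c1 c2 by linarith
  moreover have "{v. v = x \<or> prev v = 2} = Y" unfolding Y_def by auto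
  moreover have "{v. prev v = 3 \<and> v \<in> reached ?r1} = ?Fp \<inter> M" unfolding reach by auto
  moreover have "range \<chi> \<subseteq> {2, 3, 4}" unfolding \<chi>_def by auto
  ultimately show ?thesis using minF cX inv le4 com cp' FpM by (intro exI[of _ \<chi>] exI[of _ X] exI[of _ F]) simp
qed

end

section \<open>The branching procedure\<close>

text \<open>Zero means that no index satisfies \<open>P\<close>; otherwise the value is one more
  than the last such index. A loop that overwrites one variable computes exactly this.\<close>

primrec last_sat :: "(nat \<Rightarrow> bool) \<Rightarrow> nat \<Rightarrow> nat" where
  "last_sat P 0 = 0"
| "last_sat P (Suc v) = (if P v then Suc v else last_sat P v)"

lemma last_sat_eq_0: "last_sat P n = 0 \<longleftrightarrow> (\<forall>v<n. \<not> P v)"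
  by (induction n) (auto simp: less_Suc_eq)

lemma last_sat_eq_Suc: "last_sat P n = Suc v \<Longrightarrow> P v \<and> v < n"
  by (induction n) (auto split: if_splits)

text \<open>Numbers below \<open>3 ^ l\<close> stand for the ternary strings of length
  \<open>l\<close>, continued by zeros.\<close>

definition digit :: "nat \<Rightarrow> nat \<Rightarrow> nat" where
  "digit c i = (c div 3 ^ i) mod 3"

lemma digits_exist:
  assumes "\<And>i. \<delta> i < (3::nat)"
  shows "\<exists>c<3 ^ l. \<forall>i<l. digit c i = \<delta> i"
  using assms
proof (induction l arbitrary: \<delta>)
  case (Suc l)
  then obtain c where c: "c < 3 ^ l" "\<forall>i<l. digit c i = \<delta> (Suc i)"
    using Suc.IH[of "\<lambda>i. \<delta> (Suc i)"] by blast
  have "digit (3 * c + \<delta> 0) i = \<delta> i" if "i < Suc l" for i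
  proof (cases i)
    case (Suc j)
    have "(3 * c + \<delta> 0) div 3 = c" using Suc.prems[of 0] by simp
    then have "digit (3 * c + \<delta> 0) i = digit c j"
      unfolding digit_def Suc by (simp add: div_mult2_eq)
    then show ?thesis using c that Suc by simp
  qed (use Suc.prems[of 0] in \<open>simp add: digit_def\<close>)
  moreover have "3 * c + \<delta> 0 < 3 ^ Suc l" using c(1) Suc.prems[of 0] by simp
  ultimately show ?case by blast
qed simp

text \<open>The rank of \<open>v\<close> in \<open>S\<close>. A loop over the vertices in increasing
  order that consumes one symbol per element of \<open>S\<close> is at this position of the string
  when it meets \<open>v\<close>.\<close>

definition idx :: "nat set \<Rightarrow> nat \<Rightarrow> nat" where
  "idx S v = card {u \<in> S. u < v}"

lemma idx_less: "finite S \<Longrightarrow> v \<in> S \<Longrightarrow> idx S v < card S"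
  unfolding idx_def by (intro psubset_card_mono) auto

lemma idx_inj: "finite S \<Longrightarrow> inj_on (idx S) S"
proof (rule linorder_inj_onI)
  fix u v assume "finite S" "u < v" "u \<in> S" "v \<in> S"
  then have "card {x \<in> S. x < u} < card {x \<in> S. x < v}" by (intro psubset_card_mono) auto
  then show "idx S u \<noteq> idx S v" unfolding idx_def by simp
qed auto

section \<open>Branching driven by a guess string\<close>

locale deletion_instance = ugraph E for E :: "nat \<Rightarrow> nat \<Rightarrow> bool" +
  fixes n k d :: nat
  assumes E_less: "E u v \<Longrightarrow> u < n \<and> v < n"
begin

definition pick :: "(nat \<Rightarrow> nat) \<Rightarrow> nat" where
  "pick r = last_sat (\<lambda>v. r v = 0 \<and> low {x. r x = 0} v) n"

text \<open>The second component points into the guess string. It advances only at a genuine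
  branching, so the symbols consumed are bounded by the potential and not by
  \<open>n\<close>.\<close>

definition step :: "(nat \<Rightarrow> nat) \<Rightarrow> (nat \<Rightarrow> nat) \<times> nat \<Rightarrow> (nat \<Rightarrow> nat) \<times> nat" where
  "step \<delta> = (\<lambda>(r, i). case pick r of 0 \<Rightarrow> (r, i) | Suc v \<Rightarrow>
     if light {x. r x = 4} {x. r x = 3 \<or> r x = 4} (stree r v) then (r(v := 1), i)
     else (move r v (\<delta> i), Suc i))"

lemma step_cases:
  obtains (none) "\<And>\<delta> i. step \<delta> (r, i) = (r, i)" "\<And>v. v < n \<Longrightarrow> r v = 0 \<Longrightarrow> \<not> low {x. r x = 0} v"
  | (light) v where "\<And>\<delta> i. step \<delta> (r, i) = (r(v := 1), i)" "r v = 0" "low {x. r x = 0} v" "v < n"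
      "light {x. r x = 4} {x. r x = 3 \<or> r x = 4} (stree r v)"
  | (branch) v where "\<And>\<delta> i. step \<delta> (r, i) = (move r v (\<delta> i), Suc i)" "r v = 0" "v < n"
      "\<not> light {x. r x = 4} {x. r x = 3 \<or> r x = 4} (stree r v)"
proof (cases "pick r")
  case 0
  then have "\<not> low {x. r x = 0} v" if "v < n" "r v = 0" for v
    using that unfolding pick_def last_sat_eq_0 by blast
  moreover have "step \<delta> (r, i) = (r, i)" for \<delta> i using 0 unfolding step_def by simp
  ultimately show ?thesis using none by blast
next
  case (Suc v)
  then have v: "r v = 0" "low {x. r x = 0} v" "v < n" using last_sat_eq_Suc unfolding pick_def by blast+
  show ?thesis
  proof (cases "light {x. r x = 4} {x. r x = 3 \<or> r x = 4} (stree r v)")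
    case True
    then have "step \<delta> (r, i) = (r(v := 1), i)" for \<delta> i using Suc unfolding step_def by simp
    then show ?thesis using light v True by blast
  next
    case False
    then have "step \<delta> (r, i) = (move r v (\<delta> i), Suc i)" for \<delta> i using Suc unfolding step_def by simp
    then show ?thesis using branch v False by blast
  qed
qed

lemma pot_absorb:
  assumes "r v = 0" shows "pot (r(v := 1)) X F = pot r X F"
proof -
  have "{x. (r(v := 1)) x = 3 \<or> (r(v := 1)) x = 4} = {x. r x = 3 \<or> r x = 4}"
    "{x. (r(v := 1)) x = 4} = {x. r x = 4}" "{x. (r(v := 1)) x = 3} = {x. r x = 3}"
    "{x. (r(v := 1)) x = 2} = {x. r x = 2}"
    using assms by auto
  moreover have "pieces (r(v := 1)) S = pieces r S" for S
  proof -
    have "(r(v := 1)) h \<le> 1 \<longleftrightarrow> r h \<le> 1" for h using assms by simp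
    then show ?thesis unfolding pieces_def by simp
  qed
  ultimately show ?thesis unfolding pot_def by simp
qed

text \<open>The right choices form a list fixed before \<open>\<delta>\<close> and the pointer,
  since the string is assembled only later and the list sits somewhere in its middle. Each branching
  uses one entry and lowers the potential. Every effective step removes one undecided vertex, so
  \<open>n\<close> steps finish.\<close>

lemma walk_complete:
  assumes "inv r" "compat d r X F" "{x. r x \<le> 4} \<subseteq> {..<n}"
  shows "\<exists>ds. length ds \<le> pot r X F \<and> set ds \<subseteq> {..<3} \<and>
    (\<forall>\<delta> i. (\<forall>j<length ds. \<delta> (i + j) = ds ! j) \<longrightarrow>
      (\<exists>r' i' X' F'. (step \<delta> ^^ m) (r, i) = (r', i') \<and> inv r' \<and> compat d r' X' F' \<and>
        card X' \<le> card X \<and> card F' \<le> card F \<and> card {x. r' x = 0} \<le> card {x. r x = 0} - m))"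
  using assms
proof (induction m arbitrary: r X F)
  case 0
  show ?case
  proof (intro exI[of _ "[]"] conjI allI impI)
    fix \<delta> :: "nat \<Rightarrow> nat" and i
    show "\<exists>r' i' X' F'. (step \<delta> ^^ 0) (r, i) = (r', i') \<and> inv r' \<and> compat d r' X' F' \<and>
        card X' \<le> card X \<and> card F' \<le> card F \<and> card {x. r' x = 0} \<le> card {x. r x = 0} - 0"
      using "0.prems" by auto
  qed simp_all
next
  case (Suc m)
  have fin0: "finite {x. r x = 0}" by (rule inv_finite[OF Suc.prems(1)]) auto
  show ?case
  proof (cases rule: step_cases[of r])
    case none
    have no: "r v \<noteq> 0" for v
    proof
      assume "r v = 0"
      then obtain u where u: "r u = 0" "low {x. r x = 0} u" using ex_low_undecided Suc.prems(1) by blast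
      have "u \<in> {x. r x \<le> 4}" using u(1) by simp
      then have "u < n" using Suc.prems(3) by blast
      then show False using none(2) u by blast
    qed
    have it: "(step \<delta> ^^ m') (r, i) = (r, i)" for \<delta> i m'
      by (induction m') (simp_all add: none(1))
    show ?thesis
    proof (intro exI[of _ "[]"] conjI allI impI)
      fix \<delta> :: "nat \<Rightarrow> nat" and i
      show "\<exists>r' i' X' F'. (step \<delta> ^^ Suc m) (r, i) = (r', i') \<and> inv r' \<and> compat d r' X' F' \<and>
          card X' \<le> card X \<and> card F' \<le> card F \<and> card {x. r' x = 0} \<le> card {x. r x = 0} - Suc m"
      proof -
        have "{x. r x = 0} = {}" using no by simp
        then have "card {x. r x = 0} \<le> card {x. r x = 0} - Suc m" by (simp del: Collect_empty_eq)
        then show ?thesis using Suc.prems(1,2) it[of "Suc m" \<delta> i] by blast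
      qed
    qed simp_all
  next
    case (light v)
    let ?r = "r(v := 1)"
    have c0: "{x. ?r x = 0} = {x. r x = 0} - {v}" by auto
    have c0': "card {x. ?r x = 0} = card {x. r x = 0} - 1" unfolding c0 using light(2) by simp
    obtain ds where ds: "length ds \<le> pot ?r X F" "set ds \<subseteq> {..<3}"
      "\<forall>\<delta> i. (\<forall>j<length ds. \<delta> (i + j) = ds ! j) \<longrightarrow>
        (\<exists>r' i' X' F'. (step \<delta> ^^ m) (?r, i) = (r', i') \<and> inv r' \<and> compat d r' X' F' \<and>
        card X' \<le> card X \<and> card F' \<le> card F \<and> card {x. r' x = 0} \<le> card {x. ?r x = 0} - m)"
    proof -
      have "{x. ?r x \<le> 4} \<subseteq> {..<n}" unfolding role_upd_le[of r v, OF light(2)] by (rule Suc.prems(3))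
      from Suc.IH[OF inv_absorb[of r v, OF Suc.prems(1) light(2,3,5)] compat_absorb[of d r X F v, OF Suc.prems(2) light(2)] this]
      show thesis by (elim exE conjE) (rule that)
    qed
    have s: "(step \<delta> ^^ Suc m) (r, i) = (step \<delta> ^^ m) (?r, i)" for \<delta> i
      by (simp add: funpow_Suc_right light(1) del: funpow.simps)
    have c1: "card {x. r x = 0} - Suc m = card {x. ?r x = 0} - m" unfolding c0' by simp
    show ?thesis unfolding s c1 using ds unfolding pot_absorb[of r v, OF light(2)] by blast
  next
    case (branch v)
    obtain c X1 F1 where c: "c < 3" "compat d (move r v c) X1 F1" "card X1 \<le> card X" "card F1 \<le> card F"
      "pot (move r v c) X1 F1 < pot r X F"
      using branch_step[OF Suc.prems(1) branch(2) Suc.prems(2) branch(4)] by blast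
    let ?r = "move r v c"
    have c0': "card {x. ?r x = 0} = card {x. r x = 0} - 1"
      unfolding move_eq0[of r v, OF branch(2)] using branch(2) by simp
    obtain ds where ds: "length ds \<le> pot ?r X1 F1" "set ds \<subseteq> {..<3}"
      "\<And>\<delta> i. (\<forall>j<length ds. \<delta> (i + j) = ds ! j) \<Longrightarrow>
        (\<exists>r' i' X' F'. (step \<delta> ^^ m) (?r, i) = (r', i') \<and> inv r' \<and> compat d r' X' F' \<and>
        card X' \<le> card X1 \<and> card F' \<le> card F1 \<and> card {x. r' x = 0} \<le> card {x. ?r x = 0} - m)"
    proof -
      have "{x. ?r x \<le> 4} \<subseteq> {..<n}" unfolding move_le4[of r v, OF branch(2)] by (rule Suc.prems(3))
      from Suc.IH[OF inv_move[of r v, OF Suc.prems(1) branch(2)] c(2) this]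
      show thesis using that by (elim exE conjE) blast
    qed
    show ?thesis
    proof (intro exI[of _ "c # ds"] conjI allI impI)
      fix \<delta> :: "nat \<Rightarrow> nat" and i
      assume h: "\<forall>j<length (c # ds). \<delta> (i + j) = (c # ds) ! j"
      then have i: "\<delta> i = c" by force
      have "\<delta> (Suc i + j) = ds ! j" if "j < length ds" for j
        using h[rule_format, of "Suc j"] that by simp
      from ds(3)[of \<delta> "Suc i"] this
      obtain r' i' X' F' where r': "(step \<delta> ^^ m) (?r, Suc i) = (r', i')" "inv r'" "compat d r' X' F'"
        "card X' \<le> card X1" "card F' \<le> card F1" "card {x. r' x = 0} \<le> card {x. ?r x = 0} - m" by blast
      moreover have "(step \<delta> ^^ Suc m) (r, i) = (r', i')"
        using r'(1) i by (simp add: funpow_Suc_right branch(1) del: funpow.simps)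
      ultimately show "\<exists>r' i' X' F'. (step \<delta> ^^ Suc m) (r, i) = (r', i') \<and> inv r' \<and> compat d r' X' F' \<and>
          card X' \<le> card X \<and> card F' \<le> card F \<and> card {x. r' x = 0} \<le> card {x. r x = 0} - Suc m"
        using c c0' by (intro exI[of _ r'] exI[of _ i'] exI[of _ X'] exI[of _ F']) auto
    qed (use ds c in auto)
  qed
qed

lemma step_range:
  assumes "\<And>v. r v \<le> 5"
  shows "{x. fst (step \<delta> (r, i)) x \<le> 4} = {x. r x \<le> 4}" "fst (step \<delta> (r, i)) v \<le> 5"
proof -
  have "move r u c v \<le> 5" for u c using assms[of v] unfolding move_def by auto
  then show "{x. fst (step \<delta> (r, i)) x \<le> 4} = {x. r x \<le> 4}" "fst (step \<delta> (r, i)) v \<le> 5"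
    using assms[of v] role_upd_le[of r] move_le4[of r]
    by (cases rule: step_cases[of r]; auto)+
qed

lemma walk_range:
  assumes "\<And>v. r v \<le> 5"
  shows "{x. fst ((step \<delta> ^^ m) (r, i)) x \<le> 4} = {x. r x \<le> 4} \<and> (\<forall>v. fst ((step \<delta> ^^ m) (r, i)) v \<le> 5)"
proof (induction m)
  case (Suc m)
  obtain r' i' where r': "(step \<delta> ^^ m) (r, i) = (r', i')" by (metis surj_pair)
  then show ?case using Suc step_range[of r' \<delta> i'] by auto
qed (use assms in simp)

definition guessed :: "(nat \<Rightarrow> nat) \<Rightarrow> nat \<Rightarrow> nat set" where
  "guessed prev x = {v. v = x \<or> prev v = 2}"

text \<open>Symbols 0, 1, 2 stand for the roles 2, 3, 4, here and in \<open>guess\<close>.\<close>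

definition guess1 :: "(nat \<Rightarrow> nat) \<Rightarrow> nat \<Rightarrow> (nat \<Rightarrow> nat) \<Rightarrow> nat \<Rightarrow> nat" where
  "guess1 prev x \<delta> v = \<delta> (idx (guessed prev x) v) + 2"

definition reguessed :: "(nat \<Rightarrow> nat) \<Rightarrow> nat \<Rightarrow> (nat \<Rightarrow> nat) \<Rightarrow> nat set" where
  "reguessed prev x \<delta> = {v. prev v = 3 \<and> v \<in> reached (prep prev x (guess1 prev x \<delta>))}"

definition guess :: "(nat \<Rightarrow> nat) \<Rightarrow> nat \<Rightarrow> (nat \<Rightarrow> nat) \<Rightarrow> nat \<Rightarrow> nat" where
  "guess prev x \<delta> v = (if v \<in> guessed prev x then guess1 prev x \<delta> v
     else \<delta> (card (guessed prev x) + idx (reguessed prev x \<delta>) v) + 2)"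

text \<open>Whatever is undecided or absorbed after \<open>n\<close> steps is declared forest. On a
  successful run only absorbed vertices are left, and \<open>sol_finish\<close> justifies
  this.\<close>

definition attempt :: "(nat \<Rightarrow> nat) \<Rightarrow> nat \<Rightarrow> (nat \<Rightarrow> nat) \<Rightarrow> nat \<Rightarrow> nat" where
  "attempt prev x \<delta> v =
     (let r = fst ((step \<delta> ^^ n) (start prev x (guess prev x \<delta>),
        card (guessed prev x) + card (reguessed prev x \<delta>))) v
      in if r \<le> 1 then 4 else r)"

definition valid :: "(nat \<Rightarrow> nat) \<Rightarrow> bool" where
  "valid r \<longleftrightarrow> sol d {v. r v \<le> 4} {v. r v = 2} {v. r v = 3} \<and> card {v. r v = 2} \<le> k"

text \<open>The cost in \<open>minsol\<close> for \<open>N = Suc n\<close>, which exceeds the number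
  of vertices present.\<close>

definition price :: "(nat \<Rightarrow> nat) \<Rightarrow> nat" where
  "price r = Suc n * card {v. r v = 2} + card {v. r v = 3}"

text \<open>The guessed roles take \<open>k + 1\<close> and \<open>(2 * k + 1) * d\<close> symbols,
  and the choices at most the initial potential. In all this is
  \<open>5 * k + 4 + (10 * k + 5) * d\<close>.\<close>

definition str_len :: nat where
  "str_len = 10 * (k + 1) * (d + 1)"

lemma prep_cong:
  assumes "\<And>v. v \<in> guessed prev x \<Longrightarrow> \<chi> v = \<chi>' v"
  shows "prep prev x \<chi> = prep prev x \<chi>'"
  using assms unfolding prep_def guessed_def by auto

lemma start_cong:
  assumes "\<And>v. v \<in> guessed prev x \<Longrightarrow> \<chi> v = \<chi>' v"
    and "\<And>v. prev v = 3 \<Longrightarrow> v \<in> reached (prep prev x \<chi>) \<Longrightarrow> \<chi> v = \<chi>' v"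
  shows "start prev x \<chi> = start prev x \<chi>'"
proof -
  have "prep prev x \<chi>' = prep prev x \<chi>" using assms(1) by (intro prep_cong) simp
  then show ?thesis unfolding start_def using assms(2) by auto
qed

text \<open>This covers wrong strings as well: they too must produce roles that the check can
  interpret.\<close>

lemma attempt_range:
  assumes prev: "\<And>v. prev v \<in> {2, 3, 4, 5}" "{v. prev v \<le> 4} = {..<x}" and \<delta>: "\<And>i. \<delta> i < 3"
  shows "{v. attempt prev x \<delta> v \<le> 4} = {..<Suc x}" "attempt prev x \<delta> v \<in> {2, 3, 4, 5}"
proof -
  let ?g = "guess prev x \<delta>"
  have g: "?g v \<le> 4" for v
    using \<delta>[of "idx (guessed prev x) v"] \<delta>[of "card (guessed prev x) + idx (reguessed prev x \<delta>) v"]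
    unfolding guess_def guess1_def by auto
  have p5: "prev v = 5 \<longleftrightarrow> \<not> v < x" for v
  proof -
    have "v \<in> {v. prev v \<le> 4} \<longleftrightarrow> v \<in> {..<x}" using prev(2) by blast
    then show ?thesis using prev(1)[of v] by auto
  qed
  have s: "start prev x ?g v \<le> 5 \<and> (start prev x ?g v \<le> 4 \<longleftrightarrow> v < Suc x)" for v
    using g[of v] prev(1)[of v] p5[of v] unfolding start_def prep_def by (auto simp: less_Suc_eq)
  then have w: "{v. fst ((step \<delta> ^^ n) (start prev x ?g, i)) v \<le> 4} = {..<Suc x}"
      "\<forall>v. fst ((step \<delta> ^^ n) (start prev x ?g, i)) v \<le> 5" for i
    using walk_range[of "start prev x ?g" n \<delta> i] by auto
  let ?r = "fst ((step \<delta> ^^ n) (start prev x ?g, card (guessed prev x) + card (reguessed prev x \<delta>)))"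
  have a: "attempt prev x \<delta> v = (if ?r v \<le> 1 then 4 else ?r v)" for v
    unfolding attempt_def by (simp add: Let_def)
  have "{v. attempt prev x \<delta> v \<le> 4} = {v. ?r v \<le> 4}" unfolding a by auto
  then show "{v. attempt prev x \<delta> v \<le> 4} = {..<Suc x}" using w(1) by simp
  show "attempt prev x \<delta> v \<in> {2, 3, 4, 5}" unfolding a using w(2)[rule_format, of "card (guessed prev x) + card (reguessed prev x \<delta>)" v] by (simp, linarith)
qed

text \<open>The string concatenates the roles of \<open>guessed\<close>, the roles of
  \<open>reguessed\<close> and the choices from \<open>walk_complete\<close>. The final roles 2 and
  3 lie inside the target sets, whose sizes never grew, so the price is the minimum.\<close>

lemma attempt_complete:
  assumes prev: "\<And>v. prev v \<in> {2, 3, 4, 5}" "{v. prev v \<le> 4} = {..<x}" and x: "x < n"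
    and minp: "minsol (Suc n) d {..<x} {v. prev v = 2} {v. prev v = 3}" and cp: "card {v. prev v = 2} \<le> k"
    and sol0: "sol d {..<Suc x} X0 F0" "card X0 \<le> k"
  shows "\<exists>c<3 ^ str_len. valid (attempt prev x (digit c)) \<and>
    (\<forall>X F. sol d {..<Suc x} X F \<longrightarrow> price (attempt prev x (digit c)) \<le> Suc n * card X + card F)"
proof -
  have fin: "finite {v. prev v \<le> 4}" using prev(2) by simp
  have "x \<notin> {v. prev v \<le> 4}" unfolding prev(2) by simp
  then have p5: "prev x = 5" using prev(1)[of x] by auto
  have V: "{..<Suc x} = insert x {v. prev v \<le> 4}" unfolding prev(2) by (rule lessThan_Suc)
  obtain \<chi> X F where \<chi>: "range \<chi> \<subseteq> {2, 3, 4}" and min: "minsol (Suc n) d {..<Suc x} X F" and cX: "card X \<le> k"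
    and inv: "inv (start prev x \<chi>)" and rV: "{v. start prev x \<chi> v \<le> 4} = {..<Suc x}"
    and com: "compat d (start prev x \<chi>) X F" and cY: "card {v. v = x \<or> prev v = 2} \<le> k + 1"
    and cM: "card {v. prev v = 3 \<and> v \<in> reached (prep prev x \<chi>)} \<le> (2 * k + 1) * d"
    and pot: "pot (start prev x \<chi>) X F \<le> 3 * bound k d + k + (2 * k + 1) * d"
  proof -
    have m: "minsol (Suc n) d {v. prev v \<le> 4} {v. prev v = 2} {v. prev v = 3}" unfolding prev(2) by (rule minp)
    have c: "card {..<Suc x} < Suc n" using x by simp
    from compression_start[of prev x, OF prev(1) fin p5 V m cp c sol0]
    show thesis by (elim exE conjE) (rule that)
  qed
  obtain ds where ds: "length ds \<le> pot (start prev x \<chi>) X F" "set ds \<subseteq> {..<3}"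
    "\<And>\<delta> i. (\<forall>j<length ds. \<delta> (i + j) = ds ! j) \<Longrightarrow>
      (\<exists>r' i' X' F'. (step \<delta> ^^ n) (start prev x \<chi>, i) = (r', i') \<and> inv r' \<and> compat d r' X' F' \<and>
        card X' \<le> card X \<and> card F' \<le> card F \<and> card {v. r' v = 0} \<le> card {v. start prev x \<chi> v = 0} - n)"
    using walk_complete[OF inv com, of n] rV x by auto
  define Y where "Y = guessed prev x"
  define M where "M = {v. prev v = 3 \<and> v \<in> reached (prep prev x \<chi>)}"
  have "finite {v. prev v = 2}" by (rule finite_subset[OF _ fin]) auto
  then have finY: "finite Y" unfolding Y_def guessed_def by (simp add: Collect_disj_eq)
  have finM: "finite M" unfolding M_def by (rule finite_subset[OF _ fin]) auto
  have MY: "M \<inter> Y = {}" unfolding M_def Y_def guessed_def using p5 by auto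
  \<comment> \<open>\<open>inv_into\<close> turns a position back into the vertex whose role is
    coded there; the third block holds the choices.\<close>
  define \<delta> where "\<delta> i = (if i < card Y then \<chi> (inv_into Y (idx Y) i) - 2
    else if i < card Y + card M then \<chi> (inv_into M (idx M) (i - card Y)) - 2
    else if i < card Y + card M + length ds then ds ! (i - (card Y + card M)) else 0)" for i
  have \<chi>3: "\<chi> v - 2 < 3" "\<chi> v - 2 + 2 = \<chi> v" for v using \<chi> by (auto dest!: subsetD[of _ _ "\<chi> v"])
  have "\<delta> i < 3" for i
  proof -
    have "ds ! (i - (card Y + card M)) < 3" if "\<not> i < card Y + card M" "i < card Y + card M + length ds"
    proof -
      have "i - (card Y + card M) < length ds" using that by linarith
      then have "ds ! (i - (card Y + card M)) \<in> set ds" by (rule nth_mem)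
      then show ?thesis using ds(2) by blast
    qed
    then show ?thesis unfolding \<delta>_def using \<chi>3 by simp
  qed
  then obtain c where c: "c < 3 ^ str_len" "\<forall>i<str_len. digit c i = \<delta> i"
    using digits_exist[of \<delta> str_len] by blast
  have len: "card Y + card M + length ds \<le> str_len"
  proof -
    have "card Y + card M + length ds \<le> (k + 1) + (2 * k + 1) * d + (3 * bound k d + k + (2 * k + 1) * d)"
      using cY cM pot ds(1) unfolding Y_def guessed_def M_def by linarith
    also have "\<dots> \<le> str_len" unfolding bound_def str_len_def by (simp add: algebra_simps)
    finally show ?thesis .
  qed
  let ?\<delta> = "digit c"
  have dY: "guess1 prev x ?\<delta> v = \<chi> v" if "v \<in> Y" for v
  proof -
    have "idx Y v < card Y" using idx_less finY that by blast
    moreover have "inv_into Y (idx Y) (idx Y v) = v" using idx_inj finY that by simp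
    ultimately have "?\<delta> (idx Y v) = \<chi> v - 2" using c(2) len unfolding \<delta>_def by simp
    then show ?thesis unfolding guess1_def Y_def[symmetric] using \<chi>3 by simp
  qed
  \<comment> \<open>The set \<open>reguessed\<close> depends on the first block of symbols, so it
    can be identified with \<open>M\<close> only after that block has been decoded.\<close>
  have pr: "prep prev x (guess1 prev x ?\<delta>) = prep prev x \<chi>" by (rule prep_cong) (simp add: dY Y_def[symmetric])
  have M: "reguessed prev x ?\<delta> = M" unfolding reguessed_def pr M_def ..
  have dM: "guess prev x ?\<delta> v = \<chi> v" if "v \<in> M" for v
  proof -
    have i: "idx M v < card M" using idx_less finM that by blast
    moreover have "inv_into M (idx M) (idx M v) = v" using idx_inj finM that by simp
    ultimately have "?\<delta> (card Y + idx M v) = \<chi> v - 2" using c(2) len unfolding \<delta>_def by simp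
    moreover have "v \<notin> Y" using that MY by blast
    ultimately show ?thesis unfolding guess_def M Y_def[symmetric] using \<chi>3 by simp
  qed
  have st: "start prev x (guess prev x ?\<delta>) = start prev x \<chi>"
  proof (rule start_cong[symmetric])
    show "\<chi> v = guess prev x ?\<delta> v" if "v \<in> guessed prev x" for v
      using that dY unfolding guess_def Y_def by simp
    show "\<chi> v = guess prev x ?\<delta> v" if "prev v = 3" "v \<in> reached (prep prev x \<chi>)" for v
      using that dM unfolding M_def by simp
  qed
  have "\<forall>j<length ds. ?\<delta> (card Y + card M + j) = ds ! j"
    using c(2) len unfolding \<delta>_def by simp
  from ds(3)[OF this] obtain r' i' X' F' where r': "(step ?\<delta> ^^ n) (start prev x \<chi>, card Y + card M) = (r', i')"
    "inv r'" "compat d r' X' F'" "card X' \<le> card X" "card F' \<le> card F"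
    "card {v. r' v = 0} \<le> card {v. start prev x \<chi> v = 0} - n" by blast
  have "{v. start prev x \<chi> v = 0} \<subseteq> {v. start prev x \<chi> v \<le> 4}" by auto
  then have "{v. start prev x \<chi> v = 0} \<subseteq> {..<n}" unfolding rV using x by auto
  then have "card {v. start prev x \<chi> v = 0} \<le> n"
    using card_mono[OF finite_lessThan, of "{v. start prev x \<chi> v = 0}" n] by simp
  then have "card {v. r' v = 0} = 0" using r'(6) by simp
  moreover have "finite {v. r' v = 0}" by (rule inv_finite[OF r'(2)]) auto
  ultimately have U: "r' v \<noteq> 0" for v by auto
  have s5: "start prev x \<chi> v \<le> 5" for v
  proof -
    have "\<chi> v \<in> {2, 3, 4}" using \<chi> by blast
    then show ?thesis using prev(1)[of v] unfolding start_def prep_def by auto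
  qed
  have rV': "{v. r' v \<le> 4} = {..<Suc x}"
    using walk_range[of "start prev x \<chi>" n ?\<delta> "card Y + card M", OF s5] r'(1) rV by auto
  have sol: "sol d {..<Suc x} {v. r' v = 2} {v. r' v = 3}" using sol_finish[OF r'(2,3) U] rV' by simp
  have a: "attempt prev x ?\<delta> v = (if r' v \<le> 1 then 4 else r' v)" for v
    unfolding attempt_def st M Y_def[symmetric] r'(1) by (simp add: Let_def)
  have a2: "{v. attempt prev x ?\<delta> v = 2} = {v. r' v = 2}" "{v. attempt prev x ?\<delta> v = 3} = {v. r' v = 3}"
    "{v. attempt prev x ?\<delta> v \<le> 4} = {v. r' v \<le> 4}"
    unfolding a by auto
  have sub: "{v. r' v = 2} \<subseteq> X'" "{v. r' v = 3} \<subseteq> F'" using r'(3) unfolding compat_def by blast+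
  have XV: "X' \<subseteq> {v. r' v \<le> 4}" "F' \<subseteq> {v. r' v \<le> 4}" using compat_V[OF r'(3)] by blast+
  have finXF: "finite X'" "finite F'" using XV unfolding rV' using finite_subset by blast+
  have c2: "card {v. r' v = 2} \<le> card X" using card_mono[OF finXF(1) sub(1)] r'(4) by linarith
  have c3: "card {v. r' v = 3} \<le> card F" using card_mono[OF finXF(2) sub(2)] r'(5) by linarith
  have "valid (attempt prev x ?\<delta>)" unfolding valid_def a2 rV' using sol c2 cX by simp
  moreover have "price (attempt prev x ?\<delta>) \<le> Suc n * card X1 + card F1" if "sol d {..<Suc x} X1 F1" for X1 F1
  proof -
    have "price (attempt prev x ?\<delta>) \<le> Suc n * card X + card F"
      unfolding price_def a2 using c2 c3 by (intro add_mono mult_le_mono2)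
    also have "\<dots> \<le> Suc n * card X1 + card F1" using min that unfolding minsol_def by blast
    finally show ?thesis .
  qed
  ultimately show ?thesis using c(1) by blast
qed

end

section \<open>Bounded loops\<close>

text \<open>Every loop has a counter memory and a bound read before it starts. So execution is a
  total function, and running times can be bounded from the syntax.\<close>

datatype cmd =
    Skip
  | Write nat expr expr
  | Seq cmd cmd
  | If expr cmd cmd
  | For nat nat cmd

definition wr :: "nat \<Rightarrow> nat \<Rightarrow> nat \<Rightarrow> state \<Rightarrow> state" where
  "wr a i v s = s(a := (s a)(i := v))"

lemma wr_same [simp]: "wr a i v s a = (s a)(i := v)"
  by (simp add: wr_def)

lemma wr_other [simp]: "b \<noteq> a \<Longrightarrow> wr a i v s b = s b"
  by (simp add: wr_def)

definition bump :: "nat \<Rightarrow> state \<Rightarrow> state" where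
  "bump x s = wr x 0 (Suc (s x 0)) s"

lemma bump_same [simp]: "bump x s x 0 = Suc (s x 0)"
  by (simp add: bump_def)

lemma bump_other [simp]: "b \<noteq> x \<Longrightarrow> bump x s b = s b"
  by (simp add: bump_def)

primrec run :: "cmd \<Rightarrow> state \<Rightarrow> state" where
  "run Skip s = s"
| "run (Write a e f) s = wr a (eval_expr e s) (eval_expr f s) s"
| "run (Seq c c') s = run c' (run c s)"
| "run (If e c c') s = (if eval_expr e s \<noteq> 0 then run c s else run c' s)"
| "run (For x b c) s = ((\<lambda>s. bump x (run c s)) ^^ s b 0) (wr x 0 0 s)"

abbreviation var :: "nat \<Rightarrow> expr" where
  "var x \<equiv> Read x (Const 0)"

text \<open>The compiled loop re-reads its bound and its counter in every test. This agrees with the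
  fixed number of rounds in \<open>run\<close> when the body writes neither, which
  \<open>fresh\<close> and the disjointness of \<open>bounds\<close> and \<open>writes\<close>
  ensure.\<close>

primrec compile :: "cmd \<Rightarrow> program" where
  "compile Skip = SKIP"
| "compile (Write a e f) = WRITE a e f"
| "compile (Seq c c') = SEQ (compile c) (compile c')"
| "compile (If e c c') = IF e (compile c) (compile c')"
| "compile (For x b c) = SEQ (WRITE x (Const 0) (Const 0))
     (WHILE (Sub (var b) (var x)) (SEQ (compile c) (WRITE x (Const 0) (Add (var x) (Const 1)))))"

primrec writes :: "cmd \<Rightarrow> nat set" where
  "writes Skip = {}"
| "writes (Write a e f) = {a}"
| "writes (Seq c c') = writes c \<union> writes c'"
| "writes (If e c c') = writes c \<union> writes c'"
| "writes (For x b c) = insert x (writes c)"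

primrec bounds :: "cmd \<Rightarrow> nat set" where
  "bounds Skip = {}"
| "bounds (Write a e f) = {}"
| "bounds (Seq c c') = bounds c \<union> bounds c'"
| "bounds (If e c c') = bounds c \<union> bounds c'"
| "bounds (For x b c) = insert b (bounds c)"

primrec fresh :: "cmd \<Rightarrow> bool" where
  "fresh Skip = True"
| "fresh (Write a e f) = True"
| "fresh (Seq c c') = (fresh c \<and> fresh c')"
| "fresh (If e c c') = (fresh c \<and> fresh c')"
| "fresh (For x b c) = (x \<notin> writes c \<and> fresh c)"

text \<open>\<open>B b\<close> bounds the content of the bound variable \<open>b\<close>. In the
  loop clause 3 steps reset the counter and 6 pay for the failing test; each round costs 6 for the
  test and 6 for the increment besides the body.\<close>

primrec time :: "(nat \<Rightarrow> nat) \<Rightarrow> cmd \<Rightarrow> nat" where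
  "time B Skip = 1"
| "time B (Write a e f) = 1 + cost e + cost f"
| "time B (Seq c c') = time B c + time B c'"
| "time B (If e c c') = 1 + cost e + time B c + time B c'"
| "time B (For x b c) = 9 + B b * (time B c + 12)"

lemma run_frame: "a \<notin> writes c \<Longrightarrow> run c s a = s a"
proof (induction c arbitrary: s)
  case (For x b c)
  have "((\<lambda>s. bump x (run c s)) ^^ m) s' a = s' a" for m s'
    using For by (induction m) auto
  then show ?case using For by simp
qed auto

lemma for_invariant:
  assumes "x \<notin> writes c" "I 0 (wr x 0 0 s)"
    and "\<And>j s'. j < s b 0 \<Longrightarrow> I j s' \<Longrightarrow> s' x 0 = j \<Longrightarrow> I (Suc j) (bump x (run c s'))"
  shows "I (s b 0) (run (For x b c) s)"
proof -
  have "I m (((\<lambda>s. bump x (run c s)) ^^ m) (wr x 0 0 s)) \<and>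
      ((\<lambda>s. bump x (run c s)) ^^ m) (wr x 0 0 s) x 0 = m" if "m \<le> s b 0" for m
    using that
  proof (induction m)
    case 0
    then show ?case using assms(2) by simp
  next
    case (Suc m)
    then show ?case using assms(3)[of m] run_frame[OF assms(1)] by simp
  qed
  then show ?thesis by simp
qed

lemma exec_compile:
  assumes "fresh c" "bounds c \<inter> writes c = {}" "\<And>b. b \<in> bounds c \<Longrightarrow> s b 0 \<le> B b"
  shows "\<exists>t\<le>time B c. exec (compile c) s t (run c s)"
  using assms
proof (induction c arbitrary: s)
  case Skip
  show ?case using exec_SKIP[of s] by (intro exI[of _ 1]) simp
next
  case (Write a e f)
  have "exec (WRITE a e f) s (1 + cost e + cost f) (run (Write a e f) s)"
    using exec_WRITE[of a e f s] by (simp only: run.simps wr_def)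
  then show ?case by (intro exI[of _ "1 + cost e + cost f"]) simp
next
  case (Seq c c')
  have h: "fresh c" "fresh c'" "bounds c \<inter> writes c = {}" "bounds c' \<inter> writes c' = {}"
    "\<And>b. b \<in> bounds c \<Longrightarrow> s b 0 \<le> B b" "\<And>b. b \<in> bounds c' \<Longrightarrow> s b 0 \<le> B b"
    using Seq.prems by auto
  obtain t where t: "t \<le> time B c" "exec (compile c) s t (run c s)" using Seq.IH(1)[of s, OF h(1,3,5)] by blast
  have "run c s b 0 \<le> B b" if "b \<in> bounds c'" for b
  proof -
    have "run c s b = s b" using Seq.prems(2) that by (intro run_frame) auto
    then show ?thesis using h(6)[OF that] by simp
  qed
  from Seq.IH(2)[of "run c s", OF h(2,4) this]
  obtain u where u: "u \<le> time B c'" "exec (compile c') (run c s) u (run c' (run c s))" by blast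
  show ?case using exec_SEQ[OF t(2) u(2)] t(1) u(1) by (intro exI[of _ "t + u"]) simp
next
  case (If e c c')
  have h: "fresh c" "fresh c'" "bounds c \<inter> writes c = {}" "bounds c' \<inter> writes c' = {}"
    "\<And>b. b \<in> bounds c \<Longrightarrow> s b 0 \<le> B b" "\<And>b. b \<in> bounds c' \<Longrightarrow> s b 0 \<le> B b"
    using If.prems by auto
  show ?case
  proof (cases "eval_expr e s = 0")
    case True
    obtain t where t: "t \<le> time B c'" "exec (compile c') s t (run c' s)" using If.IH(2)[of s, OF h(2,4,6)] by blast
    then show ?thesis using True t(1) exec_IF_False[OF True t(2)] by (intro exI[of _ "1 + cost e + t"]) simp
  next
    case False
    obtain t where t: "t \<le> time B c" "exec (compile c) s t (run c s)" using If.IH(1)[of s, OF h(1,3,5)] by blast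
    then show ?thesis using False t(1) exec_IF_True[OF False t(2)] by (intro exI[of _ "1 + cost e + t"]) simp
  qed
next
  case (For x b c)
  let ?g = "\<lambda>s. bump x (run c s)"
  let ?W = "WHILE (Sub (var b) (var x)) (SEQ (compile c) (WRITE x (Const 0) (Add (var x) (Const 1))))"
  have xc: "x \<notin> writes c" "fresh c" "bounds c \<inter> writes c = {}" and bx: "b \<noteq> x" "b \<notin> writes c" "x \<notin> bounds c"
    using For.prems by auto
  have loop: "\<exists>t\<le>6 + m * (time B c + 12). exec ?W s' t ((?g ^^ m) s')"
    if "s' b 0 - s' x 0 = m" "\<And>b. b \<in> bounds c \<Longrightarrow> s' b 0 \<le> B b" for m s'
    using that
  proof (induction m arbitrary: s')
    case 0
    have "exec ?W s' (1 + cost (Sub (var b) (var x))) s'"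
      by (rule exec_WHILE_False) (use 0 in simp)
    then show ?case by (intro exI[of _ "1 + cost (Sub (var b) (var x))"] conjI) simp_all
  next
    case (Suc m)
    obtain t where t: "t \<le> time B c" "exec (compile c) s' t (run c s')"
      using For.IH[of s', OF xc(2,3) Suc.prems(2)] by blast
    have fr: "run c s' x = s' x" "run c s' b = s' b" using xc bx by (auto intro: run_frame)
    have w: "exec (WRITE x (Const 0) (Add (var x) (Const 1))) (run c s') 6 (?g s')"
      using exec_WRITE[of x "Const 0" "Add (var x) (Const 1)" "run c s'"]
      unfolding bump_def wr_def by (simp add: eval_nat_numeral del: fun_upd_apply)
    have m: "?g s' b 0 - ?g s' x 0 = m" using Suc.prems(1) fr bx by simp
    have "?g s' b' 0 \<le> B b'" if "b' \<in> bounds c" for b'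
    proof -
      have "b' \<noteq> x" "b' \<notin> writes c" using that bx xc by auto
      then have "?g s' b' = s' b'" using run_frame by simp
      then show ?thesis using Suc.prems(2) that by simp
    qed
    from Suc.IH[of "?g s'", OF m this] obtain u where u: "u \<le> 6 + m * (time B c + 12)" "exec ?W (?g s') u ((?g ^^ m) (?g s'))"
      by blast
    have "exec ?W s' (1 + cost (Sub (var b) (var x)) + (t + 6) + u) ((?g ^^ m) (?g s'))"
      by (rule exec_WHILE_True[OF _ exec_SEQ[OF t(2) w] u(2)]) (use Suc.prems(1) in simp)
    moreover have "(?g ^^ m) (?g s') = (?g ^^ Suc m) s'" by (simp add: funpow_Suc_right del: funpow.simps)
    ultimately show ?case using t(1) u(1) by (intro exI[of _ "1 + cost (Sub (var b) (var x)) + (t + 6) + u"] conjI) simp_all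
  qed
  let ?s = "wr x 0 0 s"
  have "?s b 0 - ?s x 0 = s b 0" using bx by simp
  moreover have "?s b' 0 \<le> B b'" if "b' \<in> bounds c" for b'
  proof -
    have "b' \<noteq> x" using that bx by blast
    then show ?thesis using For.prems(3)[of b'] that by simp
  qed
  ultimately obtain t where t: "t \<le> 6 + s b 0 * (time B c + 12)" "exec ?W ?s t ((?g ^^ s b 0) ?s)"
    using loop[of ?s "s b 0"] by blast
  have "exec (WRITE x (Const 0) (Const 0)) s 3 ?s"
    using exec_WRITE[of x "Const 0" "Const 0" s] unfolding wr_def by (simp add: eval_nat_numeral del: fun_upd_apply)
  from exec_SEQ[OF this t(2)] have "exec (compile (For x b c)) s (3 + t) (run (For x b c) s)" by simp
  moreover have "s b 0 * (time B c + 12) \<le> B b * (time B c + 12)" using For.prems(3) by (intro mult_le_mono1) simp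
  then have "3 + t \<le> time B (For x b c)" using t(1) unfolding time.simps by linarith
  ultimately show ?case by blast
qed

section \<open>A polynomial bound on the running time of nested loops\<close>

primrec weight :: "cmd \<Rightarrow> nat" where
  "weight Skip = 1"
| "weight (Write a e f) = 1 + cost e + cost f"
| "weight (Seq c c') = weight c + weight c'"
| "weight (If e c c') = 1 + cost e + weight c + weight c'"
| "weight (For x b c) = 21 + weight c"

text \<open>Depths add in sequences instead of taking a maximum: only a constant exponent matters,
  and sums keep the induction in \<open>time_le\<close> simple.\<close>

primrec depth :: "cmd \<Rightarrow> nat" where
  "depth Skip = 0"
| "depth (Write a e f) = 0"
| "depth (Seq c c') = depth c + depth c'"
| "depth (If e c c') = depth c + depth c'"
| "depth (For x b c) = Suc (depth c)"

lemma time_le: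
  assumes "\<And>b. b \<in> bounds c \<Longrightarrow> B b \<le> m" "1 \<le> m"
  shows "time B c \<le> weight c * m ^ depth c"
  using assms
proof (induction c)
  case (Seq c c')
  have "weight c * m ^ depth c \<le> weight c * m ^ (depth c + depth c')"
    "weight c' * m ^ depth c' \<le> weight c' * m ^ (depth c + depth c')"
    using Seq.prems(2) by (intro mult_le_mono2 power_increasing; simp)+
  moreover have "time B c \<le> weight c * m ^ depth c" "time B c' \<le> weight c' * m ^ depth c'"
    using Seq by simp_all
  ultimately show ?case unfolding time.simps weight.simps depth.simps distrib_right by linarith
next
  case (If e c c')
  have "weight c * m ^ depth c \<le> weight c * m ^ (depth c + depth c')"
    "weight c' * m ^ depth c' \<le> weight c' * m ^ (depth c + depth c')"
    "(1 + cost e) * 1 \<le> (1 + cost e) * m ^ (depth c + depth c')"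
    using If.prems(2) by (intro mult_le_mono2 power_increasing one_le_power; simp)+
  moreover have "time B c \<le> weight c * m ^ depth c" "time B c' \<le> weight c' * m ^ depth c'"
    using If by simp_all
  ultimately show ?case unfolding time.simps weight.simps depth.simps distrib_right by linarith
next
  case (For x b c)
  have "1 \<le> m ^ depth c" "1 \<le> m * m ^ depth c" using For.prems(2) by (simp_all add: Suc_le_eq)
  have "time B c \<le> weight c * m ^ depth c" using For by simp
  then have "time B c + 12 \<le> weight c * m ^ depth c + 12 * m ^ depth c" using \<open>1 \<le> m ^ depth c\<close> by linarith
  also have "\<dots> = (weight c + 12) * m ^ depth c" by (simp add: distrib_right)
  finally have "B b * (time B c + 12) \<le> m * ((weight c + 12) * m ^ depth c)"
    using For.prems(1) by (intro mult_le_mono) simp_all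
  also have "\<dots> = (weight c + 12) * (m * m ^ depth c)" by simp
  finally have "9 + B b * (time B c + 12) \<le> 9 * (m * m ^ depth c) + (weight c + 12) * (m * m ^ depth c)"
    using \<open>1 \<le> m * m ^ depth c\<close> by linarith
  also have "\<dots> = weight (For x b c) * m ^ depth (For x b c)" by (simp add: algebra_simps)
  finally show ?case by simp
qed simp_all

text \<open>Loops are not to be unfolded; they are treated through \<open>for_invariant\<close> and
  \<open>run_frame\<close>.\<close>

declare run.simps(5) [simp del]

text \<open>A test succeeds when its value is nonzero. Truncated subtraction from 1 negates, and two
  numbers are equal when both truncated differences vanish.\<close>

definition Not :: "expr \<Rightarrow> expr" where "Not e = Sub (Const 1) e"
definition And :: "expr \<Rightarrow> expr \<Rightarrow> expr" where "And e f = Not (Add (Not e) (Not f))"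
definition Eq :: "expr \<Rightarrow> expr \<Rightarrow> expr" where "Eq e f = Not (Add (Sub e f) (Sub f e))"

lemma eval_Not [simp]: "eval_expr (Not e) s = of_bool (eval_expr e s = 0)"
  by (simp add: Not_def)

lemma eval_And [simp]: "eval_expr (And e f) s = of_bool (eval_expr e s \<noteq> 0 \<and> eval_expr f s \<noteq> 0)"
  by (simp add: And_def)

lemma eval_Eq [simp]: "eval_expr (Eq e f) s = of_bool (eval_expr e s = eval_expr f s)"
  by (auto simp: Eq_def)

text \<open>Test and value may read the cell about to be overwritten: at index \<open>v\<close> that
  cell of the target memory still has its original content.\<close>

lemma run_fill:
  assumes "x \<noteq> a" "b \<noteq> a" "b \<noteq> x"
    and "\<And>s' v. v < s b 0 \<Longrightarrow> (\<And>m. m \<noteq> a \<Longrightarrow> m \<noteq> x \<Longrightarrow> s' m = s m) \<Longrightarrow> s' x 0 = v \<Longrightarrow> s' a v = s a v \<Longrightarrow>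
      (eval_expr g s' \<noteq> 0 \<longleftrightarrow> P v) \<and> (P v \<longrightarrow> eval_expr e s' = f v)"
  shows "run (For x b (If g (Write a (var x) e) Skip)) s a = (\<lambda>v. if v < s b 0 \<and> P v then f v else s a v)"
proof -
  define I where "I j s' \<longleftrightarrow> (\<forall>m. m \<noteq> a \<longrightarrow> m \<noteq> x \<longrightarrow> s' m = s m) \<and>
    s' a = (\<lambda>v. if v < j \<and> P v then f v else s a v)" for j s'
  have "I (s b 0) (run (For x b (If g (Write a (var x) e) Skip)) s)"
  proof (rule for_invariant)
    show "x \<notin> writes (If g (Write a (var x) e) Skip)" using assms by simp
    show "I 0 (wr x 0 0 s)" using assms(1) unfolding I_def by simp
    fix j s'
    assume j: "j < s b 0" "I j s'" "s' x 0 = j"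
    then have h: "(eval_expr g s' \<noteq> 0 \<longleftrightarrow> P j) \<and> (P j \<longrightarrow> eval_expr e s' = f j)"
      by (intro assms(4)) (simp_all add: I_def)
    show "I (Suc j) (bump x (run (If g (Write a (var x) e) Skip) s'))"
      using j h assms(1) unfolding I_def by (cases "P j") (auto simp: fun_eq_iff less_Suc_eq)
  qed
  then show ?thesis unfolding I_def by blast
qed

lemma run_sum:
  assumes "x \<noteq> a" "b \<noteq> a" "b \<noteq> x"
    and "\<And>s' v. v < s b 0 \<Longrightarrow> (\<And>m. m \<noteq> a \<Longrightarrow> m \<noteq> x \<Longrightarrow> s' m = s m) \<Longrightarrow> s' x 0 = v \<Longrightarrow>
      (eval_expr g s' \<noteq> 0 \<longleftrightarrow> P v) \<and> eval_expr e s' = f v"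
  shows "run (For x b (If g (Write a (Const 0) (Add (var a) e)) Skip)) s a 0 = s a 0 + (\<Sum>v<s b 0. if P v then f v else 0)"
proof -
  define I where "I j s' \<longleftrightarrow> (\<forall>m. m \<noteq> a \<longrightarrow> m \<noteq> x \<longrightarrow> s' m = s m) \<and>
    s' a 0 = s a 0 + (\<Sum>v<j. if P v then f v else 0)" for j s'
  have "I (s b 0) (run (For x b (If g (Write a (Const 0) (Add (var a) e)) Skip)) s)"
  proof (rule for_invariant)
    show "x \<notin> writes (If g (Write a (Const 0) (Add (var a) e)) Skip)" using assms by simp
    show "I 0 (wr x 0 0 s)" using assms(1) unfolding I_def by simp
    fix j s'
    assume j: "j < s b 0" "I j s'" "s' x 0 = j"
    then have h: "(eval_expr g s' \<noteq> 0 \<longleftrightarrow> P j) \<and> eval_expr e s' = f j"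
      by (intro assms(4)) (simp_all add: I_def)
    show "I (Suc j) (bump x (run (If g (Write a (Const 0) (Add (var a) e)) Skip) s'))"
      using j h assms(1) unfolding I_def by (cases "P j") auto
  qed
  then show ?thesis unfolding I_def by blast
qed

lemma run_last:
  assumes "x \<noteq> a" "b \<noteq> a" "b \<noteq> x" "s a 0 = 0"
    and "\<And>s' v. v < s b 0 \<Longrightarrow> (\<And>m. m \<noteq> a \<Longrightarrow> m \<noteq> x \<Longrightarrow> s' m = s m) \<Longrightarrow> s' x 0 = v \<Longrightarrow>
      (eval_expr g s' \<noteq> 0 \<longleftrightarrow> P v)"
  shows "run (For x b (If g (Write a (Const 0) (Add (var x) (Const 1))) Skip)) s a 0 = last_sat P (s b 0)"
proof -
  define I where "I j s' \<longleftrightarrow> (\<forall>m. m \<noteq> a \<longrightarrow> m \<noteq> x \<longrightarrow> s' m = s m) \<and> s' a 0 = last_sat P j" for j s'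
  have "I (s b 0) (run (For x b (If g (Write a (Const 0) (Add (var x) (Const 1))) Skip)) s)"
  proof (rule for_invariant)
    show "x \<notin> writes (If g (Write a (Const 0) (Add (var x) (Const 1))) Skip)" using assms by simp
    show "I 0 (wr x 0 0 s)" using assms unfolding I_def by simp
    fix j s'
    assume j: "j < s b 0" "I j s'" "s' x 0 = j"
    then have h: "eval_expr g s' \<noteq> 0 \<longleftrightarrow> P j"
      by (intro assms(5)) (simp_all add: I_def)
    show "I (Suc j) (bump x (run (If g (Write a (Const 0) (Add (var x) (Const 1))) Skip) s'))"
      using j h assms(1) unfolding I_def by (cases "P j") auto
  qed
  then show ?thesis unfolding I_def by blast
qed

section \<open>Programs for the branching step\<close>

text \<open>A memory serves as a variable through its cell 0 or as an array over the vertices. There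
  are several loop counters because a body must not write the counter of a loop around it.\<close>

abbreviation (input) "mN \<equiv> 2 :: nat"
abbreviation (input) "mK \<equiv> 3 :: nat"
abbreviation (input) "mD \<equiv> 4 :: nat"
abbreviation (input) "mL \<equiv> 5 :: nat"
abbreviation (input) "mC \<equiv> 6 :: nat"
abbreviation (input) "mRow \<equiv> 7 :: nat"
abbreviation (input) "mI \<equiv> 8 :: nat"
abbreviation (input) "mJ \<equiv> 9 :: nat"
abbreviation (input) "mPrev \<equiv> 10 :: nat"
abbreviation (input) "mBest \<equiv> 11 :: nat"
abbreviation (input) "mRole \<equiv> 12 :: nat"
abbreviation (input) "mDig \<equiv> 13 :: nat"
abbreviation (input) "mFound \<equiv> 14 :: nat"
abbreviation (input) "mHit \<equiv> 15 :: nat"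
abbreviation (input) "mCost \<equiv> 16 :: nat"
abbreviation (input) "mPtr \<equiv> 17 :: nat"
abbreviation (input) "mPrice \<equiv> 18 :: nat"
abbreviation (input) "mBad \<equiv> 19 :: nat"
abbreviation (input) "mX \<equiv> 20 :: nat"
abbreviation (input) "mY \<equiv> 21 :: nat"
abbreviation (input) "mZ \<equiv> 22 :: nat"
abbreviation (input) "mW \<equiv> 23 :: nat"
abbreviation (input) "mMark \<equiv> 30 :: nat"
abbreviation (input) "mSet \<equiv> 31 :: nat"
abbreviation (input) "mTree \<equiv> 32 :: nat"
abbreviation (input) "mDeg \<equiv> 33 :: nat"
abbreviation (input) "mCand \<equiv> 34 :: nat"
abbreviation (input) "mV \<equiv> 35 :: nat"
abbreviation (input) "mNbr \<equiv> 36 :: nat"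
abbreviation (input) "mCnt \<equiv> 37 :: nat"
abbreviation (input) "mCarry \<equiv> 38 :: nat"

abbreviation (input) cell :: "nat \<Rightarrow> nat \<Rightarrow> expr" where
  "cell a x \<equiv> Read a (var x)"

abbreviation (input) assign :: "nat \<Rightarrow> expr \<Rightarrow> cmd" where
  "assign x e \<equiv> Write x (Const 0) e"

abbreviation (input) fill :: "nat \<Rightarrow> expr \<Rightarrow> expr \<Rightarrow> cmd" where
  "fill a g e \<equiv> For mX mN (If g (Write a (var mX) e) Skip)"

abbreviation (input) add_all :: "nat \<Rightarrow> expr \<Rightarrow> expr \<Rightarrow> cmd" where
  "add_all a g e \<equiv> For mX mN (If g (assign a (Add (var a) e)) Skip)"

text \<open>Without multiplication the row offset is looked up in the table \<open>mRow\<close>,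
  which \<open>TABLES\<close> prepares.\<close>

abbreviation (input) adj :: "nat \<Rightarrow> nat \<Rightarrow> expr" where
  "adj x y \<equiv> Read 1 (Add (cell mRow x) (var y))"

definition Kept :: "expr \<Rightarrow> expr" where
  "Kept e = And (Sub e (Const 2)) (Sub (Const 5) e)"

lemma eval_Kept [simp]: "eval_expr (Kept e) s = of_bool (eval_expr e s = 3 \<or> eval_expr e s = 4)"
  by (auto simp: Kept_def)

text \<open>Each round relaxes all edges and adds a mark unless the marks are already closed, so
  \<open>n\<close> rounds are enough.\<close>

definition REACH :: cmd where
  "REACH = For mZ mN (For mX mN (For mY mN
     (If (And (cell mMark mX) (And (adj mX mY) (cell mSet mY))) (Write mMark (var mY) (Const 1)) Skip)))"

definition DEGREES :: cmd where
  "DEGREES = For mX mN (Seq (assign mCnt (Const 0))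
     (Seq (For mY mN (If (And (cell mSet mY) (adj mX mY)) (assign mCnt (Add (var mCnt) (Const 1))) Skip))
     (Write mDeg (var mX) (var mCnt))))"

context deletion_instance
begin

definition graph_in :: "state \<Rightarrow> bool" where
  "graph_in s \<longleftrightarrow> s mN 0 = n \<and> (\<forall>u<n. s mRow u = u * n) \<and> (\<forall>u<n. \<forall>v<n. s 1 (u * n + v) = of_bool (E u v))"

lemma graph_in_frame:
  assumes "graph_in s" "s' 1 = s 1" "s' mN = s mN" "s' mRow = s mRow"
  shows "graph_in s'"
  using assms unfolding graph_in_def by simp

lemma eval_adj:
  assumes "graph_in s" "s x 0 < n" "s y 0 < n"
  shows "eval_expr (adj x y) s = of_bool (E (s x 0) (s y 0))"
  using assms unfolding graph_in_def by simp

definition msel :: "state \<Rightarrow> nat \<Rightarrow> nat set" where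
  "msel s a = {v. v < n \<and> s a v \<noteq> 0}"

text \<open>\<open>C\<close> is any closed superset of the marks. With the true answer it gives
  soundness; with the current marks it shows that a round changes nothing once these are
  closed.\<close>

lemma reach_round:
  assumes g: "graph_in s" and MS: "msel s mMark \<subseteq> C"
    and cl: "\<And>u w. u \<in> C \<Longrightarrow> w \<in> msel s mSet \<Longrightarrow> E u w \<Longrightarrow> w \<in> C"
    and s': "s' = run (For mX mN (For mY mN
       (If (And (cell mMark mX) (And (adj mX mY) (cell mSet mY))) (Write mMark (var mY) (Const 1)) Skip))) s"
  shows "msel s mMark \<subseteq> msel s' mMark" "msel s' mMark \<subseteq> C"
    "\<And>u w. u \<in> msel s mMark \<Longrightarrow> w \<in> msel s mSet \<Longrightarrow> E u w \<Longrightarrow> w \<in> msel s' mMark"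
proof -
  let ?b = "If (And (cell mMark mX) (And (adj mX mY) (cell mSet mY))) (Write mMark (var mY) (Const 1)) Skip"
  define I where "I i t \<longleftrightarrow> (\<forall>m. m \<noteq> mMark \<longrightarrow> m \<noteq> mX \<longrightarrow> m \<noteq> mY \<longrightarrow> t m = s m) \<and>
    msel s mMark \<subseteq> msel t mMark \<and> msel t mMark \<subseteq> C \<and>
    (\<forall>u<i. u \<in> msel s mMark \<longrightarrow> (\<forall>w\<in>msel s mSet. E u w \<longrightarrow> w \<in> msel t mMark))" for i t
  have N: "s mN 0 = n" using g unfolding graph_in_def by blast
  have "I (s mN 0) s'" unfolding s'
  proof (rule for_invariant)
    have "msel (wr mX 0 0 s) mMark = msel s mMark" unfolding msel_def by simp
    then show "I 0 (wr mX 0 0 s)" unfolding I_def using MS by simp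
    fix i t
    assume i: "i < s mN 0" "I i t" "t mX 0 = i"
    define J where "J j t' \<longleftrightarrow> (\<forall>m. m \<noteq> mMark \<longrightarrow> m \<noteq> mY \<longrightarrow> t' m = t m) \<and>
      msel t mMark \<subseteq> msel t' mMark \<and> msel t' mMark \<subseteq> C \<and>
      (i \<in> msel t mMark \<longrightarrow> (\<forall>w<j. w \<in> msel s mSet \<longrightarrow> E i w \<longrightarrow> w \<in> msel t' mMark))" for j t'
    have tm: "t m = s m" if "m \<noteq> mMark" "m \<noteq> mX" "m \<noteq> mY" for m using i(2) that unfolding I_def by blast
    have "J (t mN 0) (run (For mY mN ?b) t)"
    proof (rule for_invariant)
      have "msel (wr mY 0 0 t) mMark = msel t mMark" unfolding msel_def by simp
      then show "J 0 (wr mY 0 0 t)" using i(2) unfolding J_def I_def by simp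
      fix j t'
      assume j: "j < t mN 0" "J j t'" "t' mY 0 = j"
      have jn: "j < n" "i < n" using j(1) i(1) tm N by auto
      have t'm: "t' m = s m" if "m \<noteq> mMark" "m \<noteq> mX" "m \<noteq> mY" for m
        using j(2) tm that unfolding J_def by simp
      have t'X: "t' mX 0 = i" using j(2) i(3) unfolding J_def by simp
      have gt: "graph_in t'" by (rule graph_in_frame[OF g]) (simp_all add: t'm)
      have e: "eval_expr (And (cell mMark mX) (And (adj mX mY) (cell mSet mY))) t' \<noteq> 0 \<longleftrightarrow>
          i \<in> msel t' mMark \<and> E i j \<and> j \<in> msel s mSet"
        using eval_adj[OF gt, of mX mY] t'X j(3) jn t'm[of mSet] by (auto simp: msel_def)
      define t'' where "t'' = bump mY (run ?b t')"
      have fr: "t'' m = t' m" if "m \<noteq> mMark" "m \<noteq> mY" for m using that unfolding t''_def by simp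
      have rb: "run ?b t' = (if i \<in> msel t' mMark \<and> E i j \<and> j \<in> msel s mSet then wr mMark j 1 t' else t')"
        unfolding run.simps e by (simp add: j(3))
      have mk: "msel t'' mMark = (if i \<in> msel t' mMark \<and> E i j \<and> j \<in> msel s mSet then insert j (msel t' mMark) else msel t' mMark)"
        using jn unfolding t''_def rb by (auto simp: msel_def)
      have "J (Suc j) t''"
        using j(2) cl[of i j] fr mk unfolding J_def by (auto simp: less_Suc_eq)
      then show "J (Suc j) (bump mY (run ?b t'))" unfolding t''_def .
    qed simp
    then have r: "J n (run (For mY mN ?b) t)" using tm N by simp
    define t1 where "t1 = bump mX (run (For mY mN ?b) t)"
    have mk: "msel t1 mMark = msel (run (For mY mN ?b) t) mMark" unfolding t1_def msel_def by simp
    have fr: "t1 m = t m" if "m \<noteq> mMark" "m \<noteq> mX" "m \<noteq> mY" for m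
      using r that unfolding J_def t1_def by simp
    have sub: "msel t mMark \<subseteq> msel t1 mMark" "msel t1 mMark \<subseteq> C" using r unfolding J_def mk by blast+
    have sub0: "msel s mMark \<subseteq> msel t mMark" using i(2) unfolding I_def by blast
    have "I (Suc i) t1" unfolding I_def
    proof (intro conjI allI impI ballI)
      show "t1 m = s m" if "m \<noteq> mMark" "m \<noteq> mX" "m \<noteq> mY" for m using fr tm that by simp
      show "msel s mMark \<subseteq> msel t1 mMark" "msel t1 mMark \<subseteq> C" using sub sub0 by blast+
      fix u w
      assume u: "u < Suc i" "u \<in> msel s mMark" "w \<in> msel s mSet" "E u w"
      show "w \<in> msel t1 mMark"
      proof (cases "u = i")
        case True
        then have "i \<in> msel t mMark" using u sub0 by blast
        moreover have "w < n" using u(4) E_less by blast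
        ultimately show ?thesis using r u True unfolding J_def mk by blast
      next
        case False
        then have "u < i" using u by simp
        then have "w \<in> msel t mMark" using i(2) u unfolding I_def by blast
        then show ?thesis using sub by blast
      qed
    qed
    then show "I (Suc i) (bump mX (run (For mY mN ?b) t))" unfolding t1_def .
  qed simp
  then have r: "I n s'" unfolding N .
  then show "msel s mMark \<subseteq> msel s' mMark" "msel s' mMark \<subseteq> C" unfolding I_def by blast+
  fix u w assume "u \<in> msel s mMark" "w \<in> msel s mSet" "E u w"
  then show "w \<in> msel s' mMark" using r unfolding I_def by (auto simp: msel_def)
qed

lemma run_REACH:
  assumes g: "graph_in s" and MS: "msel s mMark \<subseteq> msel s mSet"
  shows "msel (run REACH s) mMark = {v. \<exists>u\<in>msel s mMark. conn (msel s mSet) u v}"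
proof -
  let ?S = "msel s mSet" and ?M = "msel s mMark"
  let ?r = "For mX mN (For mY mN
     (If (And (cell mMark mX) (And (adj mX mY) (cell mSet mY))) (Write mMark (var mY) (Const 1)) Skip))"
  define C where "C = {v. \<exists>u\<in>?M. conn ?S u v}"
  have MC: "?M \<subseteq> C" unfolding C_def using MS conn_refl by blast
  have cl: "w \<in> C" if "u \<in> C" "w \<in> ?S" "E u w" for u w
    using that conn_step unfolding C_def by blast
  have N: "s mN 0 = n" using g unfolding graph_in_def by blast
  define I where "I j t \<longleftrightarrow> (\<forall>m. m \<notin> {mMark, mX, mY, mZ} \<longrightarrow> t m = s m) \<and>
    ?M \<subseteq> msel t mMark \<and> msel t mMark \<subseteq> C \<and>
    ((\<forall>u\<in>msel t mMark. \<forall>w\<in>?S. E u w \<longrightarrow> w \<in> msel t mMark) \<or> j \<le> card (msel t mMark))" for j t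
  have "I (s mN 0) (run REACH s)" unfolding REACH_def
  proof (rule for_invariant)
    have "msel (wr mZ 0 0 s) mMark = ?M" unfolding msel_def by simp
    then show "I 0 (wr mZ 0 0 s)" unfolding I_def using MC by simp
    fix j t
    assume j: "j < s mN 0" "I j t" "t mZ 0 = j"
    define t1 where "t1 = run ?r t"
    have tm: "t m = s m" if "m \<notin> {mMark, mX, mY, mZ}" for m using j(2) that unfolding I_def by blast
    have gt: "graph_in t" by (rule graph_in_frame[OF g]) (simp_all add: tm)
    have S: "msel t mSet = ?S" unfolding msel_def by (simp add: tm)
    have tC: "msel t mMark \<subseteq> C" using j(2) unfolding I_def by blast
    have clS: "w \<in> C" if "u \<in> C" "w \<in> msel t mSet" "E u w" for u w using cl that S by simp
    have rr1: "msel t mMark \<subseteq> msel t1 mMark" by (rule reach_round(1)[OF gt tC _ t1_def]) (rule clS)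
    have rr2: "msel t1 mMark \<subseteq> C" by (rule reach_round(2)[OF gt tC _ t1_def]) (rule clS)
    have rr3: "w \<in> msel t1 mMark" if "u \<in> msel t mMark" "w \<in> ?S" "E u w" for u w
      by (rule reach_round(3)[OF gt tC _ t1_def that(1) _ that(3)]) (use clS that S in simp_all)
    have fr: "t1 m = t m" if "m \<notin> {mMark, mX, mY, mZ}" for m
      unfolding t1_def by (rule run_frame) (use that in simp)
    have fin: "finite (msel t1 mMark)" unfolding msel_def by simp
    have c: "(\<forall>u\<in>msel t1 mMark. \<forall>w\<in>?S. E u w \<longrightarrow> w \<in> msel t1 mMark) \<or> Suc j \<le> card (msel t1 mMark)"
    proof (cases "msel t1 mMark = msel t mMark")
      case True
      have "\<forall>u\<in>msel t mMark. \<forall>w\<in>?S. E u w \<longrightarrow> w \<in> msel t1 mMark" by (intro ballI impI) (rule rr3)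
      then show ?thesis unfolding True by (rule disjI1)
    next
      case False
      then have "msel t mMark \<subset> msel t1 mMark" using rr1 by blast
      then have lt: "card (msel t mMark) < card (msel t1 mMark)" using fin psubset_card_mono by blast
      have "\<not> (\<forall>u\<in>msel t mMark. \<forall>w\<in>?S. E u w \<longrightarrow> w \<in> msel t mMark)"
      proof
        assume c0: "\<forall>u\<in>msel t mMark. \<forall>w\<in>?S. E u w \<longrightarrow> w \<in> msel t mMark"
        have "msel t1 mMark \<subseteq> msel t mMark"
          by (rule reach_round(2)[OF gt subset_refl _ t1_def]) (use c0 S in blast)
        then show False using False rr1 by blast
      qed
      then have "j \<le> card (msel t mMark)" using j(2) False unfolding I_def by blast
      then show ?thesis using lt by simp
    qed
    have mk: "msel (bump mZ t1) mMark = msel t1 mMark" unfolding msel_def by simp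
    have "?M \<subseteq> msel t mMark" using j(2) unfolding I_def by (elim conjE)
    then have "?M \<subseteq> msel t1 mMark" using rr1 by (rule order_trans)
    moreover have "bump mZ t1 m = s m" if "m \<notin> {mMark, mX, mY, mZ}" for m
    proof -
      have "m \<noteq> mZ" using that by blast
      then show ?thesis using trans[OF fr[OF that] tm[OF that]] by (subst bump_other)
    qed
    ultimately have "I (Suc j) (bump mZ t1)"
      unfolding I_def mk by (intro conjI allI impI rr2 c)
    then show "I (Suc j) (bump mZ (run ?r t))" unfolding t1_def .
  qed simp
  then have r: "I n (run REACH s)" unfolding N .
  let ?R = "msel (run REACH s) mMark"
  have Rn: "?R \<subseteq> {..<n}" unfolding msel_def by auto
  \<comment> \<open>With \<open>n\<close> marks every vertex is marked, and the marks are closed for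
    that reason.\<close>
  have "\<forall>u\<in>?R. \<forall>w\<in>?S. E u w \<longrightarrow> w \<in> ?R"
  proof (rule disjE)
    show "(\<forall>u\<in>?R. \<forall>w\<in>?S. E u w \<longrightarrow> w \<in> ?R) \<or> n \<le> card ?R" using r unfolding I_def by blast
    assume "n \<le> card ?R"
    then have "?R = {..<n}" using Rn by (intro card_seteq) simp_all
    then show ?thesis unfolding msel_def by auto
  qed blast
  then have cl': "\<And>u w. u \<in> ?R \<Longrightarrow> w \<in> ?S \<Longrightarrow> E u w \<Longrightarrow> w \<in> ?R" by blast
  have MR: "?M \<subseteq> ?R" and RC: "?R \<subseteq> C" using r unfolding I_def by simp_all
  have "C \<subseteq> ?R"
  proof
    fix v assume "v \<in> C"
    then obtain u where u: "u \<in> ?M" "conn ?S u v" unfolding C_def by blast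
    show "v \<in> ?R" by (rule conn_closed_no_exit(1)[OF u(2) subsetD[OF MR u(1)]]) (rule cl')
  qed
  then show ?thesis using RC unfolding C_def by (intro subset_antisym)
qed

lemma REACH_frame: "m \<notin> {mMark, mX, mY, mZ} \<Longrightarrow> run REACH s m = s m"
  by (rule run_frame) (simp add: REACH_def)

lemma run_DEGREES:
  assumes g: "graph_in s" and v: "v < n"
  shows "run DEGREES s mDeg v = card {u \<in> msel s mSet. E v u}"
proof -
  have N: "s mN 0 = n" using g unfolding graph_in_def by blast
  let ?body = "Seq (assign mCnt (Const 0))
     (Seq (For mY mN (If (And (cell mSet mY) (adj mX mY)) (assign mCnt (Add (var mCnt) (Const 1))) Skip))
     (Write mDeg (var mX) (var mCnt)))"
  define I where "I j t \<longleftrightarrow> (\<forall>m. m \<notin> {mDeg, mX, mY, mCnt} \<longrightarrow> t m = s m) \<and>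
    (\<forall>v<j. t mDeg v = card {u \<in> msel s mSet. E v u})" for j t
  have "I (s mN 0) (run DEGREES s)" unfolding DEGREES_def
  proof (rule for_invariant)
    show "I 0 (wr mX 0 0 s)" unfolding I_def by simp
    fix j t
    assume j: "j < s mN 0" "I j t" "t mX 0 = j"
    define t0 where "t0 = wr mCnt 0 0 t"
    let ?f = "For mY mN (If (And (cell mSet mY) (adj mX mY)) (assign mCnt (Add (var mCnt) (Const 1))) Skip)"
    have tm: "t m = s m" if "m \<notin> {mDeg, mX, mY, mCnt}" for m using j(2) that unfolding I_def by blast
    have "run ?f t0 mCnt 0 = t0 mCnt 0 + (\<Sum>u<t0 mN 0. if u \<in> msel s mSet \<and> E j u then 1 else 0)"
    proof (rule run_sum)
      fix t' u
      assume u: "u < t0 mN 0" and fr: "\<And>m. m \<noteq> mCnt \<Longrightarrow> m \<noteq> mY \<Longrightarrow> t' m = t0 m" and y: "t' mY 0 = u"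
      have t'm: "t' m = s m" if "m \<notin> {mDeg, mX, mY, mCnt}" for m using fr tm that unfolding t0_def by simp
      have gt: "graph_in t'" by (rule graph_in_frame[OF g]) (simp_all add: t'm)
      have "u < n" "j < n" "t' mX 0 = j" using u j tm N fr unfolding t0_def by simp_all
      then show "(eval_expr (And (cell mSet mY) (adj mX mY)) t' \<noteq> 0 \<longleftrightarrow> u \<in> msel s mSet \<and> E j u) \<and> eval_expr (Const 1) t' = 1"
        using eval_adj[OF gt, of mX mY] y t'm[of mSet] by (simp add: msel_def)
    qed simp_all
    also have "t0 mN 0 = n" using tm N unfolding t0_def by simp
    also have "(\<Sum>u<n. if u \<in> msel s mSet \<and> E j u then 1 else 0) = card {u \<in> msel s mSet. E j u}"
    proof -
      have "{u \<in> msel s mSet. E j u} = {u \<in> {..<n}. u \<in> msel s mSet \<and> E j u}" unfolding msel_def by auto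
      then show ?thesis by (simp add: sum.If_cases card_eq_sum Int_def del: sum_constant)
    qed
    finally have c: "run ?f t0 mCnt 0 = card {u \<in> msel s mSet. E j u}" unfolding t0_def by simp
    have fr: "run ?f t0 m = t m" if "m \<notin> {mY, mCnt}" for m
    proof -
      have "run ?f t0 m = t0 m" by (rule run_frame) (use that in simp)
      then show ?thesis using that unfolding t0_def by simp
    qed
    have "run ?body t = wr mDeg j (card {u \<in> msel s mSet. E j u}) (run ?f t0)"
      using c fr[of mX] j(3) unfolding t0_def by simp
    then show "I (Suc j) (bump mX (run ?body t))"
      using j(2) fr tm unfolding I_def by (auto simp: less_Suc_eq)
  qed simp
  then show ?thesis using v unfolding N I_def by blast
qed

lemma DEGREES_frame: "m \<notin> {mDeg, mX, mY, mCnt} \<Longrightarrow> run DEGREES s m = s m"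
  by (rule run_frame) (auto simp: DEGREES_def)

end

section \<open>Selecting an undecided vertex and testing its subtree\<close>

definition PICK :: cmd where
  "PICK = Seq (fill mSet (Const 1) (Eq (cell mRole mX) (Const 0)))
     (Seq DEGREES
     (Seq (assign mCand (Const 0))
     (For mX mN (If (And (Eq (cell mRole mX) (Const 0)) (Sub (Const 2) (cell mDeg mX)))
        (assign mCand (Add (var mX) (Const 1))) Skip))))"

definition TREE :: cmd where
  "TREE = Seq (fill mSet (Const 1) (Add (Eq (cell mRole mX) (Const 1)) (Eq (var mX) (var mV))))
     (Seq (fill mMark (Const 1) (Eq (var mX) (var mV)))
     (Seq REACH
     (fill mTree (Const 1) (cell mMark mX))))"

text \<open>Summing degrees into the subtree over the forest vertices counts the edges between them.
  The degrees are left in \<open>mDeg\<close>, where \<open>PIECE\<close> reads off the neighbours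
  of the subtree.\<close>

definition EDGES :: cmd where
  "EDGES = Seq (fill mSet (Const 1) (cell mTree mX))
     (Seq DEGREES
     (Seq (assign mCnt (Const 0))
     (add_all mCnt (Eq (cell mRole mX) (Const 4)) (cell mDeg mX))))"

text \<open>The component of one kept neighbour is marked, and the kept neighbours outside it are
  counted. If there is no kept neighbour, \<open>mNbr\<close> stays 0, no \<open>mX + 1\<close>
  equals it and nothing is marked.\<close>

definition PIECE :: cmd where
  "PIECE = Seq (assign mNbr (Const 0))
     (Seq (For mX mN (If (And (Kept (cell mRole mX)) (cell mDeg mX)) (assign mNbr (Add (var mX) (Const 1))) Skip))
     (Seq (fill mSet (Const 1) (Kept (cell mRole mX)))
     (Seq (fill mMark (Const 1) (Eq (Add (var mX) (Const 1)) (var mNbr)))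
     (Seq REACH
     (Seq (assign mBad (Const 0))
     (add_all mBad (And (Kept (cell mRole mX)) (And (cell mDeg mX) (Not (cell mMark mX)))) (Const 1)))))))"

text \<open>After the test \<open>mCnt\<close> is reused for the symbol read. For choice 1 the whole
  subtree is first filled with 4, and the root is then overwritten with 3.\<close>

definition ACT :: cmd where
  "ACT = If (And (Sub (Const 2) (var mCnt)) (Not (var mBad))) (Write mRole (var mV) (Const 1))
     (Seq (assign mCnt (Read mDig (var mPtr)))
     (Seq (assign mPtr (Add (var mPtr) (Const 1)))
     (If (Eq (var mCnt) (Const 0)) (Write mRole (var mV) (Const 2))
       (Seq (fill mRole (cell mTree mX) (Const 4))
       (If (Eq (var mCnt) (Const 1)) (Write mRole (var mV) (Const 3)) Skip)))))"

definition STEP :: cmd where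
  "STEP = Seq PICK (If (var mCand)
     (Seq (assign mV (Sub (var mCand) (Const 1))) (Seq TREE (Seq EDGES (Seq PIECE ACT)))) Skip)"

context deletion_instance
begin

text \<open>Cells from \<open>n\<close> on may contain anything, so the role of an absent vertex is
  imposed there.\<close>

definition roles :: "state \<Rightarrow> nat \<Rightarrow> nat" where
  "roles s v = (if v < n then s mRole v else 5)"

lemma roles_cong: "s' mRole = s mRole \<Longrightarrow> roles s' = roles s"
  unfolding roles_def fun_eq_iff by simp

lemma graph_in_N: "graph_in s \<Longrightarrow> s mN 0 = n"
  unfolding graph_in_def by blast

lemma fill_frame: "m \<noteq> a \<Longrightarrow> m \<noteq> mX \<Longrightarrow> run (fill a g e) s m = s m"
  by (rule run_frame) simp

lemma add_all_frame: "m \<noteq> a \<Longrightarrow> m \<noteq> mX \<Longrightarrow> run (add_all a g e) s m = s m"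
  by (rule run_frame) simp

lemma run_fill_all:
  assumes "graph_in s" "a \<noteq> mX" "a \<noteq> mN"
    and "\<And>s' v. v < n \<Longrightarrow> (\<And>m. m \<noteq> a \<Longrightarrow> m \<noteq> mX \<Longrightarrow> s' m = s m) \<Longrightarrow> s' mX 0 = v \<Longrightarrow> s' a v = s a v \<Longrightarrow>
      eval_expr e s' = f v"
    and "v < n"
  shows "run (fill a (Const 1) e) s a v = f v"
proof -
  have "run (fill a (Const 1) e) s a = (\<lambda>v. if v < s mN 0 \<and> True then f v else s a v)"
    by (rule run_fill) (use assms(1-4) graph_in_N in auto)
  then show ?thesis using assms(5) graph_in_N[OF assms(1)] by simp
qed

text \<open>In contrast to \<open>run_fill\<close>, only the vanishing of the written values has to
  be known, not the values.\<close>

lemma msel_fill: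
  assumes "graph_in s" "a \<noteq> mX" "a \<noteq> mN"
    and "\<And>s' v. v < n \<Longrightarrow> (\<And>m. m \<noteq> a \<Longrightarrow> m \<noteq> mX \<Longrightarrow> s' m = s m) \<Longrightarrow> s' mX 0 = v \<Longrightarrow> s' a v = s a v \<Longrightarrow>
      eval_expr e s' \<noteq> 0 \<longleftrightarrow> P v"
  shows "msel (run (fill a (Const 1) e) s) a = {v. v < n \<and> P v}"
proof -
  define I where "I j t \<longleftrightarrow> (\<forall>m. m \<noteq> a \<longrightarrow> m \<noteq> mX \<longrightarrow> t m = s m) \<and>
    (\<forall>v<j. t a v \<noteq> 0 \<longleftrightarrow> P v) \<and> (\<forall>v\<ge>j. t a v = s a v)" for j t
  have "I (s mN 0) (run (fill a (Const 1) e) s)"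
  proof (rule for_invariant)
    show "mX \<notin> writes (If (Const 1) (Write a (var mX) e) Skip)" using assms by simp
    show "I 0 (wr mX 0 0 s)" using assms(2) unfolding I_def by simp
    fix j t
    assume j: "j < s mN 0" "I j t" "t mX 0 = j"
    then have h: "eval_expr e t \<noteq> 0 \<longleftrightarrow> P j"
      using graph_in_N[OF assms(1)] by (intro assms(4)) (simp_all add: I_def)
    show "I (Suc j) (bump mX (run (If (Const 1) (Write a (var mX) e) Skip) t))"
      using j h assms(2) unfolding I_def by (auto simp: less_Suc_eq)
  qed
  then show ?thesis unfolding I_def msel_def graph_in_N[OF assms(1)] by auto
qed

lemma low_iff_card: "finite S \<Longrightarrow> low S v \<longleftrightarrow> card {u \<in> S. E v u} < 2"
  using card_le_Suc0_iff_eq[of "{u \<in> S. E v u}"] unfolding low_def by (auto simp: less_Suc_eq_le numeral_2_eq_2)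

lemma sum_if_eq: "(\<Sum>v<n. if P v then f v else 0) = (\<Sum>v\<in>{v. v < n \<and> P v}. f v)" for f :: "nat \<Rightarrow> nat"
proof -
  have "{v. v < n \<and> P v} = {v \<in> {..<n}. P v}" by auto
  then show ?thesis using sum.inter_filter[of "{..<n}" f P] by simp
qed

lemma roles_sets:
  "{x. roles s x = 0} = {v. v < n \<and> s mRole v = 0}" "{x. roles s x = 1} = {v. v < n \<and> s mRole v = 1}"
  "{x. roles s x = 4} = {v. v < n \<and> s mRole v = 4}"
  "{x. roles s x = 3 \<or> roles s x = 4} = {v. v < n \<and> (s mRole v = 3 \<or> s mRole v = 4)}"
  "{x. roles s x = 3} = {v. v < n \<and> s mRole v = 3}" "{x. roles s x = 2} = {v. v < n \<and> s mRole v = 2}"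
  unfolding roles_def by auto

lemma PICK_frame: "m \<notin> {mSet, mDeg, mX, mY, mCnt, mCand} \<Longrightarrow> run PICK s m = s m"
  by (rule run_frame) (auto simp: PICK_def DEGREES_def)

lemma run_PICK:
  assumes g: "graph_in s"
  shows "run PICK s mCand 0 = pick (roles s)"
proof -
  let ?F = "For mX mN (If (And (Eq (cell mRole mX) (Const 0)) (Sub (Const 2) (cell mDeg mX)))
        (assign mCand (Add (var mX) (Const 1))) Skip)"
  define s1 where "s1 = run (fill mSet (Const 1) (Eq (cell mRole mX) (Const 0))) s"
  define s2 where "s2 = run DEGREES s1"
  define s3 where "s3 = wr mCand 0 0 s2"
  have f1: "s1 m = s m" if "m \<noteq> mSet" "m \<noteq> mX" for m unfolding s1_def by (rule fill_frame) (use that in simp_all)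
  have g1: "graph_in s1" by (rule graph_in_frame[OF g]) (simp_all add: f1)
  have f2: "s2 m = s1 m" if "m \<notin> {mDeg, mX, mY, mCnt}" for m unfolding s2_def by (rule DEGREES_frame[OF that])
  have g2: "graph_in s2" by (rule graph_in_frame[OF g1]) (simp_all add: f2)
  have S: "msel s1 mSet = {x. roles s x = 0}" unfolding s1_def roles_sets
    by (rule msel_fill[OF g]) simp_all
  have fin: "finite {x. roles s x = 0}" unfolding roles_sets by simp
  have deg: "s3 mDeg v < 2 \<longleftrightarrow> low {x. roles s x = 0} v" if "v < n" for v
    using run_DEGREES[OF g1 that] low_iff_card[OF fin] S unfolding s3_def s2_def by simp
  have r3: "s3 mRole = s mRole" unfolding s3_def using f1[of mRole] f2[of mRole] by simp
  have n3: "s3 mN 0 = n" using graph_in_N[OF g2] unfolding s3_def by simp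
  have "run ?F s3 mCand 0 = last_sat (\<lambda>v. roles s v = 0 \<and> low {x. roles s x = 0} v) (s3 mN 0)"
  proof (rule run_last)
    fix s' v
    assume v: "v < s3 mN 0" and fr: "\<And>m. m \<noteq> mCand \<Longrightarrow> m \<noteq> mX \<Longrightarrow> s' m = s3 m" and x: "s' mX 0 = v"
    have "s' mDeg v < 2 \<longleftrightarrow> low {x. roles s x = 0} v" using deg[of v] v n3 fr[of mDeg] by simp
    moreover have "s' mRole v = roles s v" using fr[of mRole] r3 v n3 unfolding roles_def by simp
    ultimately show "(eval_expr (And (Eq (cell mRole mX) (Const 0)) (Sub (Const 2) (cell mDeg mX))) s' \<noteq> 0) =
        (roles s v = 0 \<and> low {x. roles s x = 0} v)"
      using x by auto
  qed (simp_all add: s3_def)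
  moreover have "run PICK s = run ?F s3"
    unfolding PICK_def s3_def s2_def s1_def by (simp only: run.simps(2,3) eval_expr.simps)
  ultimately show ?thesis unfolding pick_def n3 by simp
qed

lemma TREE_frame: "m \<notin> {mSet, mMark, mX, mY, mZ, mTree} \<Longrightarrow> run TREE s m = s m"
  by (rule run_frame) (auto simp: TREE_def REACH_def)

lemma run_TREE:
  assumes g: "graph_in s" and v: "s mV 0 = v" "v < n"
  shows "msel (run TREE s) mTree = stree (roles s) v"
proof -
  define s1 where "s1 = run (fill mSet (Const 1) (Add (Eq (cell mRole mX) (Const 1)) (Eq (var mX) (var mV)))) s"
  define s2 where "s2 = run (fill mMark (Const 1) (Eq (var mX) (var mV))) s1"
  define s3 where "s3 = run REACH s2"
  have f1: "s1 m = s m" if "m \<noteq> mSet" "m \<noteq> mX" for m unfolding s1_def by (rule fill_frame) (use that in simp_all)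
  have g1: "graph_in s1" by (rule graph_in_frame[OF g]) (simp_all add: f1)
  have f2: "s2 m = s1 m" if "m \<noteq> mMark" "m \<noteq> mX" for m unfolding s2_def by (rule fill_frame) (use that in simp_all)
  have g2: "graph_in s2" by (rule graph_in_frame[OF g1]) (simp_all add: f2)
  have f3: "s3 m = s2 m" if "m \<notin> {mMark, mX, mY, mZ}" for m unfolding s3_def by (rule REACH_frame[OF that])
  have g3: "graph_in s3" by (rule graph_in_frame[OF g2]) (simp_all add: f3)
  have "msel s1 mSet = {u. u < n \<and> (s mRole u = 1 \<or> u = v)}" unfolding s1_def
    by (rule msel_fill[OF g]) (simp_all add: v)
  also have "\<dots> = {x. roles s x = 1} \<union> {v}" unfolding roles_sets using v by auto
  finally have S: "msel s2 mSet = {x. roles s x = 1} \<union> {v}" using f2[of mSet] unfolding msel_def by simp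
  have "msel s2 mMark = {u. u < n \<and> u = v}" unfolding s2_def
    by (rule msel_fill[OF g1]) (simp_all add: f1 v)
  then have M: "msel s2 mMark = {v}" using v by auto
  have "msel s3 mMark = stree (roles s) v"
    unfolding s3_def run_REACH[OF g2, unfolded M S, OF Un_upper2] stree_def comp_def by simp
  moreover have "msel (run (fill mTree (Const 1) (cell mMark mX)) s3) mTree = {u. u < n \<and> s3 mMark u \<noteq> 0}"
    by (rule msel_fill[OF g3]) simp_all
  moreover have "run TREE s = run (fill mTree (Const 1) (cell mMark mX)) s3"
    unfolding TREE_def s3_def s2_def s1_def by (simp only: run.simps(3))
  ultimately show ?thesis unfolding msel_def by simp
qed

lemma EDGES_frame: "m \<notin> {mSet, mX, mY, mDeg, mCnt} \<Longrightarrow> run EDGES s m = s m"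
  by (rule run_frame) (auto simp: EDGES_def DEGREES_def)

text \<open>The counter is the size of a disjoint sum over the forest vertices, so a value below 2
  means that any two of these edges coincide.\<close>

lemma run_EDGES:
  assumes g: "graph_in s"
  shows "run EDGES s mCnt 0 < 2 \<longleftrightarrow> (\<forall>t\<in>msel s mTree. \<forall>t'\<in>msel s mTree. \<forall>w\<in>{x. roles s x = 4}. \<forall>w'\<in>{x. roles s x = 4}.
      E t w \<longrightarrow> E t' w' \<longrightarrow> t = t' \<and> w = w')"
    and "v < n \<Longrightarrow> run EDGES s mDeg v \<noteq> 0 \<longleftrightarrow> (\<exists>t\<in>msel s mTree. E t v)"
proof -
  define s1 where "s1 = run (fill mSet (Const 1) (cell mTree mX)) s"
  define s2 where "s2 = run DEGREES s1"
  define s3 where "s3 = wr mCnt 0 0 s2"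
  let ?F = "add_all mCnt (Eq (cell mRole mX) (Const 4)) (cell mDeg mX)"
  let ?T = "msel s mTree" and ?W = "{x. roles s x = 4}"
  have f1: "s1 m = s m" if "m \<noteq> mSet" "m \<noteq> mX" for m unfolding s1_def by (rule fill_frame) (use that in simp_all)
  have g1: "graph_in s1" by (rule graph_in_frame[OF g]) (simp_all add: f1)
  have f2: "s2 m = s1 m" if "m \<notin> {mDeg, mX, mY, mCnt}" for m unfolding s2_def by (rule DEGREES_frame[OF that])
  have g2: "graph_in s2" by (rule graph_in_frame[OF g1]) (simp_all add: f2)
  have T: "msel s1 mSet = ?T" unfolding s1_def msel_def[of s]
    by (rule msel_fill[OF g]) simp_all
  have finT: "finite ?T" unfolding msel_def by simp
  have deg: "s3 mDeg u = card {t \<in> ?T. E u t}" if "u < n" for u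
    using run_DEGREES[OF g1 that] T unfolding s3_def s2_def by simp
  have n3: "s3 mN 0 = n" using graph_in_N[OF g2] unfolding s3_def by simp
  have r3: "s3 mRole = s mRole" unfolding s3_def using f1[of mRole] f2[of mRole] by simp
  have E: "run EDGES s = run ?F s3"
    unfolding EDGES_def s3_def s2_def s1_def by (simp only: run.simps(2,3) eval_expr.simps)
  have "run ?F s3 mDeg = s3 mDeg" by (rule add_all_frame) simp_all
  then show "run EDGES s mDeg v \<noteq> 0 \<longleftrightarrow> (\<exists>t\<in>?T. E t v)" if "v < n"
    using deg[OF that] finT E_sym unfolding E by auto
  have "run ?F s3 mCnt 0 = s3 mCnt 0 + (\<Sum>u<s3 mN 0. if u \<in> ?W then card {t \<in> ?T. E u t} else 0)"
  proof (rule run_sum)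
    fix s' u
    assume u: "u < s3 mN 0" and fr: "\<And>m. m \<noteq> mCnt \<Longrightarrow> m \<noteq> mX \<Longrightarrow> s' m = s3 m" and x: "s' mX 0 = u"
    have "s' mDeg u = card {t \<in> ?T. E u t}" using deg[of u] u n3 fr[of mDeg] by simp
    moreover have "s' mRole u = roles s u" using fr[of mRole] r3 u n3 unfolding roles_def by simp
    ultimately show "(eval_expr (Eq (cell mRole mX) (Const 4)) s' \<noteq> 0 \<longleftrightarrow> u \<in> ?W) \<and> eval_expr (cell mDeg mX) s' = card {t \<in> ?T. E u t}"
      using x by simp
  qed simp_all
  also have "\<dots> = (\<Sum>u\<in>?W. card {t \<in> ?T. E u t})"
    unfolding n3 sum_if_eq using E_less by (simp add: s3_def roles_sets)
  also have "\<dots> = card (SIGMA u:?W. {t \<in> ?T. E u t})"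
    using finT by (subst card_SigmaI) (simp_all add: roles_sets)
  finally have c: "run EDGES s mCnt 0 = card (SIGMA u:?W. {t \<in> ?T. E u t})" unfolding E .
  have "finite (SIGMA u:?W. {t \<in> ?T. E u t})" using finT by (intro finite_SigmaI) (simp_all add: roles_sets)
  note card_le_Suc0_iff_eq[OF this]
  then have "run EDGES s mCnt 0 < 2 \<longleftrightarrow> (\<forall>a\<in>SIGMA u:?W. {t \<in> ?T. E u t}. \<forall>b\<in>SIGMA u:?W. {t \<in> ?T. E u t}. a = b)"
    unfolding c by (simp only: less_Suc_eq_le numeral_2_eq_2)
  also have "\<dots> \<longleftrightarrow> (\<forall>t\<in>?T. \<forall>t'\<in>?T. \<forall>w\<in>?W. \<forall>w'\<in>?W. E t w \<longrightarrow> E t' w' \<longrightarrow> t = t' \<and> w = w')"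
    (is "?L \<longleftrightarrow> ?R")
  proof
    assume L: ?L
    show ?R
    proof (intro ballI impI)
      fix t t' w w' assume h: "t \<in> ?T" "t' \<in> ?T" "w \<in> ?W" "w' \<in> ?W" "E t w" "E t' w'"
      then have "(w, t) \<in> (SIGMA u:?W. {t \<in> ?T. E u t})" "(w', t') \<in> (SIGMA u:?W. {t \<in> ?T. E u t})"
        using E_sym by simp_all
      then have "(w, t) = (w', t')" using L by blast
      then show "t = t' \<and> w = w'" by simp
    qed
  next
    assume R: ?R
    show ?L
    proof (intro ballI)
      fix a b assume "a \<in> (SIGMA u:?W. {t \<in> ?T. E u t})" "b \<in> (SIGMA u:?W. {t \<in> ?T. E u t})"
      then obtain w t w' t' where "a = (w, t)" "b = (w', t')" "w \<in> ?W" "w' \<in> ?W" "t \<in> ?T" "t' \<in> ?T" "E w t" "E w' t'"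
        by blast
      then show "a = b" using R E_sym by blast
    qed
  qed
  finally show "run EDGES s mCnt 0 < 2 \<longleftrightarrow> ?R" .
qed

lemma PIECE_frame: "m \<notin> {mSet, mX, mY, mZ, mMark, mNbr, mBad} \<Longrightarrow> run PIECE s m = s m"
  by (rule run_frame) (auto simp: PIECE_def REACH_def)

text \<open>Connectivity is an equivalence on \<open>K\<close>, so comparing all kept neighbours
  with a single one decides whether they are mutually connected.\<close>

lemma run_PIECE:
  assumes g: "graph_in s" and deg: "\<And>v. v < n \<Longrightarrow> s mDeg v \<noteq> 0 \<longleftrightarrow> (\<exists>t\<in>T. E t v)"
    and K: "K = {x. roles s x = 3 \<or> roles s x = 4}"
  shows "run PIECE s mBad 0 = 0 \<longleftrightarrow> (\<forall>t\<in>T. \<forall>t'\<in>T. \<forall>p\<in>K. \<forall>p'\<in>K. E t p \<longrightarrow> E t' p' \<longrightarrow> conn K p p')"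
proof -
  let ?F = "For mX mN (If (And (Kept (cell mRole mX)) (cell mDeg mX)) (assign mNbr (Add (var mX) (Const 1))) Skip)"
  let ?B = "add_all mBad (And (Kept (cell mRole mX)) (And (cell mDeg mX) (Not (cell mMark mX)))) (Const 1)"
  define s0 where "s0 = wr mNbr 0 0 s"
  define s1 where "s1 = run ?F s0"
  define s2 where "s2 = run (fill mSet (Const 1) (Kept (cell mRole mX))) s1"
  define s3 where "s3 = run (fill mMark (Const 1) (Eq (Add (var mX) (Const 1)) (var mNbr))) s2"
  define s4 where "s4 = run REACH s3"
  define s5 where "s5 = wr mBad 0 0 s4"
  define Q where "Q v \<longleftrightarrow> v \<in> K \<and> (\<exists>t\<in>T. E t v)" for v
  have f0: "s0 m = s m" if "m \<noteq> mNbr" for m unfolding s0_def using that by simp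
  have f1: "s1 m = s m" if "m \<noteq> mNbr" "m \<noteq> mX" for m
  proof -
    have "s1 m = s0 m" unfolding s1_def by (rule run_frame) (use that in simp)
    then show ?thesis using f0 that by simp
  qed
  have g1: "graph_in s1" by (rule graph_in_frame[OF g]) (simp_all add: f1)
  have f2: "s2 m = s1 m" if "m \<noteq> mSet" "m \<noteq> mX" for m unfolding s2_def by (rule fill_frame) (use that in simp_all)
  have g2: "graph_in s2" by (rule graph_in_frame[OF g1]) (simp_all add: f2)
  have f3: "s3 m = s2 m" if "m \<noteq> mMark" "m \<noteq> mX" for m unfolding s3_def by (rule fill_frame) (use that in simp_all)
  have g3: "graph_in s3" by (rule graph_in_frame[OF g2]) (simp_all add: f3)
  have f4: "s4 m = s3 m" if "m \<notin> {mMark, mX, mY, mZ}" for m unfolding s4_def by (rule REACH_frame[OF that])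
  have fall: "s4 m = s m" if "m \<notin> {mMark, mX, mY, mZ, mSet, mNbr}" for m using f1 f2 f3 f4 that by simp
  have n0: "s0 mN 0 = n" using graph_in_N[OF g] f0[of mN] by simp
  have n5: "s5 mN 0 = n" using graph_in_N[OF g] fall[of mN] unfolding s5_def by simp
  have KQ: "(s mRole v = 3 \<or> s mRole v = 4) \<and> s mDeg v \<noteq> 0 \<longleftrightarrow> Q v" if "v < n" for v
    using deg[OF that] that unfolding Q_def K roles_def by simp
  have c1: "s1 mNbr 0 = last_sat Q n"
  proof -
    have "run ?F s0 mNbr 0 = last_sat Q (s0 mN 0)"
    proof (rule run_last)
      fix s' v
      assume v: "v < s0 mN 0" and fr: "\<And>m. m \<noteq> mNbr \<Longrightarrow> m \<noteq> mX \<Longrightarrow> s' m = s0 m" and x: "s' mX 0 = v"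
      have "s' mRole = s mRole" "s' mDeg = s mDeg" using fr[of mRole] fr[of mDeg] f0 by simp_all
      then show "(eval_expr (And (Kept (cell mRole mX)) (cell mDeg mX)) s' \<noteq> 0) = Q v"
        using x KQ[of v] v n0 by simp
    qed (simp_all add: s0_def)
    then show ?thesis unfolding n0 s1_def .
  qed
  have "msel s2 mSet = {v. v < n \<and> (s mRole v = 3 \<or> s mRole v = 4)}" unfolding s2_def
    by (rule msel_fill[OF g1]) (simp_all add: f1)
  then have S: "msel s3 mSet = K" unfolding K roles_sets using f3[of mSet] by (simp add: msel_def)
  have "msel s3 mMark = {v. v < n \<and> Suc v = last_sat Q n}" unfolding s3_def
    by (rule msel_fill[OF g2]) (simp_all add: f2 c1)
  then have M: "msel s3 mMark = {v. Suc v = last_sat Q n}" using last_sat_eq_Suc[of Q n] by auto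
  have MK: "msel s3 mMark \<subseteq> msel s3 mSet"
  proof
    fix v assume "v \<in> msel s3 mMark"
    then have "last_sat Q n = Suc v" unfolding M by simp
    then have "Q v" using last_sat_eq_Suc by blast
    then show "v \<in> msel s3 mSet" unfolding S Q_def by blast
  qed
  have R: "msel s4 mMark = {v. \<exists>u. Suc u = last_sat Q n \<and> conn K u v}"
    unfolding s4_def run_REACH[OF g3 MK] unfolding M S by auto
  have "run ?B s5 mBad 0 = s5 mBad 0 + (\<Sum>v<s5 mN 0. if Q v \<and> v \<notin> msel s4 mMark then 1 else 0)"
  proof (rule run_sum)
    fix s' v
    assume v: "v < s5 mN 0" and fr: "\<And>m. m \<noteq> mBad \<Longrightarrow> m \<noteq> mX \<Longrightarrow> s' m = s5 m" and x: "s' mX 0 = v"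
    have "s' mRole = s mRole" "s' mDeg = s mDeg" "s' mMark = s4 mMark"
      using fr[of mRole] fr[of mDeg] fr[of mMark] fall[of mRole] fall[of mDeg] unfolding s5_def by simp_all
    then show "(eval_expr (And (Kept (cell mRole mX)) (And (cell mDeg mX) (Not (cell mMark mX)))) s' \<noteq> 0 \<longleftrightarrow> Q v \<and> v \<notin> msel s4 mMark) \<and>
        eval_expr (Const 1) s' = 1"
      using x KQ[of v] v n5 by (auto simp: msel_def)
  qed simp_all
  moreover have "run PIECE s = run ?B s5"
    unfolding PIECE_def s5_def s4_def s3_def s2_def s1_def s0_def by (simp only: run.simps(2,3) eval_expr.simps)
  ultimately have b: "run PIECE s mBad 0 = 0 \<longleftrightarrow> (\<forall>v<n. Q v \<longrightarrow> v \<in> msel s4 mMark)"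
    unfolding n5 by (auto simp: s5_def)
  have Qn: "v < n" if "Q v" for v using that E_less unfolding Q_def by blast
  have "(\<forall>v<n. Q v \<longrightarrow> v \<in> msel s4 mMark) \<longleftrightarrow> (\<forall>p p'. Q p \<longrightarrow> Q p' \<longrightarrow> conn K p p')"
  proof (cases "last_sat Q n")
    case 0
    then have "\<not> Q v" for v using Qn unfolding last_sat_eq_0 by blast
    then show ?thesis by blast
  next
    case (Suc u)
    then have u: "Q u" using last_sat_eq_Suc by blast
    have "v \<in> msel s4 mMark \<longleftrightarrow> conn K u v" for v unfolding R Suc by simp
    then have "(\<forall>v<n. Q v \<longrightarrow> v \<in> msel s4 mMark) \<longleftrightarrow> (\<forall>v. Q v \<longrightarrow> conn K u v)" using Qn by blast
    also have "\<dots> \<longleftrightarrow> (\<forall>p p'. Q p \<longrightarrow> Q p' \<longrightarrow> conn K p p')"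
    proof (intro iffI allI impI)
      fix p p' assume "\<forall>v. Q v \<longrightarrow> conn K u v" "Q p" "Q p'"
      then show "conn K p p'" using conn_trans[OF conn_sym[of K u p], of p'] by blast
    qed (use u in blast)
    finally show ?thesis .
  qed
  also have "\<dots> \<longleftrightarrow> (\<forall>t\<in>T. \<forall>t'\<in>T. \<forall>p\<in>K. \<forall>p'\<in>K. E t p \<longrightarrow> E t' p' \<longrightarrow> conn K p p')"
    unfolding Q_def by blast
  finally show ?thesis using b by blast
qed

lemma run_STEP:
  assumes g: "graph_in s"
  shows "(roles (run STEP s), run STEP s mPtr 0) = step (s mDig) (roles s, s mPtr 0)"
proof (cases "pick (roles s)")
  case 0
  then have "run STEP s = run PICK s" unfolding STEP_def using run_PICK[OF g] by simp
  moreover have "roles (run PICK s) = roles s" by (rule roles_cong) (simp add: PICK_frame)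
  ultimately show ?thesis using 0 by (simp add: step_def PICK_frame)
next
  case (Suc v)
  let ?r = "roles s"
  have v: "?r v = 0" "v < n" using Suc last_sat_eq_Suc unfolding pick_def by blast+
  define s0 where "s0 = run PICK s"
  define s1 where "s1 = wr mV 0 v s0"
  define s2 where "s2 = run TREE s1"
  define s3 where "s3 = run EDGES s2"
  define s4 where "s4 = run PIECE s3"
  have c: "s0 mCand 0 = Suc v" unfolding s0_def using run_PICK[OF g] Suc by simp
  have f0: "s0 m = s m" if "m \<notin> {mSet, mDeg, mX, mY, mCnt, mCand}" for m unfolding s0_def by (rule PICK_frame[OF that])
  have f1: "s1 m = s m" if "m \<notin> {mSet, mDeg, mX, mY, mCnt, mCand, mV}" for m using f0 that unfolding s1_def by simp
  have f2: "s2 m = s1 m" if "m \<notin> {mSet, mMark, mX, mY, mZ, mTree}" for m unfolding s2_def by (rule TREE_frame[OF that])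
  have f3: "s3 m = s2 m" if "m \<notin> {mSet, mX, mY, mDeg, mCnt}" for m unfolding s3_def by (rule EDGES_frame[OF that])
  have f4: "s4 m = s3 m" if "m \<notin> {mSet, mX, mY, mZ, mMark, mNbr, mBad}" for m unfolding s4_def by (rule PIECE_frame[OF that])
  have g1: "graph_in s1" by (rule graph_in_frame[OF g]) (simp_all add: f1)
  have g2: "graph_in s2" by (rule graph_in_frame[OF g1]) (simp_all add: f2)
  have g3: "graph_in s3" by (rule graph_in_frame[OF g2]) (simp_all add: f3)
  have g4: "graph_in s4" by (rule graph_in_frame[OF g3]) (simp_all add: f4)
  have r: "roles s1 = ?r" "roles s2 = ?r" "roles s3 = ?r" "roles s4 = ?r"
    by (rule roles_cong; simp add: f1 f2 f3 f4)+
  have T: "msel s2 mTree = stree ?r v"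
    using run_TREE[OF g1, of v] v r unfolding s1_def s2_def by simp
  note e = run_EDGES[OF g2, folded s3_def, unfolded T r]
  note p = run_PIECE[OF g3 e(2) refl, folded s4_def, unfolded r]
  have l: "s4 mCnt 0 < 2 \<and> s4 mBad 0 = 0 \<longleftrightarrow> light {x. ?r x = 4} {x. ?r x = 3 \<or> ?r x = 4} (stree ?r v)"
    unfolding light_def using e(1) p f4[of mCnt] by simp
  have V4: "s4 mV 0 = v" using f2[of mV] f3[of mV] f4[of mV] unfolding s1_def by simp
  have T4: "msel s4 mTree = stree ?r v" using T f3[of mTree] f4[of mTree] unfolding msel_def by simp
  have D4: "s4 mDig = s mDig" "s4 mPtr = s mPtr" using f1 f2 f3 f4 by simp_all
  have S: "run STEP s = run ACT s4"
    unfolding STEP_def s4_def s3_def s2_def s1_def s0_def using c[unfolded s0_def]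
    by (simp only: run.simps(2,3,4) eval_expr.simps) simp
  show ?thesis
  proof (cases "light {x. ?r x = 4} {x. ?r x = 3 \<or> ?r x = 4} (stree ?r v)")
    case True
    then have "run ACT s4 = wr mRole v 1 s4" using l V4 by (simp add: ACT_def)
    then have "run STEP s = wr mRole v 1 s4" using S by simp
    moreover have "roles (wr mRole v 1 s4) = (roles s4)(v := 1)" using v unfolding roles_def by auto
    ultimately show ?thesis using True Suc D4 r by (simp add: step_def)
  next
    case False
    define g where "g = s mDig (s mPtr 0)"
    define s5 where "s5 = wr mPtr 0 (Suc (s mPtr 0)) (wr mCnt 0 g s4)"
    have f5: "s5 m = s4 m" if "m \<noteq> mPtr" "m \<noteq> mCnt" for m unfolding s5_def using that by simp
    have g5: "graph_in s5" by (rule graph_in_frame[OF g4]) (simp_all add: f5)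
    define f where "f = run (fill mRole (cell mTree mX) (Const 4)) s5"
    have ff: "f m = s5 m" if "m \<noteq> mRole" "m \<noteq> mX" for m unfolding f_def by (rule fill_frame[OF that])
    have s5: "run (assign mPtr (Add (var mPtr) (Const 1))) (run (assign mCnt (Read mDig (var mPtr))) s4) = s5"
      unfolding s5_def g_def using D4 by simp
    have c5: "s5 mCnt 0 = g" "s5 mV 0 = v" "f mCnt 0 = g" "f mV 0 = v"
      unfolding ff[of mCnt, simplified] ff[of mV, simplified] by (simp_all add: s5_def V4)
    have "\<not> (s4 mCnt 0 < 2 \<and> s4 mBad 0 = 0)" using l False by blast
    then have e0: "eval_expr (And (Sub (Const 2) (var mCnt)) (Not (var mBad))) s4 = 0" by auto
    have "run ACT s4 = run (If (Eq (var mCnt) (Const 0)) (Write mRole (var mV) (Const 2))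
        (Seq (fill mRole (cell mTree mX) (Const 4))
        (If (Eq (var mCnt) (Const 1)) (Write mRole (var mV) (Const 3)) Skip))) s5"
      unfolding ACT_def run.simps(3,4) e0 s5 by simp
    also have "\<dots> = (if g = 0 then wr mRole v 2 s5 else if g = 1 then wr mRole v 3 f else f)"
      by (simp add: c5 f_def[symmetric])
    finally have A: "run ACT s4 = (if g = 0 then wr mRole v 2 s5 else if g = 1 then wr mRole v 3 f else f)" .
    have fr: "f mRole = (\<lambda>u. if u < s5 mN 0 \<and> u \<in> stree ?r v then 4 else s5 mRole u)"
      unfolding f_def
    proof (rule run_fill)
      fix s' u
      assume u: "u < s5 mN 0" and fr: "\<And>m. m \<noteq> mRole \<Longrightarrow> m \<noteq> mX \<Longrightarrow> s' m = s5 m" and x: "s' mX 0 = u"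
      have "s' mTree = s4 mTree" using fr[of mTree] f5[of mTree] by simp
      moreover have "u < n" using u graph_in_N[OF g5] by simp
      ultimately show "(eval_expr (cell mTree mX) s' \<noteq> 0 \<longleftrightarrow> u \<in> stree ?r v) \<and> (u \<in> stree ?r v \<longrightarrow> eval_expr (Const 4) s' = 4)"
        using x T4 unfolding msel_def by auto
    qed simp_all
    have fP: "f mPtr = s5 mPtr" by (rule ff) simp_all
    have "roles s5 = roles s4" by (rule roles_cong) (simp add: f5)
    then have r5: "roles s5 = ?r" using r(4) by simp
    have Tn: "u < n" if "u \<in> stree ?r v" for u using that unfolding T4[symmetric] msel_def by simp
    have "roles (run ACT s4) = move ?r v g"
    proof
      fix u
      have ru: "?r u = (if u < n then s5 mRole u else 5)" using r5 unfolding roles_def by metis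
      show "roles (run ACT s4) u = move ?r v g u"
      proof (cases "u < n")
        case False
        then have "u \<noteq> v" "u \<notin> stree ?r v" using v(2) Tn by blast+
        then show ?thesis using False ru unfolding move_def by (simp add: roles_def)
      next
        case True
        then have "roles (run ACT s4) u = run ACT s4 mRole u" unfolding roles_def by simp
        also have "\<dots> = move ?r v g u"
          unfolding A using True ru graph_in_N[OF g5] by (auto simp: move_def fr)
        finally show ?thesis .
      qed
    qed
    moreover have "run ACT s4 mPtr 0 = Suc (s mPtr 0)" unfolding A by (simp add: fP) (simp add: s5_def)
    ultimately show ?thesis using False Suc S unfolding g_def by (simp add: step_def)
  qed
qed

lemma STEP_frame: "m \<notin> {mRole, mPtr, mSet, mDeg, mX, mY, mZ, mCnt, mCand, mV, mMark, mTree, mNbr, mBad} \<Longrightarrow> run STEP s m = s m"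
  by (rule run_frame) (auto simp: STEP_def PICK_def DEGREES_def TREE_def REACH_def EDGES_def PIECE_def ACT_def)

lemma run_STEPS:
  assumes g: "graph_in s"
  shows "(roles (run (For mW mN STEP) s), run (For mW mN STEP) s mPtr 0) = (step (s mDig) ^^ n) (roles s, s mPtr 0)"
proof -
  define I where "I j t \<longleftrightarrow> (\<forall>m. m \<notin> {mRole, mPtr, mSet, mDeg, mX, mY, mZ, mW, mCnt, mCand, mV, mMark, mTree, mNbr, mBad} \<longrightarrow> t m = s m) \<and>
    (roles t, t mPtr 0) = (step (s mDig) ^^ j) (roles s, s mPtr 0)" for j t
  have "I (s mN 0) (run (For mW mN STEP) s)"
  proof (rule for_invariant)
    show "mW \<notin> writes STEP"
      by (auto simp: STEP_def PICK_def DEGREES_def TREE_def REACH_def EDGES_def PIECE_def ACT_def)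
    have "roles (wr mW 0 0 s) = roles s" by (rule roles_cong) simp
    then show "I 0 (wr mW 0 0 s)" unfolding I_def by simp
    fix j t
    assume j: "j < s mN 0" "I j t" "t mW 0 = j"
    have tm: "t m = s m" if "m \<notin> {mRole, mPtr, mSet, mDeg, mX, mY, mZ, mW, mCnt, mCand, mV, mMark, mTree, mNbr, mBad}" for m
      using j(2) that unfolding I_def by blast
    have gt: "graph_in t" by (rule graph_in_frame[OF g]) (simp_all add: tm)
    have "roles (bump mW (run STEP t)) = roles (run STEP t)" by (rule roles_cong) simp
    then have "(roles (bump mW (run STEP t)), bump mW (run STEP t) mPtr 0) = step (s mDig) (roles t, t mPtr 0)"
      using run_STEP[OF gt] tm[of mDig] by simp
    moreover have "bump mW (run STEP t) m = s m"
      if "m \<notin> {mRole, mPtr, mSet, mDeg, mX, mY, mZ, mW, mCnt, mCand, mV, mMark, mTree, mNbr, mBad}" for m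
      using STEP_frame[of m t] tm[OF that] that by simp
    ultimately show "I (Suc j) (bump mW (run STEP t))" using j(2) unfolding I_def by simp
  qed
  then show ?thesis unfolding I_def graph_in_N[OF g] by blast
qed

end

section \<open>Programs for the compression step\<close>

text \<open>The pointer advances once per vertex that needs a guess, in increasing order, so the
  symbol read at a vertex is the one at its rank \<open>idx\<close>.\<close>

definition GUESS :: cmd where
  "GUESS = Seq (assign mPtr (Const 0))
     (For mX mN (If (Sub (var mX) (var mI)) (Write mRole (var mX) (Const 5))
       (If (Add (Eq (var mX) (var mI)) (Eq (cell mPrev mX) (Const 2)))
         (Seq (Write mRole (var mX) (Add (Read mDig (var mPtr)) (Const 2))) (assign mPtr (Add (var mPtr) (Const 1))))
         (Write mRole (var mX) (Const 0)))))"

definition ATTACH :: cmd where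
  "ATTACH = Seq (fill mSet (Const 1) (And (Not (Eq (cell mRole mX) (Const 2))) (Not (Eq (cell mRole mX) (Const 5)))))
     (Seq (fill mMark (Const 1) (Kept (cell mRole mX))) REACH)"

text \<open>The pointer is not reset, so these symbols follow those of \<open>GUESS\<close>. The
  test for role 0 singles out the present vertices that \<open>GUESS\<close> left open.\<close>

definition REGUESS :: cmd where
  "REGUESS = For mX mN (If (Eq (cell mRole mX) (Const 0))
     (If (cell mMark mX)
       (If (Eq (cell mPrev mX) (Const 3))
         (Seq (Write mRole (var mX) (Add (Read mDig (var mPtr)) (Const 2))) (assign mPtr (Add (var mPtr) (Const 1))))
         Skip)
       (Write mRole (var mX) (cell mPrev mX))) Skip)"

definition ATTEMPT :: cmd where
  "ATTEMPT = Seq GUESS (Seq ATTACH (Seq REGUESS (Seq (For mW mN STEP)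
     (fill mRole (Sub (Const 2) (cell mRole mX)) (Const 4)))))"

lemma idx_0 [simp]: "idx S 0 = 0"
  unfolding idx_def by simp

lemma idx_Suc: "idx S (Suc j) = (if j \<in> S then Suc (idx S j) else idx S j)"
proof -
  have "{u \<in> S. u < Suc j} = (if j \<in> S then insert j {u \<in> S. u < j} else {u \<in> S. u < j})"
    by (auto simp: less_Suc_eq)
  moreover have "finite {u \<in> S. u < j}" by (rule finite_subset[of _ "{..<j}"]) auto
  ultimately show ?thesis unfolding idx_def by simp
qed

lemma idx_all: "S \<subseteq> {..<m} \<Longrightarrow> idx S m = card S"
  unfolding idx_def by (rule arg_cong[where f = card]) auto

context deletion_instance
begin

definition prevs :: "state \<Rightarrow> nat \<Rightarrow> nat \<Rightarrow> nat" where
  "prevs s x v = (if v < x then s mPrev v else 5)"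

lemma GUESS_frame: "m \<notin> {mX, mRole, mPtr} \<Longrightarrow> run GUESS s m = s m"
  by (rule run_frame) (auto simp: GUESS_def)

lemma run_GUESS:
  assumes g: "graph_in s" and x: "s mI 0 = x" "x < n" and P: "P = prevs s x"
    and pr: "\<And>v. v < x \<Longrightarrow> s mPrev v \<in> {2, 3, 4}"
  shows "roles (run GUESS s) = prep P x (guess1 P x (s mDig))"
    "run GUESS s mPtr 0 = card (guessed P x)"
proof -
  let ?Y = "guessed P x" and ?p = "prep P x (guess1 P x (s mDig))"
  let ?b = "If (Sub (var mX) (var mI)) (Write mRole (var mX) (Const 5))
       (If (Add (Eq (var mX) (var mI)) (Eq (cell mPrev mX) (Const 2)))
         (Seq (Write mRole (var mX) (Add (Read mDig (var mPtr)) (Const 2))) (assign mPtr (Add (var mPtr) (Const 1))))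
         (Write mRole (var mX) (Const 0)))"
  have Yx: "v \<in> ?Y \<longleftrightarrow> v = x \<or> v < x \<and> s mPrev v = 2" for v
    unfolding guessed_def P prevs_def by auto
  have pv: "?p v = (if v \<in> ?Y then s mDig (idx ?Y v) + 2 else if v < x then 0 else 5)" for v
    unfolding prep_def guess1_def guessed_def P prevs_def using pr[of v] by auto
  define s0 where "s0 = wr mPtr 0 0 s"
  define I where "I j t \<longleftrightarrow> (\<forall>m. m \<notin> {mX, mRole, mPtr} \<longrightarrow> t m = s m) \<and>
    t mPtr 0 = idx ?Y j \<and> (\<forall>v<j. t mRole v = ?p v)" for j t
  have n0: "s0 mN 0 = n" unfolding s0_def using graph_in_N[OF g] by simp
  have "I (s0 mN 0) (run (For mX mN ?b) s0)"
  proof (rule for_invariant)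
    show "I 0 (wr mX 0 0 s0)" unfolding I_def s0_def by simp
    fix j t
    assume j: "j < s0 mN 0" "I j t" "t mX 0 = j"
    have tm: "t m = s m" if "m \<notin> {mX, mRole, mPtr}" for m using j(2) that unfolding I_def by blast
    have t: "t mI 0 = x" "t mPrev = s mPrev" "t mDig = s mDig" "t mPtr 0 = idx ?Y j" "\<forall>v<j. t mRole v = ?p v"
      using x tm j(2) unfolding I_def by simp_all
    have r: "run ?b t = (if j \<in> ?Y then wr mPtr 0 (Suc (idx ?Y j)) (wr mRole j (?p j) t) else wr mRole j (?p j) t)"
      using t j(3) unfolding pv Yx by auto
    show "I (Suc j) (bump mX (run ?b t))"
      unfolding I_def r idx_Suc using tm t by (auto simp: less_Suc_eq)
  qed simp
  moreover have "run GUESS s = run (For mX mN ?b) s0" unfolding GUESS_def s0_def by (simp only: run.simps(2,3) eval_expr.simps)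
  ultimately have r: "I n (run GUESS s)" unfolding n0 by simp
  show "roles (run GUESS s) = ?p"
  proof
    fix v show "roles (run GUESS s) v = ?p v"
      using r x(2) Yx[of v] unfolding roles_def I_def pv by auto
  qed
  have "?Y \<subseteq> {..<n}" using Yx x(2) by auto
  then show "run GUESS s mPtr 0 = card ?Y" using r idx_all unfolding I_def by simp
qed

lemma ATTACH_frame: "m \<notin> {mX, mY, mZ, mSet, mMark} \<Longrightarrow> run ATTACH s m = s m"
  by (rule run_frame) (auto simp: ATTACH_def REACH_def)

lemma run_ATTACH:
  assumes g: "graph_in s"
  shows "msel (run ATTACH s) mMark = reached (roles s)"
proof -
  define s1 where "s1 = run (fill mSet (Const 1) (And (Not (Eq (cell mRole mX) (Const 2))) (Not (Eq (cell mRole mX) (Const 5))))) s"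
  define s2 where "s2 = run (fill mMark (Const 1) (Kept (cell mRole mX))) s1"
  have f1: "s1 m = s m" if "m \<noteq> mSet" "m \<noteq> mX" for m unfolding s1_def by (rule fill_frame) (use that in simp_all)
  have g1: "graph_in s1" by (rule graph_in_frame[OF g]) (simp_all add: f1)
  have f2: "s2 m = s1 m" if "m \<noteq> mMark" "m \<noteq> mX" for m unfolding s2_def by (rule fill_frame) (use that in simp_all)
  have g2: "graph_in s2" by (rule graph_in_frame[OF g1]) (simp_all add: f2)
  have "msel s1 mSet = {v. v < n \<and> (s mRole v \<noteq> 2 \<and> s mRole v \<noteq> 5)}" unfolding s1_def
    by (rule msel_fill[OF g]) simp_all
  then have S: "msel s2 mSet = {v. roles s v \<noteq> 2 \<and> roles s v \<noteq> 5}"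
    using f2[of mSet] unfolding msel_def roles_def by auto
  have "msel s2 mMark = {v. v < n \<and> (s mRole v = 3 \<or> s mRole v = 4)}" unfolding s2_def
    by (rule msel_fill[OF g1]) (simp_all add: f1)
  then have M: "msel s2 mMark = {v. roles s v = 3 \<or> roles s v = 4}" unfolding roles_def by auto
  have "run ATTACH s = run REACH s2" unfolding ATTACH_def s2_def s1_def by (simp only: run.simps(3))
  moreover have "msel s2 mMark \<subseteq> msel s2 mSet" unfolding M S by auto
  ultimately show ?thesis using run_REACH[OF g2] unfolding M S reached_def by auto
qed

lemma REGUESS_frame: "m \<notin> {mX, mRole, mPtr} \<Longrightarrow> run REGUESS s m = s m"
  by (rule run_frame) (auto simp: REGUESS_def)

lemma run_REGUESS:
  assumes g: "graph_in s" and x: "x < n" and P: "P = prevs s x"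
    and pr: "\<And>v. v < x \<Longrightarrow> s mPrev v \<in> {2, 3, 4}"
    and r: "roles s = prep P x (guess1 P x (s mDig))" and ptr: "s mPtr 0 = card (guessed P x)"
    and mark: "msel s mMark = reached (roles s)"
  shows "roles (run REGUESS s) = start P x (guess P x (s mDig))"
    "run REGUESS s mPtr 0 = card (guessed P x) + card (reguessed P x (s mDig))"
proof -
  let ?Y = "guessed P x" and ?M = "reguessed P x (s mDig)" and ?p = "prep P x (guess1 P x (s mDig))"
    and ?q = "start P x (guess P x (s mDig))"
  let ?b = "If (Eq (cell mRole mX) (Const 0))
     (If (cell mMark mX)
       (If (Eq (cell mPrev mX) (Const 3))
         (Seq (Write mRole (var mX) (Add (Read mDig (var mPtr)) (Const 2))) (assign mPtr (Add (var mPtr) (Const 1))))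
         Skip)
       (Write mRole (var mX) (cell mPrev mX))) Skip"
  have Px: "P v = 5 \<longleftrightarrow> \<not> v < x" "v < x \<Longrightarrow> P v = s mPrev v" for v unfolding P prevs_def using pr[of v] by auto
  have Yx: "v \<in> ?Y \<longleftrightarrow> v = x \<or> P v = 2" for v unfolding guessed_def by auto
  have pc: "prep P x (guess P x (s mDig)) = ?p" by (rule prep_cong) (simp add: guess_def)
  have p0: "?p v = 0 \<longleftrightarrow> v < x \<and> v \<notin> ?Y" for v
    unfolding prep_def guess1_def Yx using Px(1)[of v] by auto
  have Mx: "v \<in> ?M \<longleftrightarrow> v < x \<and> v \<notin> ?Y \<and> P v = 3 \<and> v \<in> msel s mMark" for v
    unfolding reguessed_def mark r Yx using Px(1)[of v] by auto
  have qv: "?q v = (if ?p v = 0 then if v \<in> msel s mMark then if P v = 3 then s mDig (card ?Y + idx ?M v) + 2 else 0 else P v else ?p v)" for v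
  proof (cases "?p v = 0")
    case True
    then have "v < x" "v \<notin> ?Y" using p0 by blast+
    moreover from this have "\<not> (v = x \<or> P v = 2 \<or> P v = 5)" using Yx Px(1) by auto
    ultimately show ?thesis using True unfolding start_def pc mark r guess_def by auto
  next
    case False
    then have "v = x \<or> P v = 2 \<or> P v = 5" using p0 Yx Px(1) by auto
    then show ?thesis using False unfolding start_def pc by auto
  qed
  define I where "I j t \<longleftrightarrow> (\<forall>m. m \<notin> {mX, mRole, mPtr} \<longrightarrow> t m = s m) \<and>
    t mPtr 0 = card ?Y + idx ?M j \<and> (\<forall>v<j. t mRole v = ?q v) \<and> (\<forall>v\<ge>j. t mRole v = s mRole v)" for j t
  have "I (s mN 0) (run REGUESS s)" unfolding REGUESS_def
  proof (rule for_invariant)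
    show "I 0 (wr mX 0 0 s)" unfolding I_def using ptr by simp
    fix j t
    assume j: "j < s mN 0" "I j t" "t mX 0 = j"
    have tm: "t m = s m" if "m \<notin> {mX, mRole, mPtr}" for m using j(2) that unfolding I_def by blast
    have jn: "j < n" using j(1) graph_in_N[OF g] by simp
    have "s mRole j = ?p j" using r jn unfolding roles_def fun_eq_iff by metis
    then have t: "t mMark = s mMark" "t mPrev = s mPrev" "t mDig = s mDig" "t mPtr 0 = card ?Y + idx ?M j" "\<forall>v<j. t mRole v = ?q v"
        "\<forall>v\<ge>j. t mRole v = s mRole v" "t mRole j = ?p j"
      using tm j(2) unfolding I_def by simp_all
    have mk: "j \<in> msel s mMark \<longleftrightarrow> s mMark j \<noteq> 0" using jn unfolding msel_def by simp
    have same: "wr mRole j (t mRole j) t = t" unfolding wr_def by simp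
    have b: "run ?b t = (if j \<in> ?M then wr mPtr 0 (Suc (card ?Y + idx ?M j)) (wr mRole j (?q j) t) else wr mRole j (?q j) t)"
    proof (cases "?p j = 0")
      case True
      then have jx: "j < x" "j \<notin> ?Y" using p0 by blast+
      show ?thesis using True t j(3) mk jx Px(2)[of j] same unfolding qv Mx by auto
    next
      case False
      then have "\<not> (j < x \<and> j \<notin> ?Y)" using p0[of j] by simp
      then have jM: "j \<notin> ?M" using Mx[of j] by simp
      have qj: "?q j = ?p j" using False qv[of j] by simp
      have "run ?b t = t" using False t(7) j(3) by simp
      then show ?thesis using same jM unfolding qj t(7) by simp
    qed
    show "I (Suc j) (bump mX (run ?b t))"
      unfolding I_def b idx_Suc using tm t by (auto simp: less_Suc_eq)
  qed simp
  then have R: "I n (run REGUESS s)" using graph_in_N[OF g] by simp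
  show "roles (run REGUESS s) = ?q"
  proof
    fix v
    have "?q v = 5" if "\<not> v < n"
    proof -
      have "?p v \<noteq> 0" using p0 that x by auto
      moreover have "?p v = 5" using that r unfolding roles_def fun_eq_iff by metis
      ultimately show ?thesis unfolding qv by simp
    qed
    then show "roles (run REGUESS s) v = ?q v" using R unfolding roles_def I_def by auto
  qed
  have "?M \<subseteq> {..<n}"
  proof
    fix v assume "v \<in> ?M"
    then have "v < x" using Mx[of v] by simp
    then show "v \<in> {..<n}" using x by simp
  qed
  then show "run REGUESS s mPtr 0 = card ?Y + card ?M" using R idx_all unfolding I_def by simp
qed

lemma STEPS_frame: "m \<notin> {mRole, mPtr, mSet, mDeg, mX, mY, mZ, mW, mCnt, mCand, mV, mMark, mTree, mNbr, mBad} \<Longrightarrow>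
    run (For mW mN STEP) s m = s m"
  by (rule run_frame) (auto simp: STEP_def PICK_def DEGREES_def TREE_def REACH_def EDGES_def PIECE_def ACT_def)

lemma ATTEMPT_frame: "m \<notin> {mRole, mPtr, mSet, mDeg, mX, mY, mZ, mW, mCnt, mCand, mV, mMark, mTree, mNbr, mBad} \<Longrightarrow>
    run ATTEMPT s m = s m"
  by (rule run_frame) (auto simp: ATTEMPT_def GUESS_def ATTACH_def REGUESS_def STEP_def PICK_def DEGREES_def TREE_def REACH_def EDGES_def PIECE_def ACT_def)

lemma run_ATTEMPT:
  assumes g: "graph_in s" and x: "s mI 0 = x" "x < n" and P: "P = prevs s x"
    and pr: "\<And>v. v < x \<Longrightarrow> s mPrev v \<in> {2, 3, 4}"
  shows "roles (run ATTEMPT s) = attempt P x (s mDig)"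
proof -
  define s1 where "s1 = run GUESS s"
  define s2 where "s2 = run ATTACH s1"
  define s3 where "s3 = run REGUESS s2"
  define s4 where "s4 = run (For mW mN STEP) s3"
  let ?f = "fill mRole (Sub (Const 2) (cell mRole mX)) (Const 4)"
  have f1: "s1 m = s m" if "m \<notin> {mX, mRole, mPtr}" for m unfolding s1_def by (rule GUESS_frame[OF that])
  have f2: "s2 m = s1 m" if "m \<notin> {mX, mY, mZ, mSet, mMark}" for m unfolding s2_def by (rule ATTACH_frame[OF that])
  have f3: "s3 m = s2 m" if "m \<notin> {mX, mRole, mPtr}" for m unfolding s3_def by (rule REGUESS_frame[OF that])
  have f4: "s4 m = s3 m" if "m \<notin> {mRole, mPtr, mSet, mDeg, mX, mY, mZ, mW, mCnt, mCand, mV, mMark, mTree, mNbr, mBad}" for m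
    unfolding s4_def by (rule STEPS_frame[OF that])
  have g1: "graph_in s1" by (rule graph_in_frame[OF g]) (simp_all add: f1)
  have g2: "graph_in s2" by (rule graph_in_frame[OF g1]) (simp_all add: f2)
  have g3: "graph_in s3" by (rule graph_in_frame[OF g2]) (simp_all add: f3)
  have g4: "graph_in s4" by (rule graph_in_frame[OF g3]) (simp_all add: f4)
  have d: "s2 mDig = s mDig" "s3 mDig = s mDig" "s2 mPrev = s mPrev" using f1 f2 f3 by simp_all
  have r2: "roles s2 = roles s1" by (rule roles_cong) (simp add: f2)
  have P2: "P = prevs s2 x" unfolding P prevs_def d by simp
  note G = run_GUESS[OF g x P pr, folded s1_def]
  have "msel s2 mMark = reached (roles s1)" unfolding s2_def by (rule run_ATTACH[OF g1])
  then have m2: "msel s2 mMark = reached (roles s2)" unfolding r2 .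
  have R3: "roles s3 = start P x (guess P x (s mDig))" "s3 mPtr 0 = card (guessed P x) + card (reguessed P x (s mDig))"
    using run_REGUESS[OF g2 x(2) P2 _ _ _ m2] pr G f2[of mPtr] r2 d unfolding s3_def[symmetric] by simp_all
  have R4: "roles s4 = fst ((step (s mDig) ^^ n) (start P x (guess P x (s mDig)), card (guessed P x) + card (reguessed P x (s mDig))))"
    using run_STEPS[OF g3] unfolding s4_def[symmetric] R3 d by (metis fst_conv)
  have A: "run ATTEMPT s = run ?f s4"
    unfolding ATTEMPT_def s4_def s3_def s2_def s1_def by (simp only: run.simps(3))
  have fr: "run ?f s4 mRole = (\<lambda>v. if v < s4 mN 0 \<and> s4 mRole v \<le> 1 then 4 else s4 mRole v)"
    by (rule run_fill) auto
  show ?thesis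
  proof
    fix v
    have "roles (run ATTEMPT s) v = (if roles s4 v \<le> 1 then 4 else roles s4 v)"
      unfolding A roles_def fr graph_in_N[OF g4] by auto
    moreover have "attempt P x (s mDig) v = (if roles s4 v \<le> 1 then 4 else roles s4 v)"
      unfolding attempt_def R4 Let_def by (rule refl)
    ultimately show "roles (run ATTEMPT s) v = attempt P x (s mDig) v" by (rule trans[OF _ sym])
  qed
qed

end

section \<open>Programs for checking a solution\<close>

definition SIZES :: cmd where
  "SIZES = Seq (assign mPrice (Const 0)) (Seq (assign mCnt (Const 0)) (Seq (assign mBad (Const 0))
     (Seq (add_all mCnt (Eq (cell mRole mX) (Const 2)) (Const 1))
     (Seq (add_all mPrice (Eq (cell mRole mX) (Const 2)) (Add (var mN) (Const 1)))
     (Seq (add_all mPrice (Eq (cell mRole mX) (Const 3)) (Const 1))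
     (If (Sub (var mCnt) (var mK)) (assign mBad (Const 1)) Skip))))))"

text \<open>In each round all low vertices are removed at once. A nonempty forest loses a vertex
  each time and is gone after \<open>n\<close> rounds, while a set that is not a forest never
  becomes one.\<close>

definition ACYCLIC :: cmd where
  "ACYCLIC = Seq (fill mSet (Const 1) (Eq (cell mRole mX) (Const 4)))
     (Seq (For mZ mN (Seq DEGREES (fill mSet (Const 1) (And (cell mSet mX) (Sub (cell mDeg mX) (Const 1))))))
     (add_all mBad (cell mSet mX) (Const 1)))"

definition COMPONENT :: cmd where
  "COMPONENT = Seq (fill mSet (Const 1) (Kept (cell mRole mX)))
     (Seq (fill mMark (Const 1) (Eq (var mX) (var mW)))
     (Seq REACH
     (Seq (assign mCnt (Const 0))
     (Seq (add_all mCnt (And (cell mMark mX) (Eq (cell mRole mX) (Const 3))) (Const 1))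
     (If (Sub (var mCnt) (var mD)) (assign mBad (Const 1)) Skip)))))"

definition COMPONENTS :: cmd where
  "COMPONENTS = For mW mN (If (Kept (cell mRole mW)) COMPONENT Skip)"

definition CHECK :: cmd where
  "CHECK = Seq SIZES (Seq ACYCLIC COMPONENTS)"

context ugraph
begin

text \<open>A subset that contains a low vertex of \<open>S\<close> has a low vertex of its own; any
  other subset survives the stripping.\<close>

lemma acyc_strip: "acyc {v \<in> S. \<not> low S v} \<longleftrightarrow> acyc S"
proof
  assume a: "acyc {v \<in> S. \<not> low S v}"
  show "acyc S" unfolding acyc_def
  proof (intro allI impI)
    fix T assume T: "T \<subseteq> S" "T \<noteq> {}"
    show "\<exists>v\<in>T. low T v"
    proof (cases "\<exists>v\<in>T. low S v")
      case True
      then show ?thesis using low_mono T by blast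
    next
      case False
      then have "T \<subseteq> {v \<in> S. \<not> low S v}" using T by blast
      then show ?thesis using a T unfolding acyc_def by blast
    qed
  qed
qed (rule acyc_mono, auto)

lemma card_strip:
  assumes "acyc S" "finite S" "card S \<le> m"
  shows "card {v \<in> S. \<not> low S v} \<le> m - 1"
proof (cases "S = {}")
  case False
  then obtain v where v: "v \<in> S" "low S v" using assms(1) unfolding acyc_def by blast
  have "card {v \<in> S. \<not> low S v} < card S" using v assms(2) by (intro psubset_card_mono) auto
  then show ?thesis using assms(3) by linarith
qed simp

end

context deletion_instance
begin

lemma run_count:
  assumes "graph_in s" "a \<noteq> mX" "a \<noteq> mN"
    and "\<And>s' v. v < n \<Longrightarrow> (\<And>m. m \<noteq> a \<Longrightarrow> m \<noteq> mX \<Longrightarrow> s' m = s m) \<Longrightarrow> s' mX 0 = v \<Longrightarrow>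
      (eval_expr g s' \<noteq> 0 \<longleftrightarrow> P v) \<and> eval_expr e s' = c"
  shows "run (add_all a g e) s a 0 = s a 0 + c * card {v. v < n \<and> P v}"
proof -
  have "run (add_all a g e) s a 0 = s a 0 + (\<Sum>v<s mN 0. if P v then c else 0)"
    by (rule run_sum) (use assms graph_in_N in auto)
  also have "(\<Sum>v<s mN 0. if P v then c else 0) = c * card {v. v < n \<and> P v}"
    unfolding graph_in_N[OF assms(1)] sum_if_eq by simp
  finally show ?thesis .
qed

lemma SIZES_frame: "m \<notin> {mX, mPrice, mCnt, mBad} \<Longrightarrow> run SIZES s m = s m"
  by (rule run_frame) (auto simp: SIZES_def)

lemma run_SIZES:
  assumes g: "graph_in s" and k: "s mK 0 = k"
  shows "run SIZES s mPrice 0 = price (roles s)"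
    "run SIZES s mBad 0 = 0 \<longleftrightarrow> card {v. roles s v = 2} \<le> k"
proof -
  define s0 where "s0 = wr mBad 0 0 (wr mCnt 0 0 (wr mPrice 0 0 s))"
  define s1 where "s1 = run (add_all mCnt (Eq (cell mRole mX) (Const 2)) (Const 1)) s0"
  define s2 where "s2 = run (add_all mPrice (Eq (cell mRole mX) (Const 2)) (Add (var mN) (Const 1))) s1"
  define s3 where "s3 = run (add_all mPrice (Eq (cell mRole mX) (Const 3)) (Const 1)) s2"
  have f0: "s0 m = s m" if "m \<notin> {mBad, mCnt, mPrice}" for m using that unfolding s0_def by simp
  have g0: "graph_in s0" by (rule graph_in_frame[OF g]) (simp_all add: f0)
  have f1: "s1 m = s0 m" if "m \<noteq> mCnt" "m \<noteq> mX" for m unfolding s1_def by (rule add_all_frame[OF that])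
  have g1: "graph_in s1" by (rule graph_in_frame[OF g0]) (simp_all add: f1)
  have f2: "s2 m = s1 m" if "m \<noteq> mPrice" "m \<noteq> mX" for m unfolding s2_def by (rule add_all_frame[OF that])
  have g2: "graph_in s2" by (rule graph_in_frame[OF g1]) (simp_all add: f2)
  have f3: "s3 m = s2 m" if "m \<noteq> mPrice" "m \<noteq> mX" for m unfolding s3_def by (rule add_all_frame[OF that])
  have role: "s0 mRole = s mRole" "s1 mRole = s mRole" "s2 mRole = s mRole" using f0 f1 f2 by simp_all
  have N: "s1 mN 0 = n" by (rule graph_in_N[OF g1])
  have "s1 mCnt 0 = s0 mCnt 0 + 1 * card {v. v < n \<and> s mRole v = 2}" unfolding s1_def
    by (rule run_count[OF g0]) (simp_all add: role)
  then have c: "s3 mCnt 0 = card {v. roles s v = 2}"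
    unfolding roles_sets using f2[of mCnt] f3[of mCnt] by (simp add: s0_def)
  have "s2 mPrice 0 = s1 mPrice 0 + Suc n * card {v. v < n \<and> s mRole v = 2}" unfolding s2_def
    by (rule run_count[OF g1]) (simp_all add: role N)
  moreover have "s3 mPrice 0 = s2 mPrice 0 + 1 * card {v. v < n \<and> s mRole v = 3}" unfolding s3_def
    by (rule run_count[OF g2]) (simp_all add: role)
  ultimately have p: "s3 mPrice 0 = price (roles s)"
    unfolding price_def roles_sets using f1[of mPrice] by (simp add: s0_def)
  have b: "s3 mBad 0 = 0" using f1[of mBad] f2[of mBad] f3[of mBad] by (simp add: s0_def)
  have K: "s3 mK 0 = k" using f0[of mK] f1[of mK] f2[of mK] f3[of mK] k by simp
  have "run SIZES s = run (If (Sub (var mCnt) (var mK)) (assign mBad (Const 1)) Skip) s3"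
    unfolding SIZES_def s3_def s2_def s1_def s0_def by (simp only: run.simps(2,3) eval_expr.simps)
  also have "\<dots> = (if card {v. roles s v = 2} \<le> k then s3 else wr mBad 0 1 s3)"
    using c K by simp
  finally show "run SIZES s mPrice 0 = price (roles s)" "run SIZES s mBad 0 = 0 \<longleftrightarrow> card {v. roles s v = 2} \<le> k"
    using p b by simp_all
qed

lemma ACYCLIC_frame: "m \<notin> {mX, mY, mZ, mSet, mDeg, mCnt, mBad} \<Longrightarrow> run ACYCLIC s m = s m"
  by (rule run_frame) (auto simp: ACYCLIC_def DEGREES_def)

lemma run_ACYCLIC:
  assumes g: "graph_in s"
  shows "run ACYCLIC s mBad 0 = 0 \<longleftrightarrow> s mBad 0 = 0 \<and> acyc {v. roles s v = 4}"
proof -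
  let ?b = "Seq DEGREES (fill mSet (Const 1) (And (cell mSet mX) (Sub (cell mDeg mX) (Const 1))))"
  let ?W = "{v. roles s v = 4}"
  define s1 where "s1 = run (fill mSet (Const 1) (Eq (cell mRole mX) (Const 4))) s"
  define s2 where "s2 = run (For mZ mN ?b) s1"
  have f1: "s1 m = s m" if "m \<noteq> mSet" "m \<noteq> mX" for m unfolding s1_def by (rule fill_frame) (use that in simp_all)
  have g1: "graph_in s1" by (rule graph_in_frame[OF g]) (simp_all add: f1)
  have f2: "s2 m = s1 m" if "m \<notin> {mX, mY, mZ, mSet, mDeg, mCnt}" for m
    unfolding s2_def by (rule run_frame) (use that in \<open>auto simp: DEGREES_def\<close>)
  have g2: "graph_in s2" by (rule graph_in_frame[OF g1]) (simp_all add: f2)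
  have W: "msel s1 mSet = ?W" unfolding s1_def roles_sets by (rule msel_fill[OF g]) simp_all
  define I where "I j t \<longleftrightarrow> (\<forall>m. m \<notin> {mX, mY, mZ, mSet, mDeg, mCnt} \<longrightarrow> t m = s1 m) \<and>
    (acyc (msel t mSet) \<longleftrightarrow> acyc ?W) \<and> (acyc ?W \<longrightarrow> card (msel t mSet) \<le> n - j)" for j t
  have fin: "finite (msel t a)" for t a unfolding msel_def by simp
  have "I (s1 mN 0) s2" unfolding s2_def
  proof (rule for_invariant)
    show "mZ \<notin> writes ?b" by (auto simp: DEGREES_def)
    have "msel (wr mZ 0 0 s1) mSet = ?W" using W unfolding msel_def by simp
    moreover have "card ?W \<le> n" using card_mono[of "{..<n}" ?W] unfolding roles_sets by auto
    ultimately show "I 0 (wr mZ 0 0 s1)" unfolding I_def by simp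
    fix j t
    assume j: "j < s1 mN 0" "I j t" "t mZ 0 = j"
    have tm: "t m = s1 m" if "m \<notin> {mX, mY, mZ, mSet, mDeg, mCnt}" for m using j(2) that unfolding I_def by blast
    have gt: "graph_in t" by (rule graph_in_frame[OF g1]) (simp_all add: tm)
    define t1 where "t1 = run DEGREES t"
    have ft: "t1 m = t m" if "m \<notin> {mDeg, mX, mY, mCnt}" for m unfolding t1_def by (rule DEGREES_frame[OF that])
    have gt1: "graph_in t1" by (rule graph_in_frame[OF gt]) (simp_all add: ft)
    have deg: "t1 mDeg v \<le> 1 \<longleftrightarrow> low (msel t mSet) v" if "v < n" for v
      using run_DEGREES[OF gt that] low_iff_card[OF fin, of t mSet v] unfolding t1_def by auto
    define t2 where "t2 = run (fill mSet (Const 1) (And (cell mSet mX) (Sub (cell mDeg mX) (Const 1)))) t1"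
    have "msel t2 mSet = {v. v < n \<and> (t1 mSet v \<noteq> 0 \<and> \<not> t1 mDeg v \<le> 1)}" unfolding t2_def
      by (rule msel_fill[OF gt1]) auto
    also have "\<dots> = {v \<in> msel t mSet. \<not> low (msel t mSet) v}"
      using deg ft[of mSet] unfolding msel_def by auto
    finally have m2: "msel t2 mSet = {v \<in> msel t mSet. \<not> low (msel t mSet) v}" .
    have m3: "msel (bump mZ t2) mSet = msel t2 mSet" unfolding msel_def by simp
    have fr: "bump mZ t2 m = s1 m" if h: "m \<notin> {mX, mY, mZ, mSet, mDeg, mCnt}" for m
    proof -
      have "t2 m = t1 m" unfolding t2_def by (rule fill_frame) (use h in simp_all)
      moreover have "t1 m = t m" by (rule ft) (use h in simp)
      ultimately show ?thesis using tm[OF h] h by simp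
    qed
    have "I (Suc j) (bump mZ t2)" unfolding I_def m3 m2 acyc_strip
    proof (intro conjI impI allI)
      show "acyc (msel t mSet) \<longleftrightarrow> acyc ?W" using j(2) unfolding I_def by (elim conjE)
      assume "acyc ?W"
      then have "acyc (msel t mSet)" "card (msel t mSet) \<le> n - j" using j(2) unfolding I_def by simp_all
      from card_strip[OF this(1) fin this(2)]
      show "card {v \<in> msel t mSet. \<not> low (msel t mSet) v} \<le> n - Suc j" by simp
    qed (rule fr)
    then show "I (Suc j) (bump mZ (run ?b t))" unfolding t2_def t1_def by simp
  qed
  then have I: "I n s2" using graph_in_N[OF g1] by simp
  have e: "msel s2 mSet = {} \<longleftrightarrow> acyc ?W"
  proof
    assume "msel s2 mSet = {}"
    then have "acyc (msel s2 mSet)" unfolding acyc_def by blast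
    then show "acyc ?W" using I unfolding I_def by simp
  next
    assume "acyc ?W"
    then have "card (msel s2 mSet) = 0" using I unfolding I_def by simp
    then show "msel s2 mSet = {}" using fin by simp
  qed
  have "run (add_all mBad (cell mSet mX) (Const 1)) s2 mBad 0 = s2 mBad 0 + 1 * card {v. v < n \<and> s2 mSet v \<noteq> 0}"
    by (rule run_count[OF g2]) simp_all
  moreover have "run ACYCLIC s = run (add_all mBad (cell mSet mX) (Const 1)) s2"
    unfolding ACYCLIC_def s2_def s1_def by (simp only: run.simps(3))
  moreover have "s2 mBad = s mBad" using f1[of mBad] f2[of mBad] by simp
  moreover have "card {v. v < n \<and> s2 mSet v \<noteq> 0} = 0 \<longleftrightarrow> acyc ?W"
    using e fin[of s2 mSet] unfolding msel_def by simp
  ultimately show ?thesis by simp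
qed

lemma run_COMPONENT:
  assumes g: "graph_in s" and d: "s mD 0 = d" and w: "s mW 0 = w" "w \<in> K"
    and K: "K = {v. roles s v = 3 \<or> roles s v = 4}"
  shows "run COMPONENT s mBad 0 = 0 \<longleftrightarrow> s mBad 0 = 0 \<and> card ({v. roles s v = 3} \<inter> comp K w) \<le> d"
proof -
  define s1 where "s1 = run (fill mSet (Const 1) (Kept (cell mRole mX))) s"
  define s2 where "s2 = run (fill mMark (Const 1) (Eq (var mX) (var mW))) s1"
  define s3 where "s3 = run REACH s2"
  define s4 where "s4 = wr mCnt 0 0 s3"
  define s5 where "s5 = run (add_all mCnt (And (cell mMark mX) (Eq (cell mRole mX) (Const 3))) (Const 1)) s4"
  have f1: "s1 m = s m" if "m \<noteq> mSet" "m \<noteq> mX" for m unfolding s1_def by (rule fill_frame) (use that in simp_all)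
  have g1: "graph_in s1" by (rule graph_in_frame[OF g]) (simp_all add: f1)
  have f2: "s2 m = s1 m" if "m \<noteq> mMark" "m \<noteq> mX" for m unfolding s2_def by (rule fill_frame) (use that in simp_all)
  have g2: "graph_in s2" by (rule graph_in_frame[OF g1]) (simp_all add: f2)
  have f3: "s3 m = s2 m" if "m \<notin> {mMark, mX, mY, mZ}" for m unfolding s3_def by (rule REACH_frame[OF that])
  have f4: "s4 m = s3 m" if "m \<noteq> mCnt" for m unfolding s4_def using that by simp
  have g4: "graph_in s4" by (rule graph_in_frame[OF g2]) (simp_all add: f3 f4)
  have f5: "s5 m = s4 m" if "m \<noteq> mCnt" "m \<noteq> mX" for m unfolding s5_def by (rule add_all_frame[OF that])
  have fr: "s5 m = s m" if "m \<notin> {mX, mY, mZ, mSet, mMark, mCnt}" for m using f1 f2 f3 f4 f5 that by simp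
  have wn: "w < n" using w(2) unfolding K roles_sets by simp
  have "msel s1 mSet = K" unfolding s1_def K roles_sets by (rule msel_fill[OF g]) simp_all
  then have S: "msel s2 mSet = K" using f2[of mSet] unfolding msel_def by simp
  have "msel s2 mMark = {v. v < n \<and> v = w}" unfolding s2_def
    by (rule msel_fill[OF g1]) (simp_all add: f1 w)
  then have M: "msel s2 mMark = {w}" using wn by auto
  have mk: "msel s3 mMark = comp K w" unfolding s3_def
    using run_REACH[OF g2] w(2) unfolding M S comp_def by simp
  have R: "s4 mMark v \<noteq> 0 \<longleftrightarrow> conn K w v" if "v < n" for v
  proof -
    have "s4 mMark v \<noteq> 0 \<longleftrightarrow> v \<in> msel s3 mMark" using that f4[of mMark] by (simp add: msel_def)
    then show ?thesis unfolding mk by simp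
  qed
  have role: "s4 mRole = s mRole" using f1[of mRole] f2[of mRole] f3[of mRole] f4[of mRole] by simp
  have "s5 mCnt 0 = s4 mCnt 0 + 1 * card {v. v < n \<and> (v \<in> comp K w \<and> s mRole v = 3)}" unfolding s5_def
  proof (rule run_count[OF g4])
    fix s' v
    assume v: "v < n" and fr': "\<And>m. m \<noteq> mCnt \<Longrightarrow> m \<noteq> mX \<Longrightarrow> s' m = s4 m" and x: "s' mX 0 = v"
    have "s' mMark = s4 mMark" "s' mRole = s mRole" using fr'[of mMark] fr'[of mRole] role by simp_all
    then show "(eval_expr (And (cell mMark mX) (Eq (cell mRole mX) (Const 3))) s' \<noteq> 0 \<longleftrightarrow> v \<in> comp K w \<and> s mRole v = 3) \<and>
        eval_expr (Const 1) s' = 1"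
      using R[OF v] x by simp
  qed simp_all
  also have "{v. v < n \<and> (v \<in> comp K w \<and> s mRole v = 3)} = {v. roles s v = 3} \<inter> comp K w"
    unfolding roles_sets by auto
  finally have c: "s5 mCnt 0 = card ({v. roles s v = 3} \<inter> comp K w)" by (simp add: s4_def)
  have "run COMPONENT s = run (If (Sub (var mCnt) (var mD)) (assign mBad (Const 1)) Skip) s5"
    unfolding COMPONENT_def s5_def s4_def s3_def s2_def s1_def by (simp only: run.simps(2,3) eval_expr.simps)
  also have "\<dots> = (if card ({v. roles s v = 3} \<inter> comp K w) \<le> d then s5 else wr mBad 0 1 s5)"
    using c fr[of mD] d by simp
  finally show ?thesis using fr[of mBad] by simp
qed

lemma COMPONENTS_frame: "m \<notin> {mX, mY, mZ, mW, mSet, mMark, mCnt, mBad} \<Longrightarrow> run COMPONENTS s m = s m"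
  by (rule run_frame) (auto simp: COMPONENTS_def COMPONENT_def REACH_def)

lemma run_COMPONENTS:
  assumes g: "graph_in s" and d: "s mD 0 = d" and K: "K = {v. roles s v = 3 \<or> roles s v = 4}"
  shows "run COMPONENTS s mBad 0 = 0 \<longleftrightarrow> s mBad 0 = 0 \<and> (\<forall>w\<in>K. card ({v. roles s v = 3} \<inter> comp K w) \<le> d)"
proof -
  let ?b = "If (Kept (cell mRole mW)) COMPONENT Skip"
  define I where "I j t \<longleftrightarrow> (\<forall>m. m \<notin> {mX, mY, mZ, mW, mSet, mMark, mCnt, mBad} \<longrightarrow> t m = s m) \<and>
    (t mBad 0 = 0 \<longleftrightarrow> s mBad 0 = 0 \<and> (\<forall>w<j. w \<in> K \<longrightarrow> card ({v. roles s v = 3} \<inter> comp K w) \<le> d))" for j t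
  have "I (s mN 0) (run COMPONENTS s)" unfolding COMPONENTS_def
  proof (rule for_invariant)
    show "mW \<notin> writes ?b" by (auto simp: COMPONENT_def REACH_def)
    show "I 0 (wr mW 0 0 s)" unfolding I_def by simp
    fix j t
    assume j: "j < s mN 0" "I j t" "t mW 0 = j"
    have tm: "t m = s m" if "m \<notin> {mX, mY, mZ, mW, mSet, mMark, mCnt, mBad}" for m using j(2) that unfolding I_def by blast
    have gt: "graph_in t" by (rule graph_in_frame[OF g]) (simp_all add: tm)
    have rt: "roles t = roles s" by (rule roles_cong) (simp add: tm)
    have jn: "j < n" using j(1) graph_in_N[OF g] by simp
    have jK: "eval_expr (Kept (cell mRole mW)) t \<noteq> 0 \<longleftrightarrow> j \<in> K"
      unfolding K roles_sets using jn j(3) tm[of mRole] by simp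
    have fr: "run ?b t m = t m" if "m \<notin> {mX, mY, mZ, mW, mSet, mMark, mCnt, mBad}" for m
      by (rule run_frame) (use that in \<open>auto simp: COMPONENT_def REACH_def\<close>)
    have "run ?b t mBad 0 = 0 \<longleftrightarrow> t mBad 0 = 0 \<and> (j \<in> K \<longrightarrow> card ({v. roles s v = 3} \<inter> comp K j) \<le> d)"
    proof (cases "j \<in> K")
      case True
      then have "run ?b t = run COMPONENT t" using jK by (simp only: run.simps(4) if_True simp_thms)
      moreover have "t mD 0 = d" using tm[of mD] d by simp
      ultimately show ?thesis using run_COMPONENT[OF gt _ j(3) True] True unfolding rt K by simp
    next
      case False
      then have "run ?b t = t" using jK by (simp only: run.simps(1,4) if_False simp_thms)
      then show ?thesis using False by simp
    qed
    then have "run ?b t mBad 0 = 0 \<longleftrightarrow> s mBad 0 = 0 \<and> (\<forall>w<Suc j. w \<in> K \<longrightarrow> card ({v. roles s v = 3} \<inter> comp K w) \<le> d)"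
      using j(2) unfolding I_def less_Suc_eq by blast
    moreover have "bump mW (run ?b t) m = s m" if "m \<notin> {mX, mY, mZ, mW, mSet, mMark, mCnt, mBad}" for m
      using fr[OF that] tm[OF that] that by simp
    moreover have "bump mW (run ?b t) mBad = run ?b t mBad" by (rule bump_other) simp
    ultimately show "I (Suc j) (bump mW (run ?b t))" unfolding I_def by (simp del: run.simps)
  qed
  then have r: "I n (run COMPONENTS s)" using graph_in_N[OF g] by simp
  have "(\<forall>w<n. w \<in> K \<longrightarrow> card ({v. roles s v = 3} \<inter> comp K w) \<le> d) \<longleftrightarrow> (\<forall>w\<in>K. card ({v. roles s v = 3} \<inter> comp K w) \<le> d)"
    unfolding K roles_sets by blast
  then show ?thesis using r unfolding I_def by blast
qed

lemma CHECK_frame: "m \<notin> {mX, mY, mZ, mW, mSet, mMark, mDeg, mCnt, mBad, mPrice} \<Longrightarrow> run CHECK s m = s m"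
  by (rule run_frame) (auto simp: CHECK_def SIZES_def ACYCLIC_def COMPONENTS_def COMPONENT_def REACH_def DEGREES_def)

lemma run_CHECK:
  assumes g: "graph_in s" and kd: "s mK 0 = k" "s mD 0 = d" and r: "\<And>v. roles s v \<in> {2, 3, 4, 5}"
  shows "run CHECK s mBad 0 = 0 \<longleftrightarrow> valid (roles s)" "run CHECK s mPrice 0 = price (roles s)"
proof -
  define s1 where "s1 = run SIZES s"
  define s2 where "s2 = run ACYCLIC s1"
  have f1: "s1 m = s m" if "m \<notin> {mX, mPrice, mCnt, mBad}" for m unfolding s1_def by (rule SIZES_frame[OF that])
  have f2: "s2 m = s1 m" if "m \<notin> {mX, mY, mZ, mSet, mDeg, mCnt, mBad}" for m unfolding s2_def by (rule ACYCLIC_frame[OF that])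
  have g1: "graph_in s1" by (rule graph_in_frame[OF g]) (simp_all add: f1)
  have g2: "graph_in s2" by (rule graph_in_frame[OF g1]) (simp_all add: f2)
  have r1: "roles s1 = roles s" by (rule roles_cong) (simp add: f1)
  have r2: "roles s2 = roles s" by (rule roles_cong) (simp add: f1 f2)
  let ?r = "roles s" and ?K = "{v. roles s v = 3 \<or> roles s v = 4}"
  have d2: "s2 mD 0 = d" using f1[of mD] f2[of mD] kd by simp
  have C: "run CHECK s = run COMPONENTS s2" unfolding CHECK_def s2_def s1_def by (simp only: run.simps(3))
  have b: "run CHECK s mBad 0 = 0 \<longleftrightarrow> card {v. ?r v = 2} \<le> k \<and> acyc {v. ?r v = 4} \<and>
      (\<forall>w\<in>?K. card ({v. ?r v = 3} \<inter> comp ?K w) \<le> d)"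
    unfolding C run_COMPONENTS[OF g2 d2 refl] r2
    using run_ACYCLIC[OF g1] run_SIZES(2)[OF g kd(1)] unfolding s2_def[symmetric] s1_def[symmetric] r1 by blast
  \<comment> \<open>No role below 2 is left, so the vertices that are present and not deleted are
    those of role 3 or 4.\<close>
  have V: "{v. ?r v \<le> 4} - {v. ?r v = 2} = ?K" "?K - {v. ?r v = 3} = {v. ?r v = 4}"
    using r by fastforce+
  show "run CHECK s mBad 0 = 0 \<longleftrightarrow> valid ?r"
    unfolding b valid_def sol_def V by auto
  have "run COMPONENTS s2 mPrice = s2 mPrice" by (rule COMPONENTS_frame) simp
  then show "run CHECK s mPrice 0 = price ?r"
    unfolding C using f2[of mPrice] run_SIZES(1)[OF g kd(1)] unfolding s1_def by simp
qed

end

section \<open>The search\<close>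

text \<open>The stored cost is meaningful only after a first hit, hence the disjunction with the
  negated \<open>mHit\<close>.\<close>

definition UPDATE :: cmd where
  "UPDATE = If (And (Not (var mBad)) (Add (Not (var mHit)) (Sub (var mCost) (var mPrice))))
     (Seq (fill mBest (Const 1) (cell mRole mX)) (Seq (assign mHit (Const 1)) (assign mCost (var mPrice)))) Skip"

text \<open>Increment of a ternary counter with a carry; the last string wraps around to all
  zeros.\<close>

definition NEXT :: cmd where
  "NEXT = Seq (assign mCarry (Const 1)) (For mX mL (If (var mCarry)
     (If (Eq (cell mDig mX) (Const 2)) (Write mDig (var mX) (Const 0))
       (Seq (Write mDig (var mX) (Add (cell mDig mX) (Const 1))) (assign mCarry (Const 0)))) Skip))"

definition TRY :: cmd where
  "TRY = Seq ATTEMPT (Seq CHECK (Seq UPDATE NEXT))"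

text \<open>Once a prefix of the vertices has no solution, \<open>mFound\<close> switches off all
  later stages; by \<open>solvable_mono\<close> no longer prefix has a solution either.\<close>

definition STAGE :: cmd where
  "STAGE = If (var mFound) (Seq (assign mHit (Const 0))
     (Seq (For mX mL (If (Const 1) (Write mDig (var mX) (Const 0)) Skip))
     (Seq (For mJ mC TRY)
     (Seq (assign mFound (var mHit)) (fill mPrev (Const 1) (cell mBest mX)))))) Skip"

definition MAIN :: cmd where
  "MAIN = Seq (assign mFound (Const 1)) (Seq (For mI mN STAGE) (Write 0 (Const 0) (var mFound)))"

lemmas cmd_defs = MAIN_def STAGE_def TRY_def NEXT_def UPDATE_def CHECK_def SIZES_def ACYCLIC_def COMPONENTS_def COMPONENT_def
  ATTEMPT_def GUESS_def ATTACH_def REGUESS_def STEP_def PICK_def TREE_def EDGES_def PIECE_def ACT_def DEGREES_def REACH_def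

lemma Suc_div_power3: "Suc c div 3 ^ i = c div 3 ^ i + of_bool (\<forall>j<i. digit c j = 2)"
proof (induction i)
  case (Suc i)
  let ?q = "c div 3 ^ i" and ?b = "\<forall>j<i. digit c j = 2"
  have "Suc c div 3 ^ Suc i = (Suc c div 3 ^ i) div 3" by (simp add: div_mult2_eq[symmetric] mult.commute)
  also have "\<dots> = (?q + of_bool ?b) div 3" using Suc.IH by simp
  also have "(q + of_bool b) div 3 = q div 3 + of_bool (b \<and> q mod 3 = 2)" for q :: nat and b
    by (cases b; cases "q mod 3 = 2"; simp; presburger)
  also have "(?b \<and> ?q mod 3 = 2) \<longleftrightarrow> (\<forall>j<Suc i. digit c j = 2)"
    unfolding digit_def less_Suc_eq by auto
  also have "?q div 3 = c div 3 ^ Suc i" by (simp add: div_mult2_eq[symmetric] mult.commute)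
  finally show ?case .
qed simp

lemma digit_Suc: "digit (Suc c) i = (if \<forall>j<i. digit c j = 2 then (if digit c i = 2 then 0 else Suc (digit c i)) else digit c i)"
proof -
  have "(q + 1) mod 3 = (if q mod 3 = 2 then 0 else Suc (q mod 3))" for q :: nat by presburger
  then show ?thesis unfolding digit_def[of "Suc c"] Suc_div_power3 by (simp add: digit_def)
qed

lemma digit_zero [simp]: "digit 0 i = 0"
  unfolding digit_def by simp

lemma digit_less: "digit c i < 3"
  unfolding digit_def by simp

lemma digit_beyond: "c < 3 ^ l \<Longrightarrow> l \<le> i \<Longrightarrow> digit c i = 0"
proof -
  assume "c < 3 ^ l" "l \<le> i"
  then have "c < 3 ^ i" using power_increasing[of l i "3::nat"] by linarith
  then show ?thesis unfolding digit_def by simp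
qed

lemma NEXT_frame: "m \<notin> {mX, mCarry, mDig} \<Longrightarrow> run NEXT s m = s m"
  by (rule run_frame) (auto simp: NEXT_def)

lemma run_NEXT:
  assumes L: "s mL 0 = l" and d: "\<And>i. s mDig i = digit c i"
  shows "run NEXT s mDig i = (if i < l then digit (Suc c) i else digit c i)"
proof -
  let ?b = "If (var mCarry) (If (Eq (cell mDig mX) (Const 2)) (Write mDig (var mX) (Const 0))
       (Seq (Write mDig (var mX) (Add (cell mDig mX) (Const 1))) (assign mCarry (Const 0)))) Skip"
  define s0 where "s0 = wr mCarry 0 1 s"
  define I where "I j t \<longleftrightarrow> t mCarry 0 = of_bool (\<forall>i<j. digit c i = 2) \<and>
    (\<forall>i. t mDig i = (if i < j then digit (Suc c) i else digit c i))" for j t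
  have "I (s0 mL 0) (run (For mX mL ?b) s0)"
  proof (rule for_invariant)
    show "I 0 (wr mX 0 0 s0)" unfolding I_def s0_def using d by simp
    fix j t
    assume j: "j < s0 mL 0" "I j t" "t mX 0 = j"
    have c: "t mCarry 0 = of_bool (\<forall>i<j. digit c i = 2)" and dg: "\<And>i. t mDig i = (if i < j then digit (Suc c) i else digit c i)"
      using j(2) unfolding I_def by auto
    have r: "run ?b t = (if \<forall>i<j. digit c i = 2 then if digit c j = 2 then wr mDig j 0 t
        else wr mCarry 0 0 (wr mDig j (Suc (digit c j)) t) else t)"
    proof (cases "\<forall>i<j. digit c i = 2")
      case True
      then have "t mCarry 0 = 1" using c by simp
      then show ?thesis using True dg[of j] j(3) by simp
    next
      case False
      then have "t mCarry 0 = 0" using c by simp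
      then have "run ?b t = t" by simp
      then show ?thesis using False by (simp only: if_False)
    qed
    show "I (Suc j) (bump mX (run ?b t))"
    proof (cases "\<forall>i<j. digit c i = 2")
      case True
      then show ?thesis using c dg digit_Suc[of c j] unfolding I_def r by (auto simp: less_Suc_eq)
    next
      case False
      then have "\<not> (\<forall>i<Suc j. digit c i = 2)" using less_SucI by blast
      then show ?thesis using False c dg digit_Suc[of c j] unfolding I_def r by (auto simp: less_Suc_eq)
    qed
  qed simp
  moreover have "run NEXT s = run (For mX mL ?b) s0" unfolding NEXT_def s0_def by (simp only: run.simps(2,3) eval_expr.simps)
  moreover have "s0 mL 0 = l" unfolding s0_def using L by simp
  ultimately show ?thesis unfolding I_def by simp
qed

context deletion_instance
begin

definition bests :: "state \<Rightarrow> nat \<Rightarrow> nat" where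
  "bests s v = (if v < n then s mBest v else 5)"

lemma bests_cong: "s' mBest = s mBest \<Longrightarrow> bests s' = bests s"
  by (simp add: bests_def fun_eq_iff)

lemma prevs_cong: "s' mPrev = s mPrev \<Longrightarrow> prevs s' x = prevs s x"
  by (simp add: prevs_def fun_eq_iff)

lemma UPDATE_frame: "m \<notin> {mX, mBest, mHit, mCost} \<Longrightarrow> run UPDATE s m = s m"
  by (rule run_frame) (auto simp: UPDATE_def)

lemma run_UPDATE:
  assumes g: "graph_in s"
  defines "b \<equiv> s mBad 0 = 0 \<and> (s mHit 0 = 0 \<or> s mPrice 0 < s mCost 0)"
  shows "bests (run UPDATE s) = (if b then roles s else bests s)"
    "run UPDATE s mHit 0 = (if b then 1 else s mHit 0)"
    "run UPDATE s mCost 0 = (if b then s mPrice 0 else s mCost 0)"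
proof -
  define f where "f = run (fill mBest (Const 1) (cell mRole mX)) s"
  have ff: "f m = s m" if "m \<noteq> mBest" "m \<noteq> mX" for m unfolding f_def by (rule fill_frame[OF that])
  have fv: "f mBest v = s mRole v" if "v < n" for v unfolding f_def
    by (rule run_fill_all[OF g _ _ _ that]) simp_all
  have "eval_expr (And (Not (var mBad)) (Add (Not (var mHit)) (Sub (var mCost) (var mPrice)))) s \<noteq> 0 \<longleftrightarrow> b"
    unfolding b_def by auto
  then have r: "run UPDATE s = (if b then wr mCost 0 (s mPrice 0) (wr mHit 0 1 f) else s)"
    unfolding UPDATE_def run.simps(1,2,3,4) f_def[symmetric] using ff[of mPrice] by simp
  show "bests (run UPDATE s) = (if b then roles s else bests s)"
    unfolding r bests_def roles_def using fv by auto
  show "run UPDATE s mHit 0 = (if b then 1 else s mHit 0)" "run UPDATE s mCost 0 = (if b then s mPrice 0 else s mCost 0)"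
    unfolding r by simp_all
qed

definition fixed :: "state \<Rightarrow> bool" where
  "fixed s \<longleftrightarrow> graph_in s \<and> s mK 0 = k \<and> s mD 0 = d \<and> s mL 0 = str_len \<and> s mC 0 = 3 ^ str_len"

lemma fixed_frame:
  assumes "fixed s" "s' 1 = s 1" "s' mN = s mN" "s' mRow = s mRow" "s' mK = s mK" "s' mD = s mD" "s' mL = s mL" "s' mC = s mC"
  shows "fixed s'"
  using assms graph_in_frame[of s s'] unfolding fixed_def by simp

definition scanned :: "(nat \<Rightarrow> nat) \<Rightarrow> nat \<Rightarrow> nat \<Rightarrow> state \<Rightarrow> bool" where
  "scanned P x j s \<longleftrightarrow>
     (s mHit 0 \<noteq> 0 \<longleftrightarrow> (\<exists>c<j. valid (attempt P x (digit c)))) \<and> s mHit 0 \<le> 1 \<and>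
     (s mHit 0 \<noteq> 0 \<longrightarrow> (\<exists>c<j. valid (attempt P x (digit c)) \<and> bests s = attempt P x (digit c) \<and>
        s mCost 0 = price (attempt P x (digit c)) \<and>
        (\<forall>c'<j. valid (attempt P x (digit c')) \<longrightarrow> price (attempt P x (digit c)) \<le> price (attempt P x (digit c')))))"

lemma scanned_Suc:
  assumes sc: "scanned P x j s" and A: "A = attempt P x (digit j)" and b: "b \<longleftrightarrow> valid A \<and> (s mHit 0 = 0 \<or> price A < s mCost 0)"
    and s': "bests s' = (if b then A else bests s)" "s' mHit 0 = (if b then 1 else s mHit 0)"
      "s' mCost 0 = (if b then price A else s mCost 0)"
  shows "scanned P x (Suc j) s'"
proof (cases b)
  case True
  have "price A \<le> price (attempt P x (digit c'))" if "c' < Suc j" "valid (attempt P x (digit c'))" for c'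
  proof (cases "c' = j")
    case False
    then have c': "c' < j" using that by simp
    then have "s mHit 0 \<noteq> 0" using sc that unfolding scanned_def by blast
    then have "price A < s mCost 0" "s mCost 0 \<le> price (attempt P x (digit c'))"
      using sc that c' True b unfolding scanned_def by auto
    then show ?thesis by simp
  qed (simp add: A)
  then show ?thesis using True b s' unfolding scanned_def A by auto
next
  case False
  show ?thesis
  proof (cases "s mHit 0 = 0")
    case True
    then have "\<not> valid A" using False b by blast
    then show ?thesis using True False sc s' unfolding scanned_def A less_Suc_eq by auto
  next
    case hit: False
    obtain c where c: "c < j" "valid (attempt P x (digit c))" "bests s = attempt P x (digit c)"
      "s mCost 0 = price (attempt P x (digit c))"
      "\<And>c'. c' < j \<Longrightarrow> valid (attempt P x (digit c')) \<Longrightarrow> price (attempt P x (digit c)) \<le> price (attempt P x (digit c'))"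
      using sc hit unfolding scanned_def by blast
    have "price (attempt P x (digit c)) \<le> price (attempt P x (digit c'))"
      if "c' < Suc j" "valid (attempt P x (digit c'))" for c'
    proof (cases "c' = j")
      case True
      then show ?thesis using False b hit that c(4) unfolding A by simp
    next
      case False
      then show ?thesis using c(5) that by simp
    qed
    moreover have "c < Suc j" using c(1) by simp
    moreover have "s' mHit 0 = s mHit 0" "bests s' = bests s" "s' mCost 0 = s mCost 0" "s mHit 0 \<le> 1"
      using s' False sc unfolding scanned_def by simp_all
    ultimately show ?thesis using hit c(2-4) unfolding scanned_def by metis
  qed
qed

definition free_mem :: "nat set" where
  "free_mem = {mRole, mPtr, mSet, mDeg, mX, mY, mZ, mW, mCnt, mCand, mV, mMark, mTree, mNbr, mBad, mPrice, mBest, mHit, mCost,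
     mCarry, mDig}"

lemma TRY_frame: "m \<notin> free_mem \<Longrightarrow> run TRY s m = s m"
  by (rule run_frame) (auto simp: cmd_defs free_mem_def)

lemma run_TRY:
  assumes fx: "fixed s" and x: "s mI 0 = x" "x < n" and P: "P = prevs s x"
    and pr: "\<And>v. v < x \<Longrightarrow> s mPrev v \<in> {2, 3, 4}" and dg: "\<And>i. s mDig i = digit j i"
    and sc: "scanned P x j s"
  shows "scanned P x (Suc j) (run TRY s)" "run TRY s mDig i = (if i < str_len then digit (Suc j) i else digit j i)"
proof -
  define s1 where "s1 = run ATTEMPT s"
  define s2 where "s2 = run CHECK s1"
  define s3 where "s3 = run UPDATE s2"
  have g: "graph_in s" using fx unfolding fixed_def by blast
  have f1: "s1 m = s m" if "m \<notin> {mRole, mPtr, mSet, mDeg, mX, mY, mZ, mW, mCnt, mCand, mV, mMark, mTree, mNbr, mBad}" for m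
    unfolding s1_def by (rule ATTEMPT_frame[OF that])
  have f2: "s2 m = s1 m" if "m \<notin> {mX, mY, mZ, mW, mSet, mMark, mDeg, mCnt, mBad, mPrice}" for m
    unfolding s2_def by (rule CHECK_frame[OF that])
  have f3: "s3 m = s2 m" if "m \<notin> {mX, mBest, mHit, mCost}" for m unfolding s3_def by (rule UPDATE_frame[OF that])
  have g1: "graph_in s1" by (rule graph_in_frame[OF g]) (simp_all add: f1)
  have g2: "graph_in s2" by (rule graph_in_frame[OF g1]) (simp_all add: f2)
  have dg': "s mDig = digit j" using dg by (simp add: fun_eq_iff)
  have r1: "roles s1 = attempt P x (digit j)"
    using run_ATTEMPT[OF g x P pr] unfolding s1_def dg' by simp
  have Pv: "P v \<in> {2, 3, 4, 5}" for v unfolding P prevs_def using pr by auto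
  have Px: "{v. P v \<le> 4} = {..<x}"
  proof (intro set_eqI)
    fix v show "v \<in> {v. P v \<le> 4} \<longleftrightarrow> v \<in> {..<x}" unfolding P prevs_def using pr[of v] by auto
  qed
  have rng: "roles s1 v \<in> {2, 3, 4, 5}" for v
    unfolding r1 by (rule attempt_range(2)[OF Pv Px digit_less])
  have kd: "s1 mK 0 = k" "s1 mD 0 = d" using fx f1[of mK] f1[of mD] unfolding fixed_def by simp_all
  note C = run_CHECK[OF g1 kd rng, folded s2_def]
  have r2: "roles s2 = attempt P x (digit j)" unfolding r1[symmetric] by (rule roles_cong) (simp add: f2)
  note U = run_UPDATE[OF g2, folded s3_def]
  have b2: "bests s2 = bests s" "s2 mHit = s mHit" "s2 mCost = s mCost"
    by (rule bests_cong; simp add: f1 f2) (simp_all add: f1 f2)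
  have sc3: "scanned P x (Suc j) s3"
    by (rule scanned_Suc[OF sc refl refl U[unfolded C r1 r2 b2]])
  have f4: "run NEXT s3 m = s3 m" if "m \<notin> {mX, mCarry, mDig}" for m by (rule NEXT_frame[OF that])
  have T: "run TRY s = run NEXT s3" unfolding TRY_def s3_def s2_def s1_def by (simp only: run.simps(3))
  have "bests (run NEXT s3) = bests s3" by (rule bests_cong) (simp add: f4)
  then show "scanned P x (Suc j) (run TRY s)" using sc3 f4 unfolding T scanned_def by simp
  have "s3 mL 0 = str_len" using fx f1[of mL] f2[of mL] f3[of mL] unfolding fixed_def by simp
  moreover have "s3 mDig i = digit j i" for i using dg f1[of mDig] f2[of mDig] f3[of mDig] by simp
  ultimately show "run TRY s mDig i = (if i < str_len then digit (Suc j) i else digit j i)"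
    unfolding T by (rule run_NEXT)
qed

lemma run_TRIES:
  assumes fx: "fixed s" and x: "s mI 0 = x" "x < n" and P: "P = prevs s x"
    and pr: "\<And>v. v < x \<Longrightarrow> s mPrev v \<in> {2, 3, 4}" and dg: "\<And>i. s mDig i = 0" and hit: "s mHit 0 = 0"
  shows "scanned P x (3 ^ str_len) (run (For mJ mC TRY) s)"
    "\<And>i. str_len \<le> i \<Longrightarrow> run (For mJ mC TRY) s mDig i = 0"
proof -
  \<comment> \<open>The last increment overflows, so the digits are described only while
    \<open>j\<close> numbers a string. The cells from \<open>str_len\<close> on have to stay 0,
    because an attempt may read beyond the string.\<close>
  define I where "I j t \<longleftrightarrow> (\<forall>m. m \<notin> insert mJ free_mem \<longrightarrow> t m = s m) \<and> scanned P x j t \<and>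
    (j < 3 ^ str_len \<longrightarrow> (\<forall>i. t mDig i = digit j i)) \<and> (\<forall>i\<ge>str_len. t mDig i = 0)" for j t
  have "I (s mC 0) (run (For mJ mC TRY) s)"
  proof (rule for_invariant)
    show "mJ \<notin> writes TRY" by (auto simp: cmd_defs)
    show "I 0 (wr mJ 0 0 s)" unfolding I_def scanned_def using dg hit by simp
    fix j t
    assume j: "j < s mC 0" "I j t" "t mJ 0 = j"
    have jl: "j < 3 ^ str_len" using j(1) fx unfolding fixed_def by simp
    have tm: "t m = s m" if "m \<notin> insert mJ free_mem" for m using j(2) that unfolding I_def by blast
    have t: "scanned P x j t" "\<And>i. t mDig i = digit j i" using j(2) jl unfolding I_def by blast+
    have ft: "fixed t" by (rule fixed_frame[OF fx]; rule tm; simp add: free_mem_def)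
    have tI: "t mI = s mI" "t mPrev = s mPrev" by (rule tm; simp add: free_mem_def)+
    have Pt: "P = prevs t x" unfolding P by (rule prevs_cong[symmetric]) (rule tI(2))
    have T: "scanned P x (Suc j) (run TRY t)" "\<And>i. run TRY t mDig i = (if i < str_len then digit (Suc j) i else digit j i)"
      using run_TRY[OF ft _ x(2) Pt _ t(2) t(1)] x(1) pr unfolding tI by blast+
    have d0: "digit j i = 0" if "str_len \<le> i" for i using digit_beyond[OF jl that] .
    show "I (Suc j) (bump mJ (run TRY t))" unfolding I_def
    proof (intro conjI allI impI)
      show "bump mJ (run TRY t) m = s m" if "m \<notin> insert mJ free_mem" for m
        using tm[OF that] TRY_frame[of m t] that by simp
      have "bests (bump mJ (run TRY t)) = bests (run TRY t)" by (rule bests_cong) simp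
      then show "scanned P x (Suc j) (bump mJ (run TRY t))" using T(1) unfolding scanned_def by simp
      show "bump mJ (run TRY t) mDig i = digit (Suc j) i" if "Suc j < 3 ^ str_len" for i
        using T(2)[of i] d0[of i] digit_beyond[OF that, of i] by simp
      show "bump mJ (run TRY t) mDig i = 0" if "str_len \<le> i" for i
        using T(2)[of i] d0[OF that] that by simp
    qed
  qed
  moreover have "s mC 0 = 3 ^ str_len" using fx unfolding fixed_def by blast
  ultimately show "scanned P x (3 ^ str_len) (run (For mJ mC TRY) s)"
    "\<And>i. str_len \<le> i \<Longrightarrow> run (For mJ mC TRY) s mDig i = 0"
    unfolding I_def by simp_all
qed

definition solvable :: "nat \<Rightarrow> bool" where
  "solvable x \<longleftrightarrow> (\<exists>X F. sol d {..<x} X F \<and> card X \<le> k)"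

text \<open>The stored solution is meaningful only while the prefix is solvable. Its minimality
  belongs to the invariant because the next compression relies on it.\<close>

definition staged :: "nat \<Rightarrow> state \<Rightarrow> bool" where
  "staged x s \<longleftrightarrow> fixed s \<and> (\<forall>i\<ge>str_len. s mDig i = 0) \<and> s mFound 0 = of_bool (solvable x) \<and>
     (solvable x \<longrightarrow> (\<forall>v<x. s mPrev v \<in> {2, 3, 4}) \<and>
        minsol (Suc n) d {..<x} {v. prevs s x v = 2} {v. prevs s x v = 3} \<and> card {v. prevs s x v = 2} \<le> k)"

lemma solvable_mono: "solvable (Suc x) \<Longrightarrow> solvable x"
proof -
  assume "solvable (Suc x)"
  then obtain X F where s: "sol d {..<Suc x} X F" "card X \<le> k" unfolding solvable_def by blast
  have "sol d {..<x} (X \<inter> {..<x}) (F \<inter> {..<x})" by (rule sol_hereditary[OF s(1)]) auto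
  moreover have "finite X" using s(1) finite_subset unfolding sol_def by blast
  then have "card (X \<inter> {..<x}) \<le> card X" by (intro card_mono) auto
  ultimately show ?thesis using s(2) unfolding solvable_def by (meson order_trans)
qed

text \<open>Validity of the stored candidate gives soundness; \<open>attempt_complete\<close> gives
  its existence and, as some string attains the minimum price, its minimality.\<close>

lemma run_STAGE:
  assumes st: "staged x s" and x: "s mI 0 = x" "x < n"
  shows "staged (Suc x) (run STAGE s)"
proof (cases "solvable x")
  case False
  then have "\<not> solvable (Suc x)" using solvable_mono by blast
  moreover have "run STAGE s = s" unfolding STAGE_def using st False unfolding staged_def by simp
  ultimately show ?thesis using st False unfolding staged_def by simp
next
  case True
  have fx: "fixed s" and dg: "\<And>i. str_len \<le> i \<Longrightarrow> s mDig i = 0" and fd: "s mFound 0 = 1"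
    and pr: "\<And>v. v < x \<Longrightarrow> s mPrev v \<in> {2, 3, 4}"
    and min: "minsol (Suc n) d {..<x} {v. prevs s x v = 2} {v. prevs s x v = 3}" and cp: "card {v. prevs s x v = 2} \<le> k"
    using st True unfolding staged_def by simp_all
  define P where "P = prevs s x"
  let ?A = "\<lambda>c. attempt P x (digit c)"
  define s0 where "s0 = wr mHit 0 0 s"
  define s1 where "s1 = run (For mX mL (If (Const 1) (Write mDig (var mX) (Const 0)) Skip)) s0"
  define s2 where "s2 = run (For mJ mC TRY) s1"
  define s3 where "s3 = wr mFound 0 (s2 mHit 0) s2"
  define s4 where "s4 = run (fill mPrev (Const 1) (cell mBest mX)) s3"
  have S: "run STAGE s = s4"
    unfolding STAGE_def s4_def s3_def s2_def s1_def s0_def using fd by (simp only: run.simps(2,3,4) eval_expr.simps) simp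
  have f1: "s1 m = s m" if "m \<notin> {mX, mDig, mHit}" for m
  proof -
    have "s1 m = s0 m" unfolding s1_def by (rule run_frame) (use that in simp)
    then show ?thesis using that unfolding s0_def by simp
  qed
  have f2: "s2 m = s1 m" if "m \<notin> insert mJ free_mem" for m
    unfolding s2_def by (rule run_frame) (use that in \<open>auto simp: cmd_defs free_mem_def\<close>)
  have f4: "s4 m = s2 m" if "m \<notin> {mX, mPrev, mFound}" for m
  proof -
    have "s4 m = s3 m" unfolding s4_def by (rule fill_frame) (use that in simp_all)
    then show ?thesis using that unfolding s3_def by simp
  qed
  have fx1: "fixed s1" by (rule fixed_frame[OF fx]; rule f1; simp)
  have fx2: "fixed s2" by (rule fixed_frame[OF fx1]; rule f2; simp add: free_mem_def)
  have fx3: "fixed s3" by (rule fixed_frame[OF fx2]; simp add: s3_def)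
  have fx4: "fixed s4" by (rule fixed_frame[OF fx2]; rule f4; simp)
  have "s1 mDig = (\<lambda>v. if v < s0 mL 0 \<and> True then 0 else s0 mDig v)" unfolding s1_def
    by (rule run_fill) simp_all
  then have d1: "s1 mDig i = 0" for i
    using dg[of i] fx unfolding fixed_def by (simp add: s0_def)
  have h1: "s1 mHit 0 = 0"
  proof -
    have "s1 mHit = s0 mHit" unfolding s1_def by (rule run_frame) simp
    then show ?thesis unfolding s0_def by simp
  qed
  have I1: "s1 mI 0 = x" using f1[of mI] x by simp
  have P1: "P = prevs s1 x" unfolding P_def by (rule prevs_cong[symmetric]) (simp add: f1)
  have pr1: "s1 mPrev v \<in> {2, 3, 4}" if "v < x" for v using pr[OF that] f1[of mPrev] by simp
  have T1: "scanned P x (3 ^ str_len) s2"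
    unfolding s2_def by (rule run_TRIES(1)[OF fx1 I1 x(2) P1 _ d1 h1]) (rule pr1)
  have T2: "s2 mDig i = 0" if "str_len \<le> i" for i
    unfolding s2_def by (rule run_TRIES(2)[OF fx1 I1 x(2) P1 _ d1 h1 that]) (rule pr1)
  have Pv: "P v \<in> {2, 3, 4, 5}" for v unfolding P_def prevs_def using pr by auto
  have Px: "{v. P v \<le> 4} = {..<x}"
  proof (intro set_eqI)
    fix v show "v \<in> {v. P v \<le> 4} \<longleftrightarrow> v \<in> {..<x}" unfolding P_def prevs_def using pr[of v] by auto
  qed
  have rng: "{v. ?A c v \<le> 4} = {..<Suc x}" "?A c v \<in> {2, 3, 4, 5}" for c v
    by (rule attempt_range[OF Pv Px digit_less])+
  have hit: "s2 mHit 0 = of_bool (solvable (Suc x))"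
  proof -
    have "(\<exists>c<3 ^ str_len. valid (?A c)) \<longleftrightarrow> solvable (Suc x)"
    proof
      assume "\<exists>c<3 ^ str_len. valid (?A c)"
      then show "solvable (Suc x)" unfolding valid_def rng(1) solvable_def by blast
    next
      assume "solvable (Suc x)"
      then obtain X F where "sol d {..<Suc x} X F" "card X \<le> k" unfolding solvable_def by blast
      from attempt_complete[OF Pv Px x(2) min[folded P_def] cp[folded P_def] this]
      show "\<exists>c<3 ^ str_len. valid (?A c)" by blast
    qed
    then show ?thesis using T1 unfolding scanned_def by (cases "s2 mHit 0 = 0") auto
  qed
  have prev4: "s4 mPrev v = s2 mBest v" if "v < n" for v
  proof -
    have "s4 mPrev v = s3 mBest v" unfolding s4_def
      by (rule run_fill_all[OF _ _ _ _ that]) (use fx3 in \<open>simp_all add: fixed_def\<close>)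
    then show ?thesis unfolding s3_def by simp
  qed
  have "s4 mFound = s3 mFound" unfolding s4_def by (rule fill_frame) simp_all
  then have found: "s4 mFound 0 = of_bool (solvable (Suc x))" using hit unfolding s3_def by simp
  have good: "(\<forall>v<Suc x. s4 mPrev v \<in> {2, 3, 4}) \<and>
        minsol (Suc n) d {..<Suc x} {v. prevs s4 (Suc x) v = 2} {v. prevs s4 (Suc x) v = 3} \<and> card {v. prevs s4 (Suc x) v = 2} \<le> k"
    if sv: "solvable (Suc x)"
  proof -
    obtain c where c: "valid (?A c)" "bests s2 = ?A c"
      "\<And>c'. c' < 3 ^ str_len \<Longrightarrow> valid (?A c') \<Longrightarrow> price (?A c) \<le> price (?A c')"
      using T1 hit sv unfolding scanned_def by auto
    have in4: "?A c v \<le> 4 \<longleftrightarrow> v < Suc x" for v using rng(1)[of c] by blast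
    have eq: "prevs s4 (Suc x) = ?A c"
    proof
      fix v
      show "prevs s4 (Suc x) v = ?A c v"
      proof (cases "v < Suc x")
        case True
        then have "v < n" using x by simp
        then have "s4 mPrev v = bests s2 v" using prev4 unfolding bests_def by simp
        then show ?thesis using True unfolding prevs_def c(2) by simp
      next
        case False
        then have "\<not> ?A c v \<le> 4" using in4 by simp
        then have "?A c v = 5" using rng(2)[of c v] by auto
        then show ?thesis using False unfolding prevs_def by simp
      qed
    qed
    have "s4 mPrev v \<in> {2, 3, 4}" if "v < Suc x" for v
    proof -
      have "s4 mPrev v = ?A c v" using eq that unfolding prevs_def fun_eq_iff by metis
      moreover have "?A c v \<le> 4" using in4 that by simp
      ultimately show ?thesis using rng(2)[of c v] by auto
    qed
    moreover have v: "sol d {..<Suc x} {v. ?A c v = 2} {v. ?A c v = 3}" "card {v. ?A c v = 2} \<le> k"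
      using c(1) unfolding valid_def rng(1) by blast+
    moreover have "Suc n * card {v. ?A c v = 2} + card {v. ?A c v = 3} \<le> Suc n * card X' + card F'"
      if s': "sol d {..<Suc x} X' F'" for X' F'
    proof -
      obtain c' where c': "c' < 3 ^ str_len" "valid (?A c')" "price (?A c') \<le> Suc n * card X' + card F'"
        using attempt_complete[OF Pv Px x(2) min[folded P_def] cp[folded P_def] v] s' by blast
      then show ?thesis using c(3)[OF c'(1,2)] unfolding price_def by linarith
    qed
    ultimately show ?thesis unfolding eq minsol_def by blast
  qed
  have "s4 mDig i = 0" if "str_len \<le> i" for i using T2[OF that] f4[of mDig] by simp
  then show ?thesis unfolding S staged_def using fx4 found good by blast
qed

lemma run_MAIN:
  assumes fx: "fixed s" and dg: "\<And>i. s mDig i = 0"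
  shows "run MAIN s 0 0 = of_bool (solvable n)"
proof -
  define s0 where "s0 = wr mFound 0 1 s"
  define s1 where "s1 = run (For mI mN STAGE) s0"
  have fx0: "fixed s0" by (rule fixed_frame[OF fx]; simp add: s0_def)
  have N: "s0 mN 0 = n" using fx0 graph_in_N unfolding fixed_def by blast
  have stw: "staged x (wr mI 0 i t) \<longleftrightarrow> staged x t" for x i t
  proof -
    have "fixed (wr mI 0 i t) \<longleftrightarrow> fixed t"
      using fixed_frame[of t "wr mI 0 i t"] fixed_frame[of "wr mI 0 i t" t] by auto
    moreover have "prevs (wr mI 0 i t) x = prevs t x" by (rule prevs_cong) simp
    ultimately show ?thesis unfolding staged_def by simp
  qed
  have sol0: "sol d {..<0} {} {}" unfolding sol_def acyc_def by simp
  have "solvable 0" unfolding solvable_def using sol0 by (intro exI[of _ "{}"]) simp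
  moreover have "minsol (Suc n) d {..<0} {v. prevs s0 0 v = 2} {v. prevs s0 0 v = 3}" "card {v. prevs s0 0 v = 2} \<le> k"
    using sol0 unfolding minsol_def prevs_def by simp_all
  ultimately have "staged 0 s0" unfolding staged_def using fx0 dg by (simp add: s0_def)
  have "staged (s0 mN 0) s1" unfolding s1_def
  proof (rule for_invariant)
    show "mI \<notin> writes STAGE" by (auto simp: cmd_defs)
    show "staged 0 (wr mI 0 0 s0)" unfolding stw by fact
    fix j t
    assume j: "j < s0 mN 0" "staged j t" "t mI 0 = j"
    have "staged (Suc j) (run STAGE t)" by (rule run_STAGE[OF j(2,3)]) (use j(1) N in simp)
    then show "staged (Suc j) (bump mI (run STAGE t))" unfolding bump_def stw .
  qed
  then have "s1 mFound 0 = of_bool (solvable n)" unfolding N staged_def by blast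
  moreover have "run MAIN s = wr 0 0 (s1 mFound 0) s1"
    unfolding MAIN_def s1_def s0_def by (simp only: run.simps(2,3) eval_expr.simps)
  ultimately show ?thesis by simp
qed

end

section \<open>Quasi-forests in terms of vertex sets\<close>

text \<open>All neighbours of a vertex lie in its own component, so a vertex that is low in one
  component's part of \<open>T\<close> is low in \<open>T\<close>.\<close>

lemma (in ugraph) acyc_of_comps:
  assumes "\<And>v. v \<in> S \<Longrightarrow> acyc (comp S v - F)"
  shows "acyc (S - F)"
  unfolding acyc_def
proof (intro allI impI)
  fix T assume T: "T \<subseteq> S - F" "T \<noteq> {}"
  then obtain v where v: "v \<in> T" by blast
  then have "v \<in> T \<inter> comp S v" using T conn_refl by auto
  moreover have "T \<inter> comp S v \<subseteq> comp S v - F" using T by blast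
  moreover have "acyc (comp S v - F)" using assms T v by blast
  ultimately obtain u where u: "u \<in> T \<inter> comp S v" "low (T \<inter> comp S v) u"
    unfolding acyc_def by blast
  have "w \<in> T \<inter> comp S v" if "w \<in> T" "E u w" for w
    using that u(1) T conn_step[of S v u w] by auto
  then have "low T u" using u(2) unfolding low_def by blast
  then show "\<exists>v\<in>T. low T v" using u(1) by blast
qed

lemma (in ugraph) comp_disjoint: "y \<in> comp S u \<Longrightarrow> y \<in> comp S v \<Longrightarrow> comp S u = comp S v"
  using comp_eq[of S u y] comp_eq[of S v y] by simp

lemma (in ugraph) sol_iff_comps:
  assumes V: "finite V"
  shows "(\<exists>X F. sol d V X F \<and> card X \<le> k) \<longleftrightarrow>
    (\<exists>X\<subseteq>V. card X \<le> k \<and> (\<forall>v\<in>V - X. \<exists>F\<subseteq>comp (V - X) v. card F \<le> d \<and> acyc (comp (V - X) v - F)))"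
    (is "?L \<longleftrightarrow> ?R")
proof
  assume ?L
  then obtain X F where s: "sol d V X F" "card X \<le> k" by blast
  have "\<exists>F'\<subseteq>comp (V - X) v. card F' \<le> d \<and> acyc (comp (V - X) v - F')" if v: "v \<in> V - X" for v
  proof (intro exI[of _ "F \<inter> comp (V - X) v"] conjI)
    show "card (F \<inter> comp (V - X) v) \<le> d" using s(1) v unfolding sol_def by blast
    have "comp (V - X) v - (F \<inter> comp (V - X) v) \<subseteq> V - X - F" using comp_subset[of "V - X" v] by blast
    then show "acyc (comp (V - X) v - (F \<inter> comp (V - X) v))"
      using s(1) acyc_mono unfolding sol_def by blast
  qed blast
  then show ?R using s unfolding sol_def by blast
next
  assume ?R
  then obtain X where X: "X \<subseteq> V" "card X \<le> k"
    "\<forall>v\<in>V - X. \<exists>F\<subseteq>comp (V - X) v. card F \<le> d \<and> acyc (comp (V - X) v - F)" by blast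
  \<comment> \<open>The choice depends on the set \<open>C\<close> alone, so all vertices of one
    component receive the same feedback set.\<close>
  define f where "f C = (SOME F. F \<subseteq> C \<and> card F \<le> d \<and> acyc (C - F))" for C
  have f: "f (comp (V - X) v) \<subseteq> comp (V - X) v \<and> card (f (comp (V - X) v)) \<le> d \<and> acyc (comp (V - X) v - f (comp (V - X) v))"
    if "v \<in> V - X" for v
    unfolding f_def by (rule someI_ex) (use X(3) that in blast)
  define F where "F = (\<Union>v\<in>V - X. f (comp (V - X) v))"
  have FC: "F \<inter> comp (V - X) v = f (comp (V - X) v)" if v: "v \<in> V - X" for v
  proof
    show "f (comp (V - X) v) \<subseteq> F \<inter> comp (V - X) v" using f[OF v] v unfolding F_def by blast
    show "F \<inter> comp (V - X) v \<subseteq> f (comp (V - X) v)"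
    proof
      fix y assume y: "y \<in> F \<inter> comp (V - X) v"
      then obtain u where u: "u \<in> V - X" "y \<in> f (comp (V - X) u)" unfolding F_def by blast
      then have "y \<in> comp (V - X) u" using f by blast
      then have "comp (V - X) u = comp (V - X) v" using comp_disjoint y by blast
      then show "y \<in> f (comp (V - X) v)" using u by simp
    qed
  qed
  have "F \<subseteq> V - X" using f comp_subset[of "V - X"] unfolding F_def by blast
  moreover have "acyc (V - X - F)"
  proof (rule acyc_of_comps)
    fix v assume v: "v \<in> V - X"
    have "comp (V - X) v - F = comp (V - X) v - f (comp (V - X) v)" using FC[OF v] by blast
    then show "acyc (comp (V - X) v - F)" using f[OF v] by simp
  qed
  moreover have "card (F \<inter> comp (V - X) v) \<le> d" if "v \<in> V - X" for v
    unfolding FC[OF that] using f[OF that] by blast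
  ultimately have "sol d V X F" using X unfolding sol_def by blast
  then show ?L using X by blast
qed

text \<open>In a longest path, a neighbour of the first vertex off the path could be put in
  front.\<close>

lemma (in ugraph) longest_path:
  assumes "finite T" "a \<in> T"
  shows "\<exists>xs. xs \<noteq> [] \<and> distinct xs \<and> set xs \<subseteq> T \<and> (\<forall>i. Suc i < length xs \<longrightarrow> E (xs ! i) (xs ! Suc i)) \<and>
    (\<forall>w\<in>T. E (xs ! 0) w \<longrightarrow> w \<in> set xs)"
proof -
  define P where "P xs \<longleftrightarrow> xs \<noteq> [] \<and> distinct xs \<and> set xs \<subseteq> T \<and> (\<forall>i. Suc i < length xs \<longrightarrow> E (xs ! i) (xs ! Suc i))" for xs
  have "P [a]" using assms unfolding P_def by simp
  moreover have "length xs < Suc (card T)" if "P xs" for xs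
    using that assms(1) card_mono[of T "set xs"] distinct_card[of xs] unfolding P_def by simp
  ultimately obtain xs where xs: "P xs" "\<And>ys. P ys \<Longrightarrow> length ys \<le> length xs"
    using ex_has_greatest_nat[of P "[a]" length "Suc (card T)"] by blast
  have "w \<in> set xs" if w: "w \<in> T" "E (xs ! 0) w" for w
  proof (rule ccontr)
    assume "w \<notin> set xs"
    have "P (w # xs)" unfolding P_def
    proof (intro conjI allI impI)
      fix i assume i: "Suc i < length (w # xs)"
      show "E ((w # xs) ! i) ((w # xs) ! Suc i)"
      proof (cases i)
        case 0
        then show ?thesis using w E_sym by simp
      next
        case (Suc j)
        then show ?thesis using xs(1) i unfolding P_def by simp
      qed
    qed (use xs(1) w \<open>w \<notin> set xs\<close> in \<open>auto simp: P_def\<close>)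
    then show False using xs(2) by fastforce
  qed
  then show ?thesis using xs(1) unfolding P_def by blast
qed

section \<open>Cycles and components of library graphs in terms of vertex sets\<close>

locale pair_instance = pair_graph G for G :: "nat pair_pre_digraph"
begin

definition E :: "nat \<Rightarrow> nat \<Rightarrow> bool" where
  "E u v \<longleftrightarrow> (u, v) \<in> parcs G"

lemma ugraph_E: "ugraph E"
proof
  show "E y x" if "E x y" for x y using that arcs_symmetric unfolding E_def by blast
  show "\<not> E x x" for x using no_loops' unfolding E_def by blast
qed

sublocale U: ugraph E
  by (rule ugraph_E)

abbreviation H :: "nat set \<Rightarrow> (nat, nat \<times> nat) pre_digraph" where
  "H S \<equiv> with_proj G \<restriction> S"

lemma H_simps:
  "verts (H S) = S" "arcs (H S) = {(u, v). E u v \<and> u \<in> S \<and> v \<in> S}" "tail (H S) = fst" "head (H S) = snd"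
  by (auto simp: induce_subgraph_def E_def)

lemma H_induced: "C \<subseteq> S \<Longrightarrow> H S \<restriction> C = H C"
  by (auto simp: induce_subgraph_def)

text \<open>This replaces the recursive walk predicate by a condition on consecutive arcs, so that
  cycles can be handled by indices.\<close>

lemma cas_H:
  "pre_digraph.cas (H S) u p v \<longleftrightarrow> (p = [] \<and> u = v) \<or>
    (p \<noteq> [] \<and> fst (p ! 0) = u \<and> snd (last p) = v \<and> (\<forall>i. Suc i < length p \<longrightarrow> snd (p ! i) = fst (p ! Suc i)))"
proof (induction p arbitrary: u)
  case Nil
  then show ?case by (simp add: pre_digraph.cas.simps)
next
  case (Cons e p)
  show ?case
  proof (cases p)
    case Nil
    then show ?thesis by (simp add: pre_digraph.cas.simps H_simps)
  next
    case (Cons e' p')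
    have "(\<forall>i. Suc i < length (e # p) \<longrightarrow> snd ((e # p) ! i) = fst ((e # p) ! Suc i)) \<longleftrightarrow>
        snd e = fst (p ! 0) \<and> (\<forall>i. Suc i < length p \<longrightarrow> snd (p ! i) = fst (p ! Suc i))"
      using Cons by (auto simp: nth_Cons split: nat.splits) 
    moreover have "pre_digraph.cas (H S) u (e # p) v \<longleftrightarrow> fst e = u \<and> pre_digraph.cas (H S) (snd e) p v"
      by (simp add: pre_digraph.cas.simps H_simps)
    moreover have "p \<noteq> []" "last (e # p) = last p" "(e # p) ! 0 = e" using Cons by simp_all
    ultimately show ?thesis unfolding Cons.IH[of "snd e"] by (metis list.distinct(1))
  qed
qed

lemma awalk_verts_H: "pre_digraph.cas (H S) u p v \<Longrightarrow> pre_digraph.awalk_verts (H S) u p = u # map snd p"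
  by (induction p arbitrary: u) (auto simp: pre_digraph.cas.simps pre_digraph.awalk_verts.simps H_simps)

lemma cycle_H:
  "pre_digraph.cycle (H S) p \<longleftrightarrow> p \<noteq> [] \<and> set p \<subseteq> {(u, v). E u v \<and> u \<in> S \<and> v \<in> S} \<and> distinct (map snd p) \<and>
    snd (last p) = fst (p ! 0) \<and> (\<forall>i. Suc i < length p \<longrightarrow> snd (p ! i) = fst (p ! Suc i))"
proof -
  have "pre_digraph.cycle (H S) p \<longleftrightarrow> (\<exists>u. u \<in> S \<and> set p \<subseteq> arcs (H S) \<and> pre_digraph.cas (H S) u p u \<and> distinct (map snd p) \<and> p \<noteq> [])"
    unfolding pre_digraph.cycle_def pre_digraph.awalk_def using awalk_verts_H by (auto simp: H_simps(1)) 
  also have "\<dots> \<longleftrightarrow> p \<noteq> [] \<and> set p \<subseteq> {(u, v). E u v \<and> u \<in> S \<and> v \<in> S} \<and> distinct (map snd p) \<and>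
    snd (last p) = fst (p ! 0) \<and> (\<forall>i. Suc i < length p \<longrightarrow> snd (p ! i) = fst (p ! Suc i))"
  proof -
    have "fst (p ! 0) \<in> S" if "p \<noteq> []" "set p \<subseteq> {(u, v). E u v \<and> u \<in> S \<and> v \<in> S}"
    proof -
      have "p ! 0 \<in> set p" using that(1) by simp
      then show ?thesis using that(2) by auto
    qed
    then show ?thesis unfolding cas_H H_simps(2) by blast
  qed
  finally show ?thesis .
qed

text \<open>A vertex of a cycle has a predecessor and a successor, distinct because the length is at
  least three, so the vertices of a cycle contain no low one. Conversely, in a set without low
  vertices the first vertex of a longest path has two neighbours on the path, and one at distance at
  least two closes a cycle.\<close>

lemma acyclic_graph_H:
  assumes fin: "finite S"
  shows "acyclic_graph (H S) \<longleftrightarrow> U.acyc S"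
proof
  assume ac: "U.acyc S"
  show "acyclic_graph (H S)" unfolding acyclic_graph_def
  proof
    assume "\<exists>p. pre_digraph.cycle (H S) p \<and> 3 \<le> length p"
    then obtain p where p: "p \<noteq> []" "set p \<subseteq> {(u, v). E u v \<and> u \<in> S \<and> v \<in> S}" "distinct (map snd p)"
        "snd (last p) = fst (p ! 0)" "\<And>i. Suc i < length p \<Longrightarrow> snd (p ! i) = fst (p ! Suc i)" and l: "3 \<le> length p"
      unfolding cycle_H by blast
    let ?T = "set (map snd p)"
    have arc: "E (fst (p ! i)) (snd (p ! i))" "snd (p ! i) \<in> S" "snd (p ! i) \<in> ?T" if "i < length p" for i
    proof -
      have "p ! i \<in> set p" using that by simp
      then show "E (fst (p ! i)) (snd (p ! i))" "snd (p ! i) \<in> S" "snd (p ! i) \<in> ?T" using p(2) by auto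
    qed
    have inj: "i = j" if "i < length p" "j < length p" "snd (p ! i) = snd (p ! j)" for i j
      using p(3) that nth_eq_iff_index_eq[of "map snd p" i j] by simp
    have wrap: "snd (p ! (length p - 1)) = fst (p ! 0)" using p(1,4) by (simp add: last_conv_nth)
    have "\<not> U.low ?T v" if "v \<in> ?T" for v
    proof -
      from that obtain e where "e \<in> set p" and v: "v = snd e" by auto
      then obtain i where "i < length p" "p ! i = e" unfolding in_set_conv_nth by blast
      with v have i: "i < length p" "v = snd (p ! i)" by simp_all
      \<comment> \<open>Cyclically, \<open>j\<close> is the index of the arc after arc
        \<open>i\<close>, which leaves \<open>v\<close>, and \<open>h\<close> that of the arc before
        it, whose head precedes \<open>v\<close>.\<close>
      define j where "j = (if Suc i < length p then Suc i else 0)"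
      define h where "h = (if i = 0 then length p - 1 else i - 1)"
      have jh: "j < length p" "h < length p" "j \<noteq> h" using l i unfolding j_def h_def by auto
      have "fst (p ! j) = v"
      proof (cases "Suc i < length p")
        case True
        then show ?thesis using p(5) i unfolding j_def by simp
      next
        case False
        then have "i = length p - 1" using i by simp
        then show ?thesis using False wrap i unfolding j_def by simp
      qed
      then have e1: "E v (snd (p ! j))" using arc[OF jh(1)] by simp
      have "fst (p ! i) = snd (p ! h)"
      proof (cases i)
        case 0
        then show ?thesis using wrap unfolding h_def by simp
      next
        case (Suc i')
        then show ?thesis using p(5)[of i'] i unfolding h_def by simp
      qed
      then have e2: "E v (snd (p ! h))" using arc[OF i(1)] i U.E_sym by simp
      have "snd (p ! j) \<noteq> snd (p ! h)" using inj[OF jh(1,2)] jh(3) by blast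
      then show ?thesis using e1 e2 arc(3)[OF jh(1)] arc(3)[OF jh(2)] unfolding U.low_def by blast
    qed
    moreover have "?T \<subseteq> S" using p(2) by auto
    moreover have "?T \<noteq> {}" using p(1) by simp
    ultimately show False using ac unfolding U.acyc_def by blast
  qed
next
  assume ag: "acyclic_graph (H S)"
  show "U.acyc S"
  proof (rule ccontr)
    assume "\<not> U.acyc S"
    then obtain T where T: "T \<subseteq> S" "T \<noteq> {}" "\<And>v. v \<in> T \<Longrightarrow> \<not> U.low T v" unfolding U.acyc_def by blast
    have finT: "finite T" using T(1) fin finite_subset by blast
    obtain a where a: "a \<in> T" using T(2) by blast
    from U.longest_path[OF finT a]
    obtain xs where xs: "xs \<noteq> []" "distinct xs" "set xs \<subseteq> T" "\<forall>i. Suc i < length xs \<longrightarrow> E (xs ! i) (xs ! Suc i)"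
      "\<forall>w\<in>T. E (xs ! 0) w \<longrightarrow> w \<in> set xs"
      by (elim exE conjE) (rule that)
    have "xs ! 0 \<in> set xs" using xs(1) by simp
    then have "\<not> U.low T (xs ! 0)" using xs(3) T(3) by blast
    then obtain u w where uw: "u \<in> T" "w \<in> T" "E (xs ! 0) u" "E (xs ! 0) w" "u \<noteq> w" unfolding U.low_def by blast
    obtain i j where ij: "i < length xs" "xs ! i = u" "j < length xs" "xs ! j = w"
      using xs(5)[rule_format, OF uw(1,3)] xs(5)[rule_format, OF uw(2,4)] by (auto simp: in_set_conv_nth)
    have "i \<noteq> 0" using ij(2) uw(3) U.E_irrefl[of u] by (cases "i = 0") auto
    have "j \<noteq> 0" using ij(4) uw(4) U.E_irrefl[of w] by (cases "j = 0") auto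
    have "i \<noteq> j" using ij uw by blast
    have "\<exists>m. 2 \<le> m \<and> m < length xs \<and> E (xs ! 0) (xs ! m)"
    proof (cases "i = 1")
      case True
      then show ?thesis using ij uw \<open>i \<noteq> j\<close> \<open>j \<noteq> 0\<close> by (intro exI[of _ j]) auto
    next
      case False
      then show ?thesis using ij uw \<open>i \<noteq> 0\<close> by (intro exI[of _ i]) auto
    qed
    then obtain m where m: "2 \<le> m" "m < length xs" "E (xs ! 0) (xs ! m)" by blast
    \<comment> \<open>The arcs of the path up to index \<open>m\<close>, with arc \<open>m\<close>
      leading back to the first vertex.\<close>
    define p where "p = map (\<lambda>j. (xs ! j, xs ! (if j = m then 0 else Suc j))) [0..<Suc m]"
    have len: "length p = Suc m" unfolding p_def by simp
    have pn: "p ! j = (xs ! j, xs ! (if j = m then 0 else Suc j))" if "j \<le> m" for j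
      unfolding p_def using that by (simp del: upt_Suc)
    have inS: "xs ! j \<in> S" if "j \<le> m" for j
    proof -
      have "xs ! j \<in> set xs" using that m(2) by simp
      then show ?thesis using xs(3) T(1) by blast
    qed
    have "pre_digraph.cycle (H S) p" unfolding cycle_H
    proof (intro conjI allI impI)
      show "p \<noteq> []" using len by auto
      show "set p \<subseteq> {(u, v). E u v \<and> u \<in> S \<and> v \<in> S}"
      proof
        fix e assume "e \<in> set p"
        then obtain j where "j < length p" "e = p ! j" unfolding in_set_conv_nth by blast
        then have j: "j \<le> m" "e = (xs ! j, xs ! (if j = m then 0 else Suc j))" using len pn[of j] by simp_all
        show "e \<in> {(u, v). E u v \<and> u \<in> S \<and> v \<in> S}"
        proof (cases "j = m")
          case True
          then show ?thesis using j(2) inS[of m] inS[of 0] U.E_sym[OF m(3)] by simp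
        next
          case False
          then have "Suc j \<le> m" using j(1) by simp
          then show ?thesis using j(2) False inS[of j] inS[of "Suc j"] xs(4)[rule_format, of j] m(2) by simp
        qed
      qed
      have "inj_on (\<lambda>j. xs ! (if j = m then 0 else Suc j)) {0..<Suc m}"
      proof (rule inj_onI)
        fix a b assume ab: "a \<in> {0..<Suc m}" "b \<in> {0..<Suc m}"
          and eq: "xs ! (if a = m then 0 else Suc a) = xs ! (if b = m then 0 else Suc b)"
        have "(if a = m then 0 else Suc a) < length xs" "(if b = m then 0 else Suc b) < length xs" using ab m(2) by auto
        from nth_eq_iff_index_eq[OF xs(2) this] eq
        have "(if a = m then 0 else Suc a) = (if b = m then 0 else Suc b)" by blast
        then show "a = b" by (auto split: if_splits)
      qed
      then show "distinct (map snd p)" unfolding p_def by (simp add: distinct_map comp_def del: upt_Suc)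
      have "last p = p ! m" using len by (subst last_conv_nth) auto
      then show "snd (last p) = fst (p ! 0)" using pn[of m] pn[of 0] by simp
      fix i assume "Suc i < length p"
      then show "snd (p ! i) = fst (p ! Suc i)" using pn[of i] pn[of "Suc i"] len by simp
    qed
    then show False using ag len m(1) unfolding acyclic_graph_def by auto
  qed
qed

lemma wf_H: "wf_digraph (H S)"
  by unfold_locales (auto simp: H_simps)

lemma reachable_H: "u \<rightarrow>\<^sup>*\<^bsub>H S\<^esub> v \<longleftrightarrow> U.conn S u v"
proof
  have dom: "(a, b) \<in> arcs_ends (H S) \<longleftrightarrow> E a b \<and> a \<in> S \<and> b \<in> S" for a b
    unfolding arcs_ends_conv H_simps by force
  show "U.conn S u v" if "u \<rightarrow>\<^sup>*\<^bsub>H S\<^esub> v"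
    using that
  proof (induction rule: wf_digraph.reachable_induct[OF wf_H, consumes 1, case_names base step])
    case base
    then show ?case using U.conn_refl by (simp add: H_simps)
  next
    case (step x y)
    then show ?case using U.conn_step dom by blast
  qed
  show "u \<rightarrow>\<^sup>*\<^bsub>H S\<^esub> v" if "U.conn S u v"
    using that
  proof (induction rule: U.conn_induct)
    case base
    then show ?case using wf_digraph.reachable_refl[OF wf_H] by (simp add: H_simps)
  next
    case (step y z)
    then show ?case using wf_digraph.reachable_adj_trans[OF wf_H] dom by blast
  qed
qed

lemma sccs_H: "pre_digraph.sccs (H S) = (\<lambda>v. H (U.comp S v)) ` S"
proof -
  interpret h: wf_digraph "H S" by (rule wf_H)
  have "h.scc_of u = U.comp S u" for u
    unfolding h.scc_of_def reachable_H using U.conn_sym by auto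
  then have "pre_digraph.sccs (H S) = (\<lambda>v. H S \<restriction> U.comp S v) ` S"
    unfolding h.sccs_conv_sccs_verts h.sccs_verts_conv_scc_of by (simp add: H_simps image_image)
  also have "\<dots> = (\<lambda>v. H (U.comp S v)) ` S"
    by (rule image_cong[OF refl]) (rule H_induced[OF U.comp_subset])
  finally show ?thesis .
qed

lemma quasi_forest_H:
  assumes "finite S"
  shows "quasi_forest d (H S) \<longleftrightarrow> (\<forall>v\<in>S. \<exists>F\<subseteq>U.comp S v. card F \<le> d \<and> U.acyc (U.comp S v - F))"
proof -
  have "(\<exists>F. feedback_vertex_set (H C) F \<and> finite F \<and> card F \<le> d) \<longleftrightarrow> (\<exists>F\<subseteq>C. card F \<le> d \<and> U.acyc (C - F))"
    if C: "finite C" for C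
  proof -
    have "feedback_vertex_set (H C) F \<longleftrightarrow> F \<subseteq> C \<and> U.acyc (C - F)" for F
      unfolding feedback_vertex_set_def delete_verts_def H_simps(1)
      using H_induced[of "C - F" C] acyclic_graph_H[of "C - F"] C by auto
    then show ?thesis using finite_subset[OF _ C] by blast
  qed
  moreover have "finite (U.comp S v)" for v by (rule finite_subset[OF U.comp_subset assms])
  ultimately show ?thesis unfolding quasi_forest_def sccs_H by simp
qed

lemma quasi_forest_deletion_iff:
  assumes "finite (pverts G)"
  shows "quasi_forest_deletion (with_proj G) k d \<longleftrightarrow> (\<exists>X F. U.sol d (pverts G) X F \<and> card X \<le> k)"
  unfolding U.sol_iff_comps[OF assms] quasi_forest_deletion_def delete_verts_def
proof -
  have "finite X \<and> card X \<le> k \<and> quasi_forest d (H (verts (with_proj G) - X)) \<longleftrightarrow>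
      card X \<le> k \<and> (\<forall>v\<in>pverts G - X. \<exists>F\<subseteq>U.comp (pverts G - X) v. card F \<le> d \<and> U.acyc (U.comp (pverts G - X) v - F))"
    if "X \<subseteq> pverts G" for X
    using that finite_subset[OF that assms] quasi_forest_H[of "pverts G - X" d] assms by simp
  then show "(\<exists>X\<subseteq>verts (with_proj G). finite X \<and> card X \<le> k \<and> quasi_forest d (H (verts (with_proj G) - X))) \<longleftrightarrow>
      (\<exists>X\<subseteq>pverts G. card X \<le> k \<and> (\<forall>v\<in>pverts G - X. \<exists>F\<subseteq>U.comp (pverts G - X) v. card F \<le> d \<and> U.acyc (U.comp (pverts G - X) v - F)))"
    by auto
qed

end

section \<open>The solver\<close>

abbreviation (input) "mRows \<equiv> 24 :: nat"
abbreviation (input) "mCols \<equiv> 25 :: nat"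

definition LOAD :: cmd where
  "LOAD = Seq (assign mN (Read 0 (Const 0))) (Seq (assign mK (Read 0 (Const 1))) (Seq (assign mD (Read 0 (Const 2)))
     (Seq (assign mRows (Add (var mK) (Const 1))) (assign mCols (Add (var mD) (Const 1))))))"

text \<open>The product is formed by repeated addition, since the machine has no multiplication;
  \<open>mL\<close> is 0 in the input.\<close>

definition LENGTH :: cmd where
  "LENGTH = For mX mRows (For mY mCols (assign mL (Add (var mL) (Const 10))))"

definition TABLES :: cmd where
  "TABLES = Seq (assign mC (Const 1))
     (Seq (For mX mL (assign mC (Add (var mC) (Add (var mC) (var mC)))))
     (For mX mN (Seq (Write mRow (var mX) (var mCnt)) (assign mCnt (Add (var mCnt) (var mN))))))"

text \<open>The four commands are compiled separately because no loop bound may be written within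
  one command, while each of them computes bounds for later ones.\<close>

definition solver :: program where
  "solver = SEQ (compile LOAD) (SEQ (compile LENGTH) (SEQ (compile TABLES) (compile MAIN)))"

lemma run_LENGTH:
  assumes "s mRows 0 = a" "s mCols 0 = b" "s mL 0 = 0"
  shows "run LENGTH s mL 0 = 10 * a * b"
proof -
  let ?c = "For mY mCols (assign mL (Add (var mL) (Const 10)))"
  have inner: "run ?c t mL 0 = t mL 0 + 10 * t mCols 0" for t
  proof -
    define I where "I j t' \<longleftrightarrow> t' mL 0 = t mL 0 + 10 * j" for j and t' :: state
    have "I (t mCols 0) (run ?c t)" by (rule for_invariant) (simp_all add: I_def)
    then show ?thesis unfolding I_def .
  qed
  define I where "I j t \<longleftrightarrow> t mL 0 = 10 * j * b \<and> t mCols 0 = b" for j and t :: state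
  have "I (s mRows 0) (run LENGTH s)" unfolding LENGTH_def
  proof (rule for_invariant)
    show "I 0 (wr mX 0 0 s)" using assms unfolding I_def by simp
    fix j t
    assume "I j t"
    moreover have "run ?c t mCols = t mCols" by (rule run_frame) simp
    ultimately show "I (Suc j) (bump mX (run ?c t))" unfolding I_def by (simp add: inner algebra_simps)
  qed simp
  then show ?thesis using assms unfolding I_def by simp
qed

lemma run_TABLES:
  assumes N: "s mN 0 = n" and L: "s mL 0 = l" and c: "s mCnt 0 = 0"
  shows "run TABLES s mC 0 = 3 ^ l" "\<And>v. v < n \<Longrightarrow> run TABLES s mRow v = v * n"
proof -
  let ?p = "assign mC (Add (var mC) (Add (var mC) (var mC)))"
  let ?q = "Seq (Write mRow (var mX) (var mCnt)) (assign mCnt (Add (var mCnt) (var mN)))"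
  define s0 where "s0 = wr mC 0 1 s"
  define s1 where "s1 = run (For mX mL ?p) s0"
  have T: "run TABLES s = run (For mX mN ?q) s1"
    unfolding TABLES_def s1_def s0_def by (simp only: run.simps(2,3) eval_expr.simps)
  define I where "I j t \<longleftrightarrow> t mC 0 = 3 ^ j" for j and t :: state
  have "I (s0 mL 0) s1" unfolding s1_def by (rule for_invariant) (simp_all add: I_def s0_def)
  then have C: "s1 mC 0 = 3 ^ l" using L unfolding I_def s0_def by simp
  have f1: "s1 m = s m" if "m \<noteq> mX" "m \<noteq> mC" for m
  proof -
    have "s1 m = s0 m" unfolding s1_def by (rule run_frame) (use that in simp)
    then show ?thesis using that unfolding s0_def by simp
  qed
  define J where "J j t \<longleftrightarrow> t mCnt 0 = j * n \<and> t mN 0 = n \<and> (\<forall>v<j. t mRow v = v * n)" for j and t :: state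
  have "J (s1 mN 0) (run (For mX mN ?q) s1)"
  proof (rule for_invariant)
    show "J 0 (wr mX 0 0 s1)" using f1[of mCnt] f1[of mN] c N unfolding J_def by simp
    fix j t
    assume "J j t" "t mX 0 = j"
    then show "J (Suc j) (bump mX (run ?q t))" unfolding J_def by (auto simp: less_Suc_eq)
  qed simp
  then show "\<And>v. v < n \<Longrightarrow> run TABLES s mRow v = v * n" using f1[of mN] N unfolding T J_def by simp
  have "run (For mX mN ?q) s1 mC = s1 mC" by (rule run_frame) simp
  then show "run TABLES s mC 0 = 3 ^ l" unfolding T using C by simp
qed

lemma exec_compile_le:
  assumes "fresh c" "bounds c \<inter> writes c = {}" "\<And>b. b \<in> bounds c \<Longrightarrow> s b 0 \<le> m" "1 \<le> m"
  shows "\<exists>t\<le>weight c * m ^ depth c. exec (compile c) s t (run c s)"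
proof -
  obtain t where "t \<le> time (\<lambda>_. m) c" "exec (compile c) s t (run c s)"
    using exec_compile[of c s "\<lambda>_. m"] assms by blast
  moreover have "time (\<lambda>_. m) c \<le> weight c * m ^ depth c" by (intro time_le) (use assms(4) in auto)
  ultimately show ?thesis by (meson order_trans)
qed

section \<open>Correctness and running time of the whole program\<close>

definition solver_weight :: nat where
  "solver_weight = weight LOAD + weight LENGTH + weight TABLES + weight MAIN"

definition solver_depth :: nat where
  "solver_depth = depth LOAD + depth LENGTH + depth TABLES + depth MAIN"

text \<open>The base of the power dominates every loop bound: \<open>n\<close>,
  \<open>k + 1\<close>, \<open>d + 1\<close>, the string length and the number of strings.\<close>

definition solver_time :: "nat \<Rightarrow> nat \<Rightarrow> nat \<Rightarrow> nat" where
  "solver_time n k d = solver_weight * (n + 3 ^ (10 * (k + 1) * (d + 1))) ^ solver_depth"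

lemma MAIN_bounds: "bounds MAIN \<subseteq> {mN, mL, mC}" and MAIN_fresh: "fresh MAIN"
  and MAIN_writes: "writes MAIN \<inter> {mN, mL, mC} = {}"
  by (auto simp: cmd_defs)

lemma less_pow3: "(a::nat) < 3 ^ a"
  by (induction a) auto

lemma solver_correct:
  assumes G: "pair_graph G" "pverts G = {..<n}"
  shows "decides_within solver (encode_instance n G k d) (quasi_forest_deletion (with_proj G) k d) (solver_time n k d)"
proof -
  interpret I: pair_instance G using G(1) by (simp add: pair_instance_def)
  interpret D: deletion_instance I.E n k d
  proof
    fix u v assume "I.E u v"
    then have "u \<in> pverts G" "v \<in> pverts G" unfolding I.E_def using I.wellformed' by blast+
    then show "u < n \<and> v < n" using G(2) by simp
  qed
  define l where "l = 10 * (k + 1) * (d + 1)"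
  define m where "m = n + 3 ^ l"
  let ?s = "encode_instance n G k d"
  define s1 where "s1 = run LOAD ?s"
  define s2 where "s2 = run LENGTH s1"
  define s3 where "s3 = run TABLES s2"
  have enc: "?s a i = 0" if "2 \<le> a" for a i using that unfolding encode_instance_def by simp
  have s1: "s1 mN 0 = n" "s1 mK 0 = k" "s1 mD 0 = d" "s1 mRows 0 = k + 1" "s1 mCols 0 = d + 1"
    unfolding s1_def LOAD_def by (simp_all add: encode_instance_def)
  have f1: "s1 a = ?s a" if "a \<notin> {mN, mK, mD, mRows, mCols}" for a
    unfolding s1_def by (rule run_frame) (use that in \<open>simp add: LOAD_def\<close>)
  have f2: "s2 a = s1 a" if "a \<notin> {mX, mY, mL}" for a
    unfolding s2_def by (rule run_frame) (use that in \<open>simp add: LENGTH_def\<close>)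
  have f3: "s3 a = s2 a" if "a \<notin> {mX, mC, mRow, mCnt}" for a
    unfolding s3_def by (rule run_frame) (use that in \<open>simp add: TABLES_def\<close>)
  have L: "s2 mL 0 = l"
    using run_LENGTH[of s1 "k + 1" "d + 1", OF s1(4,5)] f1[of mL] enc[of mL 0] unfolding s2_def[symmetric] l_def by simp
  have N2: "s2 mN 0 = n" using f2[of mN] s1 by simp
  have c2: "s2 mCnt 0 = 0" using f2[of mCnt] f1[of mCnt] enc[of mCnt 0] by simp
  note T = run_TABLES[of s2 n l, OF N2 L c2, folded s3_def]
  \<comment> \<open>Division by \<open>n\<close> recovers the row from the index, so no other pair
    of vertices can set this cell.\<close>
  have adj: "?s 1 (u * n + v) = of_bool (I.E u v)" if uv: "u < n" "v < n" for u v
  proof -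
    have "u' = u \<and> v' = v" if "u * n + v = u' * n + v'" "v' < n" for u' v'
    proof -
      have d: "(u * n + v) div n = u" "(u' * n + v') div n = u'" using uv that(2) by simp_all
      have "u = u'" using d(1)[unfolded that(1)] d(2) by (rule trans[OF sym])
      then show ?thesis using that(1) by simp
    qed
    then have "(\<exists>u'<n. \<exists>v'<n. u * n + v = u' * n + v' \<and> (u', v') \<in> parcs G) \<longleftrightarrow> I.E u v"
      unfolding I.E_def using uv by blast
    then show ?thesis unfolding encode_instance_def by simp
  qed
  have "s3 1 = ?s 1" using f1[of 1] f2[of 1] f3[of 1] by simp
  moreover have v3: "s3 mN 0 = n" "s3 mK 0 = k" "s3 mD 0 = d" "s3 mL 0 = l"
    using f2 f3 s1 L N2 by simp_all
  ultimately have fx: "D.fixed s3"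
    unfolding D.fixed_def D.graph_in_def D.str_len_def using T adj by (simp add: l_def)
  have "s3 mDig i = 0" for i using f1[of mDig] f2[of mDig] f3[of mDig] enc[of mDig i] by simp
  then have ans: "run MAIN s3 0 0 = of_bool (D.solvable n)" using D.run_MAIN[OF fx] by blast
  have "quasi_forest_deletion (with_proj G) k d \<longleftrightarrow> D.solvable n"
    using I.quasi_forest_deletion_iff G(2) unfolding D.solvable_def by simp
  then have ans': "run MAIN s3 0 0 = (if quasi_forest_deletion (with_proj G) k d then 1 else 0)"
    using ans by simp
  have m1: "1 \<le> m" unfolding m_def by (simp add: Suc_le_eq)
  have lm: "l < m" unfolding m_def using less_pow3[of l] by linarith
  have kd: "k + 1 \<le> l" "d + 1 \<le> l" unfolding l_def by (simp_all add: algebra_simps)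
  obtain t1 where t1: "t1 \<le> weight LOAD * m ^ depth LOAD" "exec (compile LOAD) ?s t1 s1"
    unfolding s1_def using exec_compile_le[of LOAD ?s m] m1 by (auto simp: LOAD_def)
  have b2: "s1 b 0 \<le> m" if "b \<in> bounds LENGTH" for b
    using that s1 kd lm by (auto simp: LENGTH_def)
  obtain t2 where t2: "t2 \<le> weight LENGTH * m ^ depth LENGTH" "exec (compile LENGTH) s1 t2 s2"
    unfolding s2_def using exec_compile_le[of LENGTH s1 m, OF _ _ b2 m1] by (auto simp: LENGTH_def)
  have b3: "s2 b 0 \<le> m" if "b \<in> bounds TABLES" for b
    using that N2 L lm by (auto simp: TABLES_def m_def)
  obtain t3 where t3: "t3 \<le> weight TABLES * m ^ depth TABLES" "exec (compile TABLES) s2 t3 s3"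
    unfolding s3_def using exec_compile_le[of TABLES s2 m, OF _ _ b3 m1] by (auto simp: TABLES_def)
  have b4: "s3 b 0 \<le> m" if b: "b \<in> bounds MAIN" for b
  proof -
    consider "b = mN" | "b = mL" | "b = mC" using subsetD[OF MAIN_bounds b] by auto
    then show ?thesis using v3 T(1) lm by cases (simp_all add: m_def)
  qed
  have "bounds MAIN \<inter> writes MAIN = {}" using MAIN_bounds MAIN_writes by blast
  from exec_compile_le[of MAIN s3 m, OF MAIN_fresh this b4 m1]
  obtain t4 where t4: "t4 \<le> weight MAIN * m ^ depth MAIN" "exec (compile MAIN) s3 t4 (run MAIN s3)" by blast
  have ex: "exec solver ?s (t1 + (t2 + (t3 + t4))) (run MAIN s3)"
    unfolding solver_def by (rule exec_SEQ[OF t1(2) exec_SEQ[OF t2(2) exec_SEQ[OF t3(2) t4(2)]]])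
  have pw: "w * m ^ e \<le> w * m ^ solver_depth" if "e \<le> solver_depth" for w e
    using that m1 by (intro mult_le_mono2 power_increasing)
  have "t1 + (t2 + (t3 + t4)) \<le> weight LOAD * m ^ solver_depth + weight LENGTH * m ^ solver_depth +
      weight TABLES * m ^ solver_depth + weight MAIN * m ^ solver_depth"
    using t1(1) t2(1) t3(1) t4(1) pw[of "depth LOAD" "weight LOAD"] pw[of "depth LENGTH" "weight LENGTH"]
      pw[of "depth TABLES" "weight TABLES"] pw[of "depth MAIN" "weight MAIN"]
    unfolding solver_depth_def by linarith
  also have "\<dots> = solver_time n k d"
    unfolding solver_time_def solver_weight_def m_def l_def by (simp add: distrib_right)
  finally show ?thesis unfolding decides_within_def using ex ans' by blast
qed

text \<open>With \<open>m = k + d\<close> the string length is at most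
  \<open>10 + 30 * (m * m)\<close>. The constant part goes into the polynomial, and the quadratic
  part has the required form with \<open>c\<^sub>2 = 1\<close>.\<close>

lemma solver_time_O_star:
  "solver_time \<in> O_star (\<lambda>k d. ((3 ^ (30 * solver_depth)) ^ (k + d)) ^ (1 * (k + d)))"
proof -
  let ?e = solver_depth
  let ?p = "smult (solver_weight * 3 ^ (10 * ?e)) ([:1, 1:] ^ ?e) :: nat poly"
  have "solver_time n k d \<le> ((3 ^ (30 * ?e)) ^ (k + d)) ^ (1 * (k + d)) * poly ?p n" for n k d
  proof -
    define m where "m = k + d"
    define l where "l = 10 * (k + 1) * (d + 1)"
    have "(k + 1) * (d + 1) \<le> (m + 1) * (m + 1)" unfolding m_def by (intro mult_le_mono) simp_all
    also have "\<dots> = m * m + 2 * m + 1" by (simp add: algebra_simps)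
    \<comment> \<open>For natural numbers \<open>m \<le> m * m\<close>, so the linear term is
      absorbed by the square.\<close>
    also have "\<dots> \<le> 1 + 3 * (m * m)" using le_square[of m] by linarith
    finally have l: "l \<le> 10 + 30 * (m * m)" unfolding l_def by linarith
    have "n + 3 ^ l \<le> (1 + n) * 3 ^ l" by (simp add: algebra_simps)
    also have "\<dots> \<le> (1 + n) * 3 ^ (10 + 30 * (m * m))" using l by (intro mult_le_mono2 power_increasing) simp_all
    finally have "(n + 3 ^ l) ^ ?e \<le> ((1 + n) * 3 ^ (10 + 30 * (m * m))) ^ ?e" by (rule power_mono) simp
    also have "\<dots> = (1 + n) ^ ?e * (3 ^ (10 + 30 * (m * m))) ^ ?e" by (rule power_mult_distrib)
    also have "((3::nat) ^ (10 + 30 * (m * m))) ^ ?e = 3 ^ (10 * ?e) * (3 ^ (30 * ?e)) ^ (m * m)"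
      unfolding power_mult[symmetric] power_add[symmetric]
      by (rule arg_cong[where f = "power 3"]) (simp add: algebra_simps)
    finally have "(n + 3 ^ l) ^ ?e \<le> (1 + n) ^ ?e * (3 ^ (10 * ?e) * (3 ^ (30 * ?e)) ^ (m * m))" .
    then have "solver_weight * (n + 3 ^ l) ^ ?e \<le> solver_weight * ((1 + n) ^ ?e * (3 ^ (10 * ?e) * (3 ^ (30 * ?e)) ^ (m * m)))"
      by (rule mult_le_mono2)
    also have "\<dots> = (3 ^ (30 * ?e)) ^ (m * m) * (solver_weight * 3 ^ (10 * ?e) * (1 + n) ^ ?e)"
      by (simp only: mult.assoc mult.commute mult.left_commute)
    also have "solver_weight * 3 ^ (10 * ?e) * (1 + n) ^ ?e = poly ?p n" by (simp add: poly_power)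
    also have "((3::nat) ^ (30 * ?e)) ^ (m * m) = ((3 ^ (30 * ?e)) ^ m) ^ (1 * m)"
      unfolding mult_1 by (rule power_mult)
    finally show ?thesis unfolding solver_time_def m_def l_def .
  qed
  then show ?thesis unfolding O_star_def by blast
qed

theorem theorem5:
  shows "\<exists>(c\<^sub>1 :: nat) (c\<^sub>2 :: nat) (P :: program).
    \<exists>T \<in> O_star (\<lambda>k d. (c\<^sub>1 ^ (k + d)) ^ (c\<^sub>2 * (k + d))).
      \<forall>(n :: nat) (k :: nat) (d :: nat) (G :: nat pair_pre_digraph).
        pair_graph G \<and> pverts G = {..<n} \<longrightarrow>
        decides_within P (encode_instance n G k d)
          (quasi_forest_deletion (with_proj G) k d) (T n k d)"
proof (rule exI[of _ "3 ^ (30 * solver_depth)"], rule exI[of _ 1], rule exI[of _ solver],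
    rule bexI[OF _ solver_time_O_star], intro allI impI, elim conjE)
  fix n k d :: nat and G :: "nat pair_pre_digraph"
  assume "pair_graph G" "pverts G = {..<n}"
  then show "decides_within solver (encode_instance n G k d) (quasi_forest_deletion (with_proj G) k d) (solver_time n k d)"
    by (rule solver_correct)
qed

end
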